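(* Let $\Gamma$ be a countable residually finite group, let $(\hat\Gamma,\mu_{\hat\Gamma})$ be its profinite completion with normalized Haar measure, with $\Gamma$ acting by left translation, and let $\lambda$ be Lebesgue measure on $[0,1]$. (1) If $\Gamma$ has property EMD, then the action $\Gamma\curvearrowright(\hat\Gamma,\mu_{\hat\Gamma})$ is existentially closed. (2) If $\Gamma$ has property MD, then the action $\Gamma\curvearrowright(\hat\Gamma\times[0,1],\mu_{\hat\Gamma}\times\lambda)$, where $\Gamma$ acts trivially on $[0,1]$, is existentially closed.
   Context: p.m.p. = probability measure-preserving. For $\alpha:Y\to p=\{0,\dots,p-1\}$ and finite $S\subseteq\Gamma$, $\alpha_S(y)(s)=\alpha(s^{-1}y)$. A factor map $\phi:(Y,\nu)\to(X,\mu)$ of p.m.p. actions is existentially closed if for all $p,q$, measurable $\alpha:Y\to p$, $\beta:X\to q$, finite $S$, $\epsilon>0$ there is measurable $\tilde\alpha:X\to p$ with $|\nu(\alpha_S^{-1}(\pi)\cap\phi^{-1}\beta^{-1}(j))-\mu(\tilde\alpha_S^{-1}(\pi)\cap\beta^{-1}(j))|<\epsilon$ for all $\pi,j$; an action is existentially closed if every factor map onto it from a p.m.p. action of $\Gamma$ is. A p.m.p. action on $(X,\mu)$ is profinite if there is a sequence of successively refining finite $\Gamma$-invariant measurable partitions of $X$ that separates points. For a standard non-atomic probability space $(X,\mu)$, $A(\Gamma,X,\mu)$ is the Polish space of p.m.p. actions of $\Gamma$ on $(X,\mu)$ (as a closed subspace of $\mathrm{Aut}(X,\mu)^\Gamma$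 with the weak topology). $\Gamma$ has property MD if profinite actions are dense in $A(\Gamma,X,\mu)$, and property EMD if ergodic profinite actions are dense in $A(\Gamma,X,\mu)$. *)

theory Defs
  imports
    "HOL-Algebra.Group_Action"
    "HOL-Algebra.Product_Groups"
    "HOL-Probability.Probability_Measure"
begin

section \<open>Probability measure-preserving actions\<close>

definition mp_auts :: "'a measure \<Rightarrow> ('a \<Rightarrow> 'a) set" where
  "mp_auts M = {T \<in> Bij (space M). T \<in> measurable M M \<and>
     inv_into (space M) T \<in> measurable M M \<and> distr M M T = M}"

text \<open>Neither standardness nor non-atomicity of the underlying probability space is required here.
  This matters for the profinite completion of a group that is not finitely generated, which can
  fail to be metrizable.\<close>

definition pmp_action :: "('g, 'm) monoid_scheme \<Rightarrow> 'a measure \<Rightarrow> ('g \<Rightarrow> 'a \<Rightarrow> 'a) \<Rightarrow> bool" where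
  "pmp_action G M a \<longleftrightarrow> prob_space M \<and> group_action G (space M) a \<and> (\<forall>g\<in>carrier G. a g \<in> mp_auts M)"

definition factor_map ::
  "('g, 'm) monoid_scheme \<Rightarrow> 'y measure \<Rightarrow> ('g \<Rightarrow> 'y \<Rightarrow> 'y) \<Rightarrow> 'x measure \<Rightarrow> ('g \<Rightarrow> 'x \<Rightarrow> 'x)
    \<Rightarrow> ('y \<Rightarrow> 'x) \<Rightarrow> bool" where
  "factor_map G Y b X a \<phi> \<longleftrightarrow> pmp_action G Y b \<and> pmp_action G X a \<and>
     \<phi> \<in> measurable Y X \<and> distr Y X \<phi> = X \<and>
     (\<forall>g\<in>carrier G. AE y in Y. \<phi> (b g y) = a g (\<phi> y))"

definition ergodic :: "('g, 'm) monoid_scheme \<Rightarrow> 'a measure \<Rightarrow> ('g \<Rightarrow> 'a \<Rightarrow> 'a) \<Rightarrow> bool" where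
  "ergodic G M a \<longleftrightarrow>
     (\<forall>A\<in>sets M. (\<forall>g\<in>carrier G. a g ` A = A) \<longrightarrow> measure M A = 0 \<or> measure M A = 1)"

text \<open>A finite partition is invariant if the group permutes its pieces.\<close>

definition profinite_action :: "('g, 'm) monoid_scheme \<Rightarrow> 'a measure \<Rightarrow> ('g \<Rightarrow> 'a \<Rightarrow> 'a) \<Rightarrow> bool" where
  "profinite_action G M a \<longleftrightarrow>
     (\<exists>P :: nat \<Rightarrow> 'a set set.
        (\<forall>n. partition_on (space M) (P n) \<and> finite (P n) \<and> P n \<subseteq> sets M \<and>
             (\<forall>g\<in>carrier G. \<forall>A\<in>P n. a g ` A \<in> P n)) \<and>
        (\<forall>n. refines (space M) (P (Suc n)) (P n)) \<and>
        (\<forall>x\<in>space M. \<forall>y\<in>space M. x \<noteq> y \<longrightarrow> (\<exists>n. \<exists>A\<in>P n. x \<in> A \<and> y \<notin> A)))"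


section \<open>Existentially closed factor maps and actions\<close>

text \<open>The map \<open>\<alpha>\<^sub>S\<close>, with values in the functions from \<open>S\<close> to \<open>{..<p}\<close>.\<close>

definition shift_map ::
  "('g, 'm) monoid_scheme \<Rightarrow> ('g \<Rightarrow> 'a \<Rightarrow> 'a) \<Rightarrow> ('a \<Rightarrow> nat) \<Rightarrow> 'g set \<Rightarrow> 'a \<Rightarrow> ('g \<Rightarrow> nat)" where
  "shift_map G a \<alpha> S y = (\<lambda>s\<in>S. \<alpha> (a (inv\<^bsub>G\<^esub> s) y))"

definition existentially_closed_map ::
  "('g, 'm) monoid_scheme \<Rightarrow> 'y measure \<Rightarrow> ('g \<Rightarrow> 'y \<Rightarrow> 'y) \<Rightarrow> 'x measure \<Rightarrow> ('g \<Rightarrow> 'x \<Rightarrow> 'x)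
    \<Rightarrow> ('y \<Rightarrow> 'x) \<Rightarrow> bool" where
  "existentially_closed_map G Y b X a \<phi> \<longleftrightarrow>
     (\<forall>p q :: nat. \<forall>\<alpha> \<in> measurable Y (count_space {..<p}). \<forall>\<beta> \<in> measurable X (count_space {..<q}).
      \<forall>S. finite S \<longrightarrow> S \<subseteq> carrier G \<longrightarrow> (\<forall>\<epsilon>>0.
        \<exists>\<alpha>' \<in> measurable X (count_space {..<p}).
          \<forall>\<pi> \<in> S \<rightarrow>\<^sub>E {..<p}. \<forall>j<q.
            \<bar>measure Y {y \<in> space Y. shift_map G b \<alpha> S y = \<pi> \<and> \<beta> (\<phi> y) = j}
              - measure X {x \<in> space X. shift_map G a \<alpha>' S x = \<pi> \<and> \<beta> x = j}\<bar> < \<epsilon>))"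

text \<open>HOL cannot quantify over types inside a definition, so the type \<open>'y\<close> of the points of the
  extension is a parameter; a theorem in which \<open>'y\<close> is free covers extensions on every type.\<close>

definition existentially_closed ::
  "'y itself \<Rightarrow> ('g, 'm) monoid_scheme \<Rightarrow> 'x measure \<Rightarrow> ('g \<Rightarrow> 'x \<Rightarrow> 'x) \<Rightarrow> bool" where
  "existentially_closed (_ :: 'y itself) G X a \<longleftrightarrow> pmp_action G X a \<and>
     (\<forall>(Y :: 'y measure) b \<phi>. factor_map G Y b X a \<phi> \<longrightarrow> existentially_closed_map G Y b X a \<phi>)"


section \<open>The space of actions, and the properties MD and EMD\<close>

definition is_borel_of :: "'a measure \<Rightarrow> 'a topology \<Rightarrow> bool" where
  "is_borel_of M T \<longleftrightarrow> space M = topspace T \<and> sets M = sigma_sets (topspace T) {U. openin T U}"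

definition standard_nonatomic :: "'a measure \<Rightarrow> bool" where
  "standard_nonatomic M \<longleftrightarrow> prob_space M \<and>
     (\<exists>T. completely_metrizable_space T \<and> second_countable T \<and> is_borel_of M T) \<and>
     (\<forall>x\<in>space M. emeasure M {x} = 0)"

text \<open>The weak topology is the coarsest one making every map \<open>T \<mapsto> T(A)\<close> into the measure algebra
  (with the metric \<open>\<mu>(A \<triangle> B)\<close>) continuous.

  Automorphisms are not identified modulo null sets here. Those that agree almost everywhere are
  topologically indistinguishable, so the usual space of actions is the Kolmogorov quotient of
  \<open>action_space\<close>, and a set is dense here iff its image in the quotient is dense. For a countable
  group every homomorphism into the automorphism group modulo null sets comes from a genuine
  pointwise action, and the pieces of an almost everywhere separating sequence of invariant
  partitions can be made separating by changing the action on an invariant null set.\<close>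

definition weak_topology :: "'a measure \<Rightarrow> ('a \<Rightarrow> 'a) topology" where
  "weak_topology M = topology_generated_by
     {{T \<in> mp_auts M. measure M (sym_diff (T ` A) (R ` A)) < \<epsilon>} | R A \<epsilon>.
        R \<in> mp_auts M \<and> A \<in> sets M \<and> (0::real) < \<epsilon>}"

definition action_space :: "('g, 'm) monoid_scheme \<Rightarrow> 'a measure \<Rightarrow> ('g \<Rightarrow> 'a \<Rightarrow> 'a) topology" where
  "action_space G M =
     subtopology (product_topology (\<lambda>_. weak_topology M) (carrier G)) {a. pmp_action G M a}"

text \<open>Up to isomorphism there is only one standard non-atomic probability space. Every standard
  Borel space has at most continuum many points, hence has an isomorphic copy whose points are
  reals; the Polish topology in \<open>standard_nonatomic\<close> need not be the usual one.\<close>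

definition property_MD :: "('g, 'm) monoid_scheme \<Rightarrow> bool" where
  "property_MD G \<longleftrightarrow> (\<forall>M :: real measure. standard_nonatomic M \<longrightarrow>
     action_space G M closure_of {a \<in> topspace (action_space G M). profinite_action G M a}
       = topspace (action_space G M))"

definition property_EMD :: "('g, 'm) monoid_scheme \<Rightarrow> bool" where
  "property_EMD G \<longleftrightarrow> (\<forall>M :: real measure. standard_nonatomic M \<longrightarrow>
     action_space G M closure_of
         {a \<in> topspace (action_space G M). ergodic G M a \<and> profinite_action G M a}
       = topspace (action_space G M))"


section \<open>The profinite completion\<close>

definition fin_index_normals :: "('g, 'm) monoid_scheme \<Rightarrow> 'g set set" where
  "fin_index_normals G = {N. N \<lhd> G \<and> finite (carrier (G Mod N))}"

definition residually_finite :: "('g, 'm) monoid_scheme \<Rightarrow> bool" where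
  "residually_finite G \<longleftrightarrow>
     (\<forall>g\<in>carrier G. g \<noteq> \<one>\<^bsub>G\<^esub> \<longrightarrow> (\<exists>N\<in>fin_index_normals G. g \<notin> N))"

text \<open>The inverse limit of the finite quotients. For \<open>N \<subseteq> M\<close> the bonding map from \<open>G Mod N\<close> to
  \<open>G Mod M\<close> sends a coset \<open>C\<close> of \<open>N\<close> to \<open>M <#> C\<close>.\<close>

definition profinite_completion :: "('g, 'm) monoid_scheme \<Rightarrow> ('g set \<Rightarrow> 'g set) monoid" where
  "profinite_completion G =
     (product_group (fin_index_normals G) (\<lambda>N. G Mod N))
       \<lparr>carrier := {x \<in> \<Pi>\<^sub>E N\<in>fin_index_normals G. carrier (G Mod N).
          \<forall>N\<in>fin_index_normals G. \<forall>M\<in>fin_index_normals G. N \<subseteq> M \<longrightarrow> M <#>\<^bsub>G\<^esub> x N = x M}\<rparr>"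

definition profinite_topology :: "('g, 'm) monoid_scheme \<Rightarrow> ('g set \<Rightarrow> 'g set) topology" where
  "profinite_topology G =
     subtopology (product_topology (\<lambda>N. discrete_topology (carrier (G Mod N))) (fin_index_normals G))
       (carrier (profinite_completion G))"

definition to_completion :: "('g, 'm) monoid_scheme \<Rightarrow> 'g \<Rightarrow> ('g set \<Rightarrow> 'g set)" where
  "to_completion G g = (\<lambda>N\<in>fin_index_normals G. N #>\<^bsub>G\<^esub> g)"

definition left_translation ::
  "('g, 'm) monoid_scheme \<Rightarrow> 'g \<Rightarrow> ('g set \<Rightarrow> 'g set) \<Rightarrow> ('g set \<Rightarrow> 'g set)" where
  "left_translation G g =
     (\<lambda>x\<in>carrier (profinite_completion G). to_completion G g \<otimes>\<^bsub>profinite_completion G\<^esub> x)"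

text \<open>The normalized Haar measure of a compact group \<open>K\<close> with topology \<open>T\<close>: the unique
  left-invariant Radon probability measure on the Borel sets. Regularity is automatic when \<open>T\<close> is
  metrizable.\<close>

definition normalized_haar_measure :: "('k, 'm) monoid_scheme \<Rightarrow> 'k topology \<Rightarrow> 'k measure \<Rightarrow> bool" where
  "normalized_haar_measure K T \<mu> \<longleftrightarrow> prob_space \<mu> \<and> is_borel_of \<mu> T \<and>
     (\<forall>x\<in>carrier K. \<forall>A\<in>sets \<mu>. emeasure \<mu> (x <#\<^bsub>K\<^esub> A) = emeasure \<mu> A) \<and>
     (\<forall>A\<in>sets \<mu>. emeasure \<mu> A = (INF U\<in>{U. openin T U \<and> A \<subseteq> U}. emeasure \<mu> U)) \<and>
     (\<forall>U. openin T U \<longrightarrow> emeasure \<mu> U = (SUP C\<in>{C. compactin T C \<and> C \<subseteq> U}. emeasure \<mu> C))"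

definition times_trivial :: "'x set \<Rightarrow> 't set \<Rightarrow> ('g \<Rightarrow> 'x \<Rightarrow> 'x) \<Rightarrow> 'g \<Rightarrow> 'x \<times> 't \<Rightarrow> 'x \<times> 't" where
  "times_trivial X I a g = (\<lambda>(x, t)\<in>X \<times> I. (a g x, t))"

end

theory Submission
  imports Defs "HOL-Probability.Probability"
begin

text \<open>Let \<open>\<phi> : Y \<rightarrow> X\<close> be an extension, where \<open>X\<close> is the completion (times the unit interval), and
  let \<open>\<psi> : Y \<rightarrow> I\<close> be the composition of \<open>\<phi>\<close> with a finite equivariant quotient \<open>I\<close> of \<open>X\<close>. Functions
  on \<open>X\<close> are approximated by functions of such quotients. An MD approximation of \<open>Y\<close> itself would only
  carry \<open>\<psi>\<close> approximately. Instead, let \<open>W\<close> be the product over \<open>j \<in> I\<close> of the fibres of \<open>\<psi>\<close>, on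
  which the group acts by \<open>(g s)(j) = g s(g\<^sup>-\<^sup>1 j)\<close>. Then \<open>(s, j) \<mapsto> s(j)\<close> makes \<open>Y\<close> a factor of \<open>W \<times> I\<close>
  over \<open>I\<close>, and MD approximates \<open>W\<close> by a finite weighted group set \<open>D\<close>, so that \<open>D \<times> I\<close>
  approximates \<open>Y\<close> over \<open>I\<close> with \<open>I\<close> kept exactly.

  It remains to map \<open>X\<close> to \<open>D\<close> almost equivariantly and almost independently of \<open>I\<close>. With the unit
  interval, let the profinite coordinate act on a random point of \<open>D\<close> read off the interval
  coordinate. Without it, EMD applied to a high power of \<open>D\<close> gives many almost equivariant, almost
  pairwise independent maps from the completion to \<open>D\<close>, and by Bessel's inequality one of them is
  almost independent of \<open>I\<close>.\<close>

section \<open>Approximation by finite-valued maps\<close>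

text \<open>Density is available only on standard non-atomic spaces of reals, while \<open>Y\<close>
  is arbitrary. Only the law of the translates of a finite-valued function matters, so an arbitrary
  action is replaced by a process on real sequences, made non-atomic by an independent uniform
  coordinate, and then carried into the reals. The completion may fail to be metrizable; regularity
  of Haar measure reduces its Borel sets to cylinders.

  What EMD adds is transitivity. An ergodic profinite model concentrates on one orbit, a transitive
  finite set has only one invariant probability, and so an orbit map from the completion has the
  correct law without any random choice. The diagonal action on a power of \<open>D\<close> need not
  be ergodic, yet EMD approximates it by ergodic actions. Independence of \<open>I\<close> cannot be
  imposed on a single such map, since \<open>I\<close> and the model are quotients of the same
  completion and may share a further quotient; averaging over the coordinates of the power provides
  it, since one event cannot correlate with many nearly orthogonal functions.\<close>

definition level_family :: "'a measure \<Rightarrow> ('a \<Rightarrow> 'd) set \<Rightarrow> bool" where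
  "level_family M L \<longleftrightarrow> L \<noteq> {} \<and> (\<forall>l\<in>L. l \<in> measurable M (count_space UNIV)) \<and>
     (\<forall>l\<in>L. \<forall>l'\<in>L. \<exists>k\<in>L. \<exists>u u'. \<forall>x\<in>space M. l x = u (k x) \<and> l' x = u' (k x))"

text \<open>The closure, in the pseudometric \<open>measure M (sym_diff A B)\<close>, of the sets
  that are unions of fibres of single members of \<open>L\<close>. For a \<open>level_family\<close>
  these unions form an algebra, because any two levels factor through a third one, and the closure
  is a sigma-algebra.\<close>

definition approx_set :: "'a measure \<Rightarrow> ('a \<Rightarrow> 'd) set \<Rightarrow> 'a set \<Rightarrow> bool" where
  "approx_set M L A \<longleftrightarrow> A \<in> sets M \<and>
     (\<forall>\<epsilon>>0. \<exists>l\<in>L. \<exists>E. measure M (sym_diff A {x\<in>space M. l x \<in> E}) < \<epsilon>)"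

lemma approx_setE:
  assumes "approx_set M L A" "0 < e"
  obtains l E where "l \<in> L" "measure M (sym_diff A {x\<in>space M. l x \<in> E}) < e"
proof -
  have "\<exists>l\<in>L. \<exists>E. measure M (sym_diff A {x\<in>space M. l x \<in> E}) < e"
    using assms by (simp only: approx_set_def)
  then show ?thesis by (elim bexE exE) (rule that)
qed

lemma level_familyE:
  assumes "level_family M L" "l \<in> L" "l' \<in> L"
  obtains k u u' where "k \<in> L" "\<forall>x\<in>space M. l x = u (k x) \<and> l' x = u' (k x)"
proof -
  have "\<exists>k\<in>L. \<exists>u u'. \<forall>x\<in>space M. l x = u (k x) \<and> l' x = u' (k x)"
    using assms by (simp only: level_family_def)
  then obtain k u u' where "k \<in> L" "\<forall>x\<in>space M. l x = u (k x) \<and> l' x = u' (k x)"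
    by (elim bexE exE)
  then show ?thesis by (rule that)
qed

lemma level_sets:
  assumes "level_family M L" "l \<in> L" shows "{x\<in>space M. l x \<in> E} \<in> sets M"
  using measurable_sets[of l M "count_space UNIV" E] assms
  by (auto simp: level_family_def vimage_def Int_def conj_commute)

lemma level_family_common:
  assumes "level_family M L" "\<And>j. j < (n::nat) \<Longrightarrow> l j \<in> L"
  shows "\<exists>k\<in>L. \<forall>j<n. \<exists>u. \<forall>x\<in>space M. l j x = u (k x)"
  using assms(2)
proof (induction n)
  case 0
  then show ?case using assms(1) by (auto simp: level_family_def)
next
  case (Suc n)
  then obtain k where k: "k \<in> L" "\<forall>j<n. \<exists>u. \<forall>x\<in>space M. l j x = u (k x)" by force
  obtain k' u u' where k': "k' \<in> L" "\<forall>x\<in>space M. k x = u (k' x) \<and> l n x = u' (k' x)"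
    by (rule level_familyE[OF assms(1) k(1) Suc.prems[of n, OF lessI]])
  have v: "\<exists>v. \<forall>x\<in>space M. l j x = v (k' x)" if "j < Suc n" for j
  proof (cases "j = n")
    case True then show ?thesis using k' by (intro exI[of _ u']) simp
  next
    case False
    then have "j < n" using that by simp
    with k(2) obtain v where "\<forall>x\<in>space M. l j x = v (k x)" by (elim allE[of _ j] impE exE) auto
    then show ?thesis using k' by (intro exI[of _ "v \<circ> u"]) auto
  qed
  show ?case by (rule bexI[OF _ k'(1)]) (simp add: v)
qed

lemma (in finite_measure) approx_set_Diff:
  assumes "level_family M L" "approx_set M L A"
  shows "approx_set M L (space M - A)"
  unfolding approx_set_def
proof safe
  show "space M - A \<in> sets M" using assms by (auto simp: approx_set_def)
  fix e :: real assume "0 < e"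
  then obtain l E where l: "l \<in> L" "measure M (sym_diff A {x\<in>space M. l x \<in> E}) < e"
    using assms by (auto simp: approx_set_def)
  have "A \<subseteq> space M" using assms sets.sets_into_space by (auto simp: approx_set_def)
  then have "sym_diff (space M - A) {x\<in>space M. l x \<in> - E} = sym_diff A {x\<in>space M. l x \<in> E}"
    by auto
  then show "\<exists>l\<in>L. \<exists>E. measure M (sym_diff (space M - A) {x\<in>space M. l x \<in> E}) < e"
    using l by (intro bexI[OF _ l(1)] exI[of _ "- E"]) (simp only:)
qed

text \<open>A common refinement \<open>k\<close> of the two levels carries both approximating sets,
  and the symmetric difference of unions is covered by the two given ones.\<close>

lemma (in finite_measure) approx_set_Un:
  assumes L: "level_family M L" and A: "approx_set M L A" and B: "approx_set M L B"
  shows "approx_set M L (A \<union> B)"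
  unfolding approx_set_def
proof safe
  show "A \<union> B \<in> sets M" using A B by (auto simp: approx_set_def)
  fix e :: real assume "0 < e"
  then have e2: "e / 2 > 0" by simp
  obtain l E where l: "l \<in> L" "measure M (sym_diff A {x\<in>space M. l x \<in> E}) < e / 2"
    by (rule approx_setE[OF A e2])
  obtain l' E' where l': "l' \<in> L" "measure M (sym_diff B {x\<in>space M. l' x \<in> E'}) < e / 2"
    by (rule approx_setE[OF B e2])
  obtain k u u' where k: "k \<in> L" "\<forall>x\<in>space M. l x = u (k x) \<and> l' x = u' (k x)"
    by (rule level_familyE[OF L l(1) l'(1)])
  let ?F = "u -` E \<union> u' -` E'"
  have [measurable]: "A \<in> sets M" "B \<in> sets M" using A B by (auto simp: approx_set_def)
  have s: "{x\<in>space M. l x \<in> E} \<in> sets M" "{x\<in>space M. l' x \<in> E'} \<in> sets M"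
    using level_sets[OF L] l l' by auto
  have "sym_diff (A \<union> B) {x\<in>space M. k x \<in> ?F} \<subseteq>
     sym_diff A {x\<in>space M. l x \<in> E} \<union> sym_diff B {x\<in>space M. l' x \<in> E'}"
    using k by auto
  then have "measure M (sym_diff (A \<union> B) {x\<in>space M. k x \<in> ?F}) \<le>
     measure M (sym_diff A {x\<in>space M. l x \<in> E} \<union> sym_diff B {x\<in>space M. l' x \<in> E'})"
    using s by (intro finite_measure_mono) auto
  also have "\<dots> \<le> measure M (sym_diff A {x\<in>space M. l x \<in> E}) + measure M (sym_diff B {x\<in>space M. l' x \<in> E'})"
    using s by (intro measure_Un_le) auto
  also have "\<dots> < e" using l l' by simp
  finally show "\<exists>l\<in>L. \<exists>E. measure M (sym_diff (A \<union> B) {x\<in>space M. l x \<in> E}) < e"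
    by (intro bexI[OF _ k(1)] exI[of _ ?F])
qed

text \<open>Continuity from below reduces the countable union to a finite one at the cost of
  \<open>e / 2\<close>; the other half is spent on approximating the finite union.\<close>

lemma (in finite_measure) approx_set_UN:
  assumes L: "level_family M L" and A: "\<And>i::nat. approx_set M L (A i)"
  shows "approx_set M L (\<Union>i. A i)"
proof -
  have As: "A i \<in> sets M" for i using A by (auto simp: approx_set_def)
  have fin: "approx_set M L (\<Union>i\<le>n. A i)" for n
  proof (induction n)
    case 0 then show ?case using A by simp
  next
    case (Suc n)
    then show ?case using approx_set_Un[OF L Suc A[of "Suc n"]] by (simp add: atMost_Suc Un_commute)
  qed
  have "\<exists>l\<in>L. \<exists>E. measure M (sym_diff (\<Union>i. A i) {x\<in>space M. l x \<in> E}) < e" if e0: "e > 0" for e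
  proof -
    have "(\<lambda>n. measure M (\<Union>i\<le>n. A i)) \<longlonglongrightarrow> measure M (\<Union>n. \<Union>i\<le>n. A i)"
      using As by (intro finite_Lim_measure_incseq) (auto simp: incseq_def intro: order_trans)
    also have "(\<Union>n. \<Union>i\<le>n. A i) = (\<Union>i. A i)" by auto
    finally have "\<forall>\<^sub>F n in sequentially. measure M (\<Union>i. A i) - e / 2 < measure M (\<Union>i\<le>n. A i)"
      using that by (intro order_tendstoD(1)) auto
    then obtain n where n: "measure M (\<Union>i. A i) - e / 2 < measure M (\<Union>i\<le>n. A i)"
      by (auto simp: eventually_sequentially)
    obtain l E where l: "l \<in> L" "measure M (sym_diff (\<Union>i\<le>n. A i) {x\<in>space M. l x \<in> E}) < e / 2"
      by (rule approx_setE[OF fin[of n], of "e / 2"]) (use e0 in auto)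
    have s: "{x\<in>space M. l x \<in> E} \<in> sets M" using level_sets[OF L] l by auto
    have U: "(\<Union>i. A i) \<in> sets M" "(\<Union>i\<le>n. A i) \<in> sets M" using As by auto
    have "measure M (sym_diff (\<Union>i. A i) {x\<in>space M. l x \<in> E}) \<le>
       measure M (((\<Union>i. A i) - (\<Union>i\<le>n. A i)) \<union> sym_diff (\<Union>i\<le>n. A i) {x\<in>space M. l x \<in> E})"
      using s U by (intro finite_measure_mono) auto
    also have "\<dots> \<le> measure M ((\<Union>i. A i) - (\<Union>i\<le>n. A i)) + measure M (sym_diff (\<Union>i\<le>n. A i) {x\<in>space M. l x \<in> E})"
      using s U by (intro measure_Un_le) auto
    also have "measure M ((\<Union>i. A i) - (\<Union>i\<le>n. A i)) = measure M (\<Union>i. A i) - measure M (\<Union>i\<le>n. A i)"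
      using U by (intro finite_measure_Diff) auto
    finally show ?thesis using l n by (intro bexI[OF _ l(1)] exI[of _ E]) linarith
  qed
  then show ?thesis using As by (auto simp: approx_set_def)
qed

lemma (in finite_measure) approx_set_sigma_sets:
  assumes L: "level_family M L" and G: "\<And>A. A \<in> G \<Longrightarrow> approx_set M L A"
    and A: "A \<in> sigma_sets (space M) G"
  shows "approx_set M L A"
  using A
proof induction
  case (Basic a) then show ?case by (rule G)
next
  case Empty
  obtain l where "l \<in> L" using L by (auto simp: level_family_def)
  then show ?case by (auto simp: approx_set_def intro!: bexI[of _ l] exI[of _ "{}"])
next
  case (Compl a) then show ?case by (intro approx_set_Diff[OF L])
next
  case (Union a) then show ?case by (intro approx_set_UN[OF L])
qed

text \<open>Each fibre of \<open>f\<close> is approximated within \<open>e / k\<close>, and all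
  \<open>k\<close> approximations are moved to one common level \<open>h\<close>. Reading off the
  fibre to which a value of \<open>h\<close> is assigned gives \<open>u\<close>; wherever
  \<open>u (h x)\<close> is wrong, \<open>x\<close> lies in one of the \<open>k\<close> symmetric
  differences.\<close>

lemma (in finite_measure) approx_fun:
  assumes L: "level_family M L" and k: "k > 0" and f: "f \<in> measurable M (count_space {..<k::nat})"
    and A: "\<And>j. j < k \<Longrightarrow> approx_set M L {x\<in>space M. f x = j}" and e: "e > 0"
  shows "\<exists>l\<in>L. \<exists>u. (\<forall>d. u d < k) \<and> measure M {x\<in>space M. f x \<noteq> u (l x)} < e"
proof -
  define P where "P j p \<longleftrightarrow> fst p \<in> L \<and>
    measure M (sym_diff {x\<in>space M. f x = j} {x\<in>space M. fst p x \<in> snd p}) < e / k" for j p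
  have "\<exists>p. P j p" if j: "j < k" for j
  proof -
    obtain l E where "l \<in> L" "measure M (sym_diff {x\<in>space M. f x = j} {x\<in>space M. l x \<in> E}) < e / k"
      by (rule approx_setE[OF A[OF j], of "e / k"]) (use e k in auto)
    then show ?thesis by (intro exI[of _ "(l, E)"]) (simp add: P_def)
  qed
  then have P: "P j (SOME p. P j p)" if "j < k" for j using that by (intro someI_ex[of "P j"]) simp
  define l where "l j = fst (SOME p. P j p)" for j
  define E where "E j = snd (SOME p. P j p)" for j
  have lE: "l j \<in> L" "measure M (sym_diff {x\<in>space M. f x = j} {x\<in>space M. l j x \<in> E j}) < e / k"
    if "j < k" for j
    using P[OF that] by (simp_all add: P_def l_def E_def)
  obtain h where h: "h \<in> L" "\<forall>j<k. \<exists>v. \<forall>x\<in>space M. l j x = v (h x)"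
    using level_family_common[where l=l and n=k, OF L lE(1)] by auto
  define v where "v j = (SOME v. \<forall>x\<in>space M. l j x = v (h x))" for j
  have "\<forall>x\<in>space M. l j x = v j (h x)" if "j < k" for j
    unfolding v_def
    by (rule someI_ex[where P = "\<lambda>v. \<forall>x\<in>space M. l j x = v (h x)"]) (use h(2) that in simp)
  then have v: "l j x = v j (h x)" if "j < k" "x \<in> space M" for j x using that by simp
  \<comment> \<open>The approximating sets need neither be disjoint nor cover the space: the least
    index settles overlaps and 0 is the value in the gaps. Both cases occur only inside the union of
    the symmetric differences.\<close>
  define u where "u d = (if \<exists>j<k. v j d \<in> E j then LEAST j. j < k \<and> v j d \<in> E j else 0)" for d
  have u: "u d < k" for d
    using k by (auto simp: u_def dest!: LeastI_ex[of "\<lambda>j. j < k \<and> v j d \<in> E j"])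
  let ?D = "\<lambda>j. sym_diff {x\<in>space M. f x = j} {x\<in>space M. l j x \<in> E j}"
  have fs: "{x\<in>space M. f x = j} \<in> sets M" if "j < k" for j
    using A[OF that] by (auto simp: approx_set_def)
  have D: "?D j \<in> sets M" if "j < k" for j
    using fs[OF that] level_sets[OF L lE(1)[OF that]] by auto
  have "{x\<in>space M. f x \<noteq> u (h x)} \<subseteq> (\<Union>j<k. ?D j)"
  proof (rule subsetI, rule ccontr)
    fix x assume "x \<in> {x\<in>space M. f x \<noteq> u (h x)}" and n: "x \<notin> (\<Union>j<k. ?D j)"
    then have x: "x \<in> space M" "f x \<noteq> u (h x)" by auto
    have fx: "f x < k" using measurable_space[OF f x(1)] by simp
    have *: "v j (h x) \<in> E j \<longleftrightarrow> j = f x" if "j < k" for j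
    proof -
      have "x \<notin> ?D j"
      proof
        assume "x \<in> ?D j"
        then have "x \<in> (\<Union>j<k. ?D j)" using that by (intro UN_I[of j] lessThan_iff[THEN iffD2])
        with n show False ..
      qed
      then have "l j x \<in> E j \<longleftrightarrow> f x = j" using x(1) by blast
      then show ?thesis using v[OF that x(1)] by auto
    qed
    have "u (h x) = (LEAST j. j < k \<and> v j (h x) \<in> E j)"
      using fx *[OF fx] by (auto simp: u_def)
    also have "\<dots> = f x" using fx * by (intro Least_equality) auto
    finally show False using x by simp
  qed
  moreover have "(\<Union>j<k. ?D j) \<in> sets M" using D by auto
  ultimately have "measure M {x\<in>space M. f x \<noteq> u (h x)} \<le> measure M (\<Union>j<k. ?D j)"
    by (intro finite_measure_mono)
  also have "\<dots> \<le> (\<Sum>j<k. measure M (?D j))"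
    using D by (intro measure_UNION_le) auto
  also have "\<dots> < (\<Sum>j<k. e / k)" using lE(2) k by (intro sum_strict_mono) auto
  also have "\<dots> = e" using k by simp
  finally show ?thesis using u by (intro bexI[OF _ h(1)] exI[of _ u]) simp
qed

text \<open>Disjoint compact sets on which all the maps \<open>l n\<close> are continuous are separated by a single
  \<open>l n\<close>. This replaces the theorem that a separating sequence of Borel sets generates the Borel
  sets of a Polish space.\<close>

lemma approx_set_polish:
  fixes M :: "'a::polish_space measure" and l :: "nat \<Rightarrow> 'a \<Rightarrow> 'd"
  assumes fin: "finite_measure M" and sb: "sets M = sets borel"
    and range: "\<And>n. finite (range (l n))" and meas: "\<And>n d. l n -` {d} \<in> sets M"
    and ref: "\<And>n. \<exists>u. \<forall>x. l n x = u (l (Suc n) x)"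
    and sep: "\<And>x y. x \<noteq> y \<Longrightarrow> \<exists>n. l n x \<noteq> l n y"
  shows "level_family M (range l)" and "A \<in> sets M \<Longrightarrow> approx_set M (range l) A"
proof -
  interpret finite_measure M by fact
  have sp[simp]: "space M = UNIV" using sets_eq_imp_space_eq[OF sb] by simp
  have le: "\<exists>u. \<forall>x. l n x = u (l (n + i) x)" for n i
  proof (induction i)
    case 0 show ?case by (auto intro!: exI[of _ id])
  next
    case (Suc i)
    obtain u where u: "\<forall>x. l n x = u (l (n + i) x)" using Suc by blast
    obtain v where v: "\<forall>x. l (n+i) x = v (l (Suc (n+i)) x)" using ref by blast
    then show ?case using u by (intro exI[of _ "u \<circ> v"]) simp
  qed
  have lm: "{x. l n x \<in> E} \<in> sets M" for n E
  proof -
    have "{x. l n x \<in> E} = (\<Union>d\<in>range (l n) \<inter> E. l n -` {d})" by auto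
    also have "\<dots> \<in> sets M" using range[of n] meas by (intro sets.finite_UN) auto
    finally show ?thesis .
  qed
  show lf: "level_family M (range l)"
    unfolding level_family_def
  proof (intro conjI ballI)
    fix a b assume "a \<in> range l" "b \<in> range l"
    then obtain n m where nm: "a = l n" "b = l m" by auto
    obtain u where "\<forall>x. l n x = u (l (n + m) x)" using le by metis
    moreover obtain v where "\<forall>x. l m x = v (l (n + m) x)" using le[of m n] by (auto simp: add.commute)
    ultimately show "\<exists>k\<in>range l. \<exists>u u'. \<forall>x\<in>space M. a x = u (k x) \<and> b x = u' (k x)"
      using nm by (intro bexI[of _ "l (n + m)"] exI[of _ u] exI[of _ v]) auto
  next
    fix a assume "a \<in> range l"
    then show "a \<in> measurable M (count_space UNIV)" using lm
      by (auto simp: measurable_def vimage_def)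
  qed auto
  assume A: "A \<in> sets M"
  have inner: "\<exists>K. K \<subseteq> B \<and> compact K \<and> measure M B - measure M K < e" if B: "B \<in> sets M" and e: "e > 0" for B e
  proof (rule ccontr)
    assume n: "\<not> ?thesis"
    have "emeasure M B = (SUP K\<in>{K. K \<subseteq> B \<and> compact K}. emeasure M K)"
      using B sb by (intro inner_regular) auto
    also have "\<dots> \<le> ennreal (measure M B - e)"
    proof (rule SUP_least)
      fix K assume K: "K \<in> {K. K \<subseteq> B \<and> compact K}"
      then have "measure M B - measure M K \<ge> e" using n by force
      then have "measure M K \<le> measure M B - e" by simp
      then show "emeasure M K \<le> ennreal (measure M B - e)"
        by (simp add: emeasure_eq_measure ennreal_leI)
    qed
    \<comment> \<open>\<open>ennreal\<close> truncates negative numbers, so a set of measure below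
      \<open>e\<close> is not refuted at once. It gets measure zero, and then the empty compact set
      contradicts the assumption.\<close>
    finally have "measure M B \<le> max 0 (measure M B - e)"
      by (auto simp add: emeasure_eq_measure ennreal_le_iff2 max_def)
    then have "measure M B = 0" using e
      by (smt (verit) measure_nonneg)
    then show False using n e by (metis compact_empty diff_0_right empty_subsetI measure_empty)
  qed
  have cs: "compact K \<Longrightarrow> K \<in> sets M" for K using sb by (simp add: borel_closed compact_imp_closed)
  have "\<exists>l\<in>range l. \<exists>E. measure M (sym_diff A {x\<in>space M. l x \<in> E}) < e" if e0: "e > 0" for e
  proof -
    obtain K1 where K1: "K1 \<subseteq> A" "compact K1" "measure M A - measure M K1 < e/4"
      using inner[OF A, of "e/4"] e0 by auto
    obtain K2 where K2: "K2 \<subseteq> - A" "compact K2" "measure M (- A) - measure M K2 < e/4"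
      using inner[of "- A" "e/4"] e0 A by (auto simp: Compl_eq_Diff_UNIV simp flip: sp)
    \<comment> \<open>The argument of Lusin's theorem: each fibre of \<open>l n\<close> is shrunk to
      a compact set. On their finite disjoint union \<open>C n\<close> the map \<open>l n\<close> is
      continuous. The errors over the fibres add up to \<open>e/4 * (1/2)^(Suc n)\<close>, and over
      all \<open>n\<close> to \<open>e/4\<close>.\<close>
    have "\<exists>K. K \<subseteq> l n -` {d} \<and> compact K \<and>
        measure M (l n -` {d}) - measure M K < e/4 * (1/2)^(Suc n) / (card (range (l n)))" for n d
      using e0 range[of n] by (intro inner meas) (auto simp: card_gt_0_iff)
    then obtain K where K: "\<And>n d. K n d \<subseteq> l n -` {d}" "\<And>n d. compact (K n d)"
      "\<And>n d. measure M (l n -` {d}) - measure M (K n d) < e/4 * (1/2)^(Suc n) / (card (range (l n)))"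
      by metis
    define C where "C n = (\<Union>d\<in>range (l n). K n d)" for n
    have C: "compact (C n)" for n unfolding C_def using K range by (intro compact_UN) auto
    have mC: "measure M (- C n) \<le> e/4 * (1/2)^(Suc n)" for n
    proof -
      have "- C n \<subseteq> (\<Union>d\<in>range (l n). l n -` {d} - K n d)" by (auto simp: C_def)
      then have "measure M (- C n) \<le> measure M (\<Union>d\<in>range (l n). l n -` {d} - K n d)"
        using range[of n] meas cs[OF K(2)] by (intro finite_measure_mono sets.finite_UN) auto
      also have "\<dots> \<le> (\<Sum>d\<in>range (l n). measure M (l n -` {d} - K n d))"
        using range[of n] meas cs[OF K(2)] by (intro measure_UNION_le) auto
      also have "\<dots> \<le> (\<Sum>d\<in>range (l n). e/4 * (1/2)^(Suc n) / (card (range (l n))))"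
        using meas cs[OF K(2)] K by (intro sum_mono) (simp add: finite_measure_Diff less_imp_le)
      also have "\<dots> = e/4 * (1/2)^(Suc n)" using range[of n] by (simp add: card_gt_0_iff)
      finally show ?thesis .
    qed
    define CC where "CC = (\<Inter>n. C n)"
    have CC: "closed CC" unfolding CC_def using C compact_imp_closed by blast
    have mCC: "measure M (- CC) \<le> e/4"
    proof -
      have "- CC = (\<Union>n. - C n)" by (auto simp: CC_def)
      then have "measure M (- CC) = measure M (\<Union>n. - C n)" by simp
      also have "\<dots> \<le> (\<Sum>n. measure M (- C n))"
      proof (rule finite_measure_subadditive_countably)
        show "range (\<lambda>n. - C n) \<subseteq> sets M" using cs[OF C] by (auto simp: Compl_eq_Diff_UNIV simp flip: sp)
        show "summable (\<lambda>i. measure M (- C i))"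
        proof (rule summable_comparison_test_ev)
          show "\<forall>\<^sub>F n in sequentially. norm (measure M (- C n)) \<le> e/4 * (1/2)^(Suc n)" using mC by simp
          show "summable (\<lambda>n. e/4 * (1/2)^(Suc n))"
            by (intro summable_mult sums_summable[OF power_half_series])
        qed
      qed
      also have "\<dots> \<le> (\<Sum>n. e/4 * (1/2)^(Suc n))"
      proof (rule suminf_le)
        show s: "summable (\<lambda>n. e/4 * (1/2)^(Suc n))"
            by (intro summable_mult sums_summable[OF power_half_series])
        show "summable (\<lambda>i. measure M (- C i))"
          by (rule summable_comparison_test_ev[OF _ s]) (use mC in simp)
      qed (use mC in auto)
      also have "\<dots> = e/4"
        using sums_mult[OF power_half_series, of "e/4"] by (simp add: sums_iff)
      finally show ?thesis .
    qed
    \<comment> \<open>The pairs from \<open>K1\<close> and \<open>K2\<close> inside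
      \<open>CC\<close> that level \<open>n\<close> does not yet separate. These sets are closed in
      a compact product and decrease in \<open>n\<close>; since \<open>K1\<close> and
      \<open>K2\<close> are disjoint and the levels separate points, their intersection is empty, so
      one of them is.\<close>
    define Q where "Q n = {(x, y). x \<in> K1 \<inter> CC \<and> y \<in> K2 \<inter> CC \<and> l n x = l n y}" for n
    have Qc: "closed (Q n)" for n
    proof -
      have "Q n = ((K1 \<inter> CC) \<times> (K2 \<inter> CC)) \<inter> (\<Union>d\<in>range (l n). K n d \<times> K n d)"
      proof -
        have kl: "x \<in> K n (l n x)" if "x \<in> CC" for x
        proof -
          have "x \<in> C n" using that by (auto simp: CC_def)
          then obtain y where y: "x \<in> K n (l n y)" by (auto simp: C_def)
          then have "l n x = l n y" using K(1)[of n "l n y"] by auto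
          then show ?thesis using y by simp
        qed
        have lk: "l n x = d" if "x \<in> K n d" for x d using that K(1)[of n d] by auto
        have "(x, y) \<in> (\<Union>d\<in>range (l n). K n d \<times> K n d)"
          if "x \<in> CC" "y \<in> CC" "l n x = l n y" for x y
          using kl[OF that(1)] kl[OF that(2)] that(3) by (intro UN_I[of "l n x"]) auto
        moreover have "l n x = l n y" if "(x, y) \<in> (\<Union>d\<in>range (l n). K n d \<times> K n d)" for x y
          using that lk by auto
        ultimately have iff: "(x, y) \<in> (\<Union>d\<in>range (l n). K n d \<times> K n d) \<longleftrightarrow> l n x = l n y"
          if "x \<in> CC" "y \<in> CC" for x y using that by metis
        show ?thesis
        proof (rule Set.set_eqI)
          fix z :: "'a \<times> 'a"
          obtain x y where z: "z = (x, y)" by (cases z)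
          show "z \<in> Q n \<longleftrightarrow> z \<in> ((K1 \<inter> CC) \<times> (K2 \<inter> CC)) \<inter> (\<Union>d\<in>range (l n). K n d \<times> K n d)"
            unfolding z Q_def Int_iff[of "(x, y)"] mem_Collect_eq prod.case mem_Times_iff fst_conv snd_conv
            using iff[of x y] by (simp only: Int_iff) blast
        qed
      qed
      moreover have "closed ((\<Union>d\<in>range (l n). K n d \<times> K n d))"
        using range K(2) by (intro closed_UN ballI closed_Times compact_imp_closed) auto
      moreover have "closed ((K1 \<inter> CC) \<times> (K2 \<inter> CC))"
        using compact_imp_closed[OF K1(2)] compact_imp_closed[OF K2(2)] CC
        by (intro closed_Times closed_Int)
      ultimately show ?thesis by (simp only: closed_Int)
    qed
    have "\<exists>n. Q n = {}"
    proof (rule ccontr)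
      assume ne: "\<nexists>n. Q n = {}"
      have "(K1 \<times> K2) \<inter> \<Inter>(range Q) \<noteq> {}"
      proof (rule compact_imp_fip)
        show "compact (K1 \<times> K2)" using K1 K2 by (intro compact_Times)
        show "\<And>T. T \<in> range Q \<Longrightarrow> closed T" using Qc by auto
        fix F' assume F': "finite F'" "F' \<subseteq> range Q"
        then obtain N where N: "finite N" "F' = Q ` N" by (meson finite_subset_image)
        define n where "n = Max (insert 0 N)"
        have "Q n \<subseteq> Q m" if "m \<in> N" for m
        proof -
          have "m \<le> n" using N that by (auto simp: n_def)
          then obtain u where "\<forall>x. l m x = u (l n x)" using le[of m "n - m"] by auto
          then show ?thesis by (auto simp: Q_def)
        qed
        moreover have "Q n \<noteq> {}" "Q n \<subseteq> K1 \<times> K2" using ne by (auto simp: Q_def)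
        ultimately show "(K1 \<times> K2) \<inter> \<Inter>F' \<noteq> {}" using N by blast
      qed
      then obtain x y where xy: "\<And>n. (x, y) \<in> Q n" by auto
      then have "x = y" using sep[of x y] by (auto simp: Q_def)
      then show False using xy[of 0] K1 K2 by (auto simp: Q_def)
    qed
    then obtain n where n: "Q n = {}" by blast
    \<comment> \<open>At this level no point of \<open>K2\<close> in \<open>CC\<close> shares its
      value with a point of \<open>K1\<close> in \<open>CC\<close>. Errors can therefore occur only
      in the three discarded sets, each of measure at most \<open>e/4\<close>.\<close>
    define E where "E = l n ` (K1 \<inter> CC)"
    have "sym_diff A {x. l n x \<in> E} \<subseteq> (A - K1) \<union> ((- A) - K2) \<union> (- CC)"
    proof (intro subsetI, rule ccontr)
      fix x assume x: "x \<in> sym_diff A {x. l n x \<in> E}" "x \<notin> (A - K1) \<union> ((- A) - K2) \<union> (- CC)"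
      then have xC: "x \<in> CC" and xA: "x \<in> A \<longleftrightarrow> l n x \<notin> E" and x1: "x \<in> A \<Longrightarrow> x \<in> K1"
        and x2: "x \<notin> A \<Longrightarrow> x \<in> K2" by blast+
      show False
      proof (cases "x \<in> A")
        case True
        then show False using xA x1 xC by (auto simp: E_def)
      next
        case False
        then obtain y where "y \<in> K1" "y \<in> CC" "l n x = l n y" using xA by (auto simp: E_def)
        then have "(y, x) \<in> Q n" using x2[OF False] xC by (simp add: Q_def)
        then show False using n by simp
      qed
    qed
    then have "measure M (sym_diff A {x. l n x \<in> E}) \<le> measure M ((A - K1) \<union> ((- A) - K2) \<union> (- CC))"
      using A cs[OF K1(2)] cs[OF K2(2)] CC sb by (intro finite_measure_mono) auto
    also have "\<dots> \<le> measure M ((A - K1) \<union> ((- A) - K2)) + measure M (- CC)"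
      using A cs[OF K1(2)] cs[OF K2(2)] CC sb by (intro measure_Un_le) auto
    also have "measure M ((A - K1) \<union> ((- A) - K2)) \<le> measure M (A - K1) + measure M ((- A) - K2)"
      using A cs[OF K1(2)] cs[OF K2(2)] CC sb by (intro measure_Un_le) auto
    also have "measure M (A - K1) = measure M A - measure M K1"
      using A cs[OF K1(2)] K1 by (intro finite_measure_Diff)
    also have "measure M (- A - K2) = measure M (- A) - measure M K2"
      using A cs[OF K2(2)] K2 sb by (intro finite_measure_Diff) auto
    finally have "measure M (sym_diff A {x. l n x \<in> E}) < e" using K1 K2 mCC e0 by linarith
    then show ?thesis by auto
  qed
  then show "approx_set M (range l) A" using A by (auto simp: approx_set_def)
qed

section \<open>Measure-preserving actions and density\<close>

lemma pmp_actionI: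
  assumes G: "group G" and M: "prob_space M"
    and ext: "\<And>g. g \<in> carrier G \<Longrightarrow> a g \<in> extensional (space M)"
    and meas: "\<And>g. g \<in> carrier G \<Longrightarrow> a g \<in> measurable M M"
    and distr: "\<And>g. g \<in> carrier G \<Longrightarrow> distr M M (a g) = M"
    and one: "\<And>x. x \<in> space M \<Longrightarrow> a \<one>\<^bsub>G\<^esub> x = x"
    and mult: "\<And>g h x. g \<in> carrier G \<Longrightarrow> h \<in> carrier G \<Longrightarrow> x \<in> space M \<Longrightarrow> a (g \<otimes>\<^bsub>G\<^esub> h) x = a g (a h x)"
  shows "pmp_action G M a"
proof -
  interpret group G by fact
  have sp: "a g x \<in> space M" if "g \<in> carrier G" "x \<in> space M" for g x
    using measurable_space[OF meas[OF that(1)] that(2)] .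
  have inv: "a g (a (inv\<^bsub>G\<^esub> g) x) = x" "a (inv\<^bsub>G\<^esub> g) (a g x) = x" if "g \<in> carrier G" "x \<in> space M" for g x
    using that mult[of g "inv\<^bsub>G\<^esub> g" x] mult[of "inv\<^bsub>G\<^esub> g" g x] one by simp_all
  have bij: "bij_betw (a g) (space M) (space M)" if "g \<in> carrier G" for g
    by (rule bij_betw_byWitness[where f' = "a (inv\<^bsub>G\<^esub> g)"]) (use that inv sp in auto)
  then have Bij: "a g \<in> Bij (space M)" if "g \<in> carrier G" for g
    using that ext by (simp add: Bij_def)
  have "group_action G (space M) a"
    unfolding group_action_def group_hom_def group_hom_axioms_def
  proof (intro conjI G group_BijGroup homI)
    fix g assume "g \<in> carrier G" then show "a g \<in> carrier (BijGroup (space M))"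
      using Bij by (simp add: BijGroup_def)
  next
    fix g h assume gh: "g \<in> carrier G" "h \<in> carrier G"
    have "a (g \<otimes>\<^bsub>G\<^esub> h) = compose (space M) (a g) (a h)"
      by (rule extensionalityI[where A = "space M"]) (use gh ext mult in \<open>auto simp: compose_def\<close>)
    then show "a (g \<otimes>\<^bsub>G\<^esub> h) = a g \<otimes>\<^bsub>BijGroup (space M)\<^esub> a h"
      using gh Bij by (simp add: BijGroup_def)
  qed
  moreover have "a g \<in> mp_auts M" if g: "g \<in> carrier G" for g
  proof -
    have "inv_into (space M) (a g) x = a (inv\<^bsub>G\<^esub> g) x" if "x \<in> space M" for x
      by (rule inv_into_f_eq) (use g that inv sp bij in \<open>auto simp: bij_betw_def\<close>)
    then have "inv_into (space M) (a g) \<in> measurable M M \<longleftrightarrow> a (inv\<^bsub>G\<^esub> g) \<in> measurable M M"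
      by (intro measurable_cong)
    then show ?thesis using g meas Bij distr by (simp add: mp_auts_def)
  qed
  ultimately show ?thesis using M by (simp add: pmp_action_def)
qed

lemma pmp_actionD:
  assumes "pmp_action G M a"
  shows "prob_space M" and "group G"
    and "g \<in> carrier G \<Longrightarrow> a g \<in> measurable M M"
    and "g \<in> carrier G \<Longrightarrow> distr M M (a g) = M"
    and "g \<in> carrier G \<Longrightarrow> a g \<in> extensional (space M)"
    and "x \<in> space M \<Longrightarrow> a \<one>\<^bsub>G\<^esub> x = x"
    and "g \<in> carrier G \<Longrightarrow> h \<in> carrier G \<Longrightarrow> x \<in> space M \<Longrightarrow> a (g \<otimes>\<^bsub>G\<^esub> h) x = a g (a h x)"
    and "g \<in> carrier G \<Longrightarrow> x \<in> space M \<Longrightarrow> a g x \<in> space M"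
proof -
  interpret ga: group_action G "space M" a using assms by (simp add: pmp_action_def)
  show "prob_space M" using assms by (simp add: pmp_action_def)
  show "group G" using ga.group_hom by (simp add: group_hom_def)
  show m: "a g \<in> measurable M M" "distr M M (a g) = M" "a g \<in> extensional (space M)"
    if "g \<in> carrier G" for g
    using assms that by (auto simp: pmp_action_def mp_auts_def Bij_def)
  show "a \<one>\<^bsub>G\<^esub> x = x" if "x \<in> space M" for x
    using ga.id_eq_one that by (metis restrict_apply')
  show "a (g \<otimes>\<^bsub>G\<^esub> h) x = a g (a h x)" if "g \<in> carrier G" "h \<in> carrier G" "x \<in> space M"
    using ga.composition_rule that by auto
  show "a g x \<in> space M" if "g \<in> carrier G" "x \<in> space M"
    using measurable_space[OF m(1)] that by auto
qed

lemma pmp_action_inv: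
  assumes a: "pmp_action G M a" and g: "g \<in> carrier G" and x: "x \<in> space M"
  shows "a g (a (inv\<^bsub>G\<^esub> g) x) = x" and "a (inv\<^bsub>G\<^esub> g) (a g x) = x"
proof -
  interpret group G using a by (rule pmp_actionD)
  show "a g (a (inv\<^bsub>G\<^esub> g) x) = x" "a (inv\<^bsub>G\<^esub> g) (a g x) = x"
    using pmp_actionD(6,7)[OF a] g x by (metis inv_closed r_inv, metis inv_closed l_inv)
qed

lemma pmp_action_image:
  assumes a: "pmp_action G M a" and g: "g \<in> carrier G" and A: "A \<subseteq> space M"
  shows "a g ` A = {x\<in>space M. a (inv\<^bsub>G\<^esub> g) x \<in> A}"
proof (intro equalityI subsetI)
  interpret group G using a by (rule pmp_actionD)
  fix x
  {
    assume "x \<in> a g ` A"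
    then obtain y where y: "y \<in> A" "x = a g y" by auto
    then show "x \<in> {x\<in>space M. a (inv\<^bsub>G\<^esub> g) x \<in> A}"
      using pmp_action_inv[OF a g] pmp_actionD(8)[OF a g] A by auto
  }
  assume "x \<in> {x\<in>space M. a (inv\<^bsub>G\<^esub> g) x \<in> A}"
  then show "x \<in> a g ` A" using pmp_action_inv(1)[OF a g, of x]
    by (intro image_eqI[of _ _ "a (inv\<^bsub>G\<^esub> g) x"]) simp_all
qed

lemma pmp_action_image_sets:
  assumes a: "pmp_action G M a" and g: "g \<in> carrier G" and A: "A \<in> sets M"
  shows "a g ` A \<in> sets M"
proof -
  interpret group G using a by (rule pmp_actionD)
  have "a g ` A = a (inv\<^bsub>G\<^esub> g) -` A \<inter> space M"
    using pmp_action_image[OF a g sets.sets_into_space[OF A]] by auto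
  then show ?thesis using measurable_sets[OF pmp_actionD(3)[OF a] A] g by simp
qed

lemma pmp_action_measure:
  assumes a: "pmp_action G M a" and g: "g \<in> carrier G" and A: "{x\<in>space M. P x} \<in> sets M"
  shows "measure M {x\<in>space M. P (a g x)} = measure M {x\<in>space M. P x}"
proof -
  have "measure M {x\<in>space M. P x} = measure (distr M M (a g)) {x\<in>space M. P x}"
    using pmp_actionD(4)[OF a g] by simp
  also have "\<dots> = measure M (a g -` {x\<in>space M. P x} \<inter> space M)"
    using pmp_actionD(3)[OF a g] A by (rule measure_distr)
  also have "a g -` {x\<in>space M. P x} \<inter> space M = {x\<in>space M. P (a g x)}"
    using pmp_actionD(8)[OF a g] by auto
  finally show ?thesis by simp
qed

lemma pmp_action_image_measure:
  assumes a: "pmp_action G M a" and g: "g \<in> carrier G" and A: "A \<in> sets M"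
  shows "measure M (a g ` A) = measure M A"
proof -
  interpret group G using a by (rule pmp_actionD)
  have "{x\<in>space M. x \<in> A} = A" using sets.sets_into_space[OF A] by auto
  then show ?thesis
    using pmp_action_measure[OF a, of "inv\<^bsub>G\<^esub> g" "\<lambda>x. x \<in> A"] g A
      pmp_action_image[OF a g sets.sets_into_space[OF A]] by simp
qed

text \<open>A finite window over a finite alphabet shows only finitely many patterns, so for an
  arbitrary predicate \<open>R\<close> the event is a finite union of cylinders.\<close>

lemma pattern_sets:
  assumes S: "finite S" and h: "\<And>s. s \<in> S \<Longrightarrow> h s \<in> measurable M (count_space V)" and V: "finite V"
  shows "{x\<in>space M. R (\<lambda>s\<in>S. h s x)} \<in> sets M"
proof -
  have "{x\<in>space M. R (\<lambda>s\<in>S. h s x)} =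
      (\<Union>p\<in>{p\<in>S \<rightarrow>\<^sub>E V. R p}. {x\<in>space M. \<forall>s\<in>S. h s x = p s})" (is "?L = ?R")
  proof (intro equalityI subsetI)
    fix x assume x: "x \<in> ?L"
    let ?p = "\<lambda>s\<in>S. h s x"
    have "?p \<in> {p\<in>S \<rightarrow>\<^sub>E V. R p}" using x measurable_space[OF h] by auto
    moreover have "x \<in> {x\<in>space M. \<forall>s\<in>S. h s x = ?p s}" using x by auto
    ultimately show "x \<in> ?R" by (intro UN_I[of ?p])
  next
    fix x assume "x \<in> ?R"
    then obtain p where p: "p \<in> S \<rightarrow>\<^sub>E V" "R p" "x \<in> space M" "\<forall>s\<in>S. h s x = p s" by auto
    have "(\<lambda>s\<in>S. h s x) = p"
      by (rule extensionalityI[where A = S]) (use p in \<open>auto simp: PiE_def\<close>)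
    then show "x \<in> ?L" using p by simp
  qed
  also have "\<dots> \<in> sets M"
  proof (intro sets.finite_UN)
    show "finite {p\<in>S \<rightarrow>\<^sub>E V. R p}" using S V by (simp add: finite_PiE)
    fix p assume "p \<in> {p\<in>S \<rightarrow>\<^sub>E V. R p}"
    then have p: "p \<in> S \<rightarrow>\<^sub>E V" by simp
    have "{x\<in>space M. h s x = p s} \<in> sets M" if "s \<in> S" for s
    proof -
      have "p s \<in> V" using p that by auto
      then have "h s -` {p s} \<inter> space M \<in> sets M" using h[OF that] by (intro measurable_sets) auto
      also have "h s -` {p s} \<inter> space M = {x\<in>space M. h s x = p s}" by auto
      finally show ?thesis .
    qed
    then show "{x\<in>space M. \<forall>s\<in>S. h s x = p s} \<in> sets M" using S by (rule sets.sets_Collect_finite_All)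
  qed
  finally show ?thesis .
qed

lemma (in prob_space) measure_neq_le:
  assumes P: "{x\<in>space M. P x} \<in> sets M" and Q: "{x\<in>space M. Q x} \<in> sets M" and D: "D \<in> sets M"
    and sub: "\<And>x. x \<in> space M \<Longrightarrow> P x \<noteq> Q x \<Longrightarrow> x \<in> D"
  shows "\<bar>prob {x\<in>space M. P x} - prob {x\<in>space M. Q x}\<bar> \<le> prob D"
proof -
  have "prob {x\<in>space M. P x} \<le> prob ({x\<in>space M. Q x} \<union> D)"
    using sub Q D by (intro finite_measure_mono) auto
  also have "\<dots> \<le> prob {x\<in>space M. Q x} + prob D" using Q D by (rule measure_Un_le)
  finally have 1: "prob {x\<in>space M. P x} \<le> prob {x\<in>space M. Q x} + prob D" .
  have "prob {x\<in>space M. Q x} \<le> prob ({x\<in>space M. P x} \<union> D)"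
    using sub P D by (intro finite_measure_mono) auto
  also have "\<dots> \<le> prob {x\<in>space M. P x} + prob D" using P D by (rule measure_Un_le)
  finally show ?thesis using 1 by linarith
qed

lemma topspace_weak_topology: "topspace (weak_topology M) = mp_auts M"
proof -
  have "R \<in> topspace (weak_topology M)" if R: "R \<in> mp_auts M" for R
  proof -
    have "R \<in> {T \<in> mp_auts M. measure M (sym_diff (T ` {}) (R ` {})) < 1}" using R by simp
    moreover have "{T \<in> mp_auts M. measure M (sym_diff (T ` {}) (R ` {})) < 1} \<in>
      {{T \<in> mp_auts M. measure M (sym_diff (T ` A) (R ` A)) < \<epsilon>} | R A \<epsilon>.
        R \<in> mp_auts M \<and> A \<in> sets M \<and> (0::real) < \<epsilon>}"
      using R by (intro CollectI exI[of _ R] exI[of _ "{}"] exI[of _ 1]) auto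
    ultimately show ?thesis unfolding weak_topology_def topology_generated_by_topspace by (rule UnionI[rotated])
  qed
  moreover have "topspace (weak_topology M) \<subseteq> mp_auts M"
    unfolding weak_topology_def topology_generated_by_topspace by auto
  ultimately show ?thesis by auto
qed

text \<open>Finitely many group elements and finitely many sets cut out an open neighbourhood of the
  action in the product of weak topologies, and a dense set meets it.\<close>

lemma dense_actions_approx:
  assumes dense: "action_space G M closure_of {a \<in> topspace (action_space G M). Q a} = topspace (action_space G M)"
    and a: "pmp_action G M a" and S: "finite S" "S \<subseteq> carrier G"
    and F: "finite F" "F \<subseteq> sets M" and e: "0 < e"
  shows "\<exists>b. pmp_action G M b \<and> Q b \<and> (\<forall>s\<in>S. \<forall>A\<in>F. measure M (sym_diff (b s ` A) (a s ` A)) < e)"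
proof -
  interpret group G using a by (rule pmp_actionD)
  let ?X = "action_space G M"
  have top: "topspace ?X = (carrier G \<rightarrow>\<^sub>E mp_auts M) \<inter> {a. pmp_action G M a}"
    by (simp add: action_space_def topspace_weak_topology)
  \<comment> \<open>Points of a product topology are extensional in the index, so \<open>a\<close>
    lies in the space of actions only after its restriction to \<open>carrier G\<close>.\<close>
  define a' where "a' = restrict a (carrier G)"
  have "pmp_action G M a'"
    by (rule pmp_actionI[OF is_group pmp_actionD(1)[OF a]])
       (use pmp_actionD[OF a] in \<open>auto simp: a'_def\<close>)
  then have a': "a' \<in> topspace ?X" using a unfolding top by (auto simp: a'_def pmp_action_def)
  define V where "V p = {T \<in> mp_auts M. measure M (sym_diff (T ` snd p) (a (fst p) ` snd p)) < e}" for p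
  have Vo: "openin (weak_topology M) (V p)" if "p \<in> S \<times> F" for p
    unfolding weak_topology_def V_def
    by (rule topology_generated_by_Basis)
      (use that S F e a in \<open>auto simp: pmp_action_def intro!: exI[of _ "a (fst p)"] exI[of _ "snd p"] exI[of _ e]\<close>)
  \<comment> \<open>The whole space is inserted so that the intersection is taken over a nonempty
    family even when \<open>S\<close> or \<open>F\<close> is empty.\<close>
  define U where "U = \<Inter>(insert (topspace ?X) ((\<lambda>p. {b \<in> topspace ?X. b (fst p) \<in> V p}) ` (S \<times> F)))"
  have "openin ?X U"
    unfolding U_def
  proof (rule openin_Inter)
    fix W assume "W \<in> insert (topspace ?X) ((\<lambda>p. {b \<in> topspace ?X. b (fst p) \<in> V p}) ` (S \<times> F))"
    then consider "W = topspace ?X" | p where "p \<in> S \<times> F" "W = {b \<in> topspace ?X. b (fst p) \<in> V p}" by auto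
    then show "openin ?X W"
    proof cases
      case (2 p)
      have "continuous_map ?X (weak_topology M) (\<lambda>b. b (fst p))"
        unfolding action_space_def
        by (intro continuous_map_from_subtopology continuous_map_product_projection) (use 2 S in auto)
      then show ?thesis unfolding 2(2) using Vo[OF 2(1)] by (rule openin_continuous_map_preimage)
    qed simp
  qed (use S F in auto)
  moreover have "a' \<in> U"
    using a' S e a by (auto simp: U_def V_def a'_def pmp_action_def)
  moreover have "a' \<in> ?X closure_of {a \<in> topspace ?X. Q a}" using a' dense by simp
  ultimately obtain b where b: "b \<in> topspace ?X" "Q b" "b \<in> U" unfolding in_closure_of by auto
  have "measure M (sym_diff (b s ` A) (a s ` A)) < e" if "s \<in> S" "A \<in> F" for s A
  proof -
    have "b (fst (s, A)) \<in> V (s, A)" using b(3) that unfolding U_def by blast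
    then show ?thesis by (simp add: V_def)
  qed
  then show ?thesis using b top by blast
qed

section \<open>Carrying Polish probability spaces into the reals\<close>

lemma inj_embedding_real: "\<exists>\<iota> :: (nat \<Rightarrow> real) \<Rightarrow> real. inj \<iota>"
proof -
  obtain f :: "nat set \<Rightarrow> real" where f: "bij_betw f UNIV UNIV"
    using nat_sets_eqpoll_reals by (auto simp: eqpoll_def)
  \<comment> \<open>Each real is coded by a set of naturals, a sequence of such sets is merged into
    one set through the pairing function, and \<open>f\<close> turns that set back into a real. Only
    cardinality is used, so the injection has no topological regularity.\<close>
  define c where "c x = prod_encode ` {(n, k). k \<in> inv_into UNIV f (x n)}" for x :: "nat \<Rightarrow> real"
  have "inj c"
  proof (rule injI)
    fix x y assume "c x = c y"
    then have "{(n, k). k \<in> inv_into UNIV f (x n)} = {(n, k). k \<in> inv_into UNIV f (y n)}"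
      unfolding c_def by (subst (asm) inj_image_eq_iff) (rule inj_prod_encode)
    then have "inv_into UNIV f (x n) = inv_into UNIV f (y n)" for n by (auto simp: set_eq_iff)
    then have "f (inv_into UNIV f (x n)) = f (inv_into UNIV f (y n))" for n by simp
    then show "x = y" using f by (auto simp: fun_eq_iff bij_betw_def surj_f_inv_f)
  qed
  then have "inj (f \<circ> c)" using f by (intro inj_compose) (auto simp: bij_betw_def)
  then show ?thesis by blast
qed

text \<open>The injection may be wild with respect to the usual topology of its target, so the
  Polish topology is transported along it: \<open>T\<close> is the topology on the range that makes
  \<open>\<iota>\<close> a homeomorphism. Borel sets then correspond to images of Borel
  sets.\<close>

lemma standard_nonatomic_embed:
  fixes P :: "'x::polish_space measure" and \<iota> :: "'x \<Rightarrow> 'z"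
  assumes P: "prob_space P" "sets P = sets borel" "\<And>x. emeasure P {x} = 0" and inj: "inj \<iota>"
  shows "standard_nonatomic (embed_measure P \<iota>)"
proof -
  interpret prob_space P by fact
  have sp: "space P = UNIV" using sets_eq_imp_space_eq[OF P(2)] by simp
  let ?M = "embed_measure P \<iota>"
  define T where "T = pullback_topology (range \<iota>) (inv_into UNIV \<iota>) euclidean"
  have topT: "topspace T = range \<iota>" by (simp add: T_def topspace_pullback_topology)
  have openT: "openin T U \<longleftrightarrow> (\<exists>V. open V \<and> U = \<iota> ` V)" for U
  proof -
    have "inv_into UNIV \<iota> -` V \<inter> range \<iota> = \<iota> ` V" for V using inj by auto
    then show ?thesis by (simp add: T_def openin_pullback_topology)
  qed
  have hom: "homeomorphic_maps euclidean T \<iota> (inv_into UNIV \<iota>)"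
    unfolding homeomorphic_maps_def
  proof (intro conjI)
    show "continuous_map euclidean T \<iota>"
      unfolding continuous_map_alt
    proof (intro conjI allI impI)
      fix U assume "openin T U"
      then obtain V where "open V" "U = \<iota> ` V" unfolding openT by blast
      then show "openin euclidean (\<iota> -` U \<inter> topspace euclidean)" using inj by (simp add: inj_vimage_image_eq)
    qed (auto simp: topT)
    show "continuous_map T euclidean (inv_into UNIV \<iota>)"
      unfolding continuous_map_alt
    proof (intro conjI allI impI)
      fix V :: "'x set" assume "openin euclidean V"
      then show "openin T (inv_into UNIV \<iota> -` V \<inter> topspace T)"
        unfolding topT by (auto simp: T_def openin_pullback_topology)
    qed auto
  qed (use inj topT in auto)
  then have hs: "(euclidean :: 'x topology) homeomorphic_space T"
    by (rule homeomorphic_maps_imp_homeomorphic_space)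
  have "second_countable (euclidean :: 'x topology)"
  proof -
    obtain B :: "'x set set" where B: "countable B" "topological_basis B" using ex_countable_basis by blast
    then show ?thesis
      unfolding second_countable_def topological_basis_def
      by (intro exI[of _ B]) (metis (no_types, lifting) B(2) Union_upper open_openin topological_basisE topological_basis_open)
  qed
  then have sc: "second_countable T" using hs homeomorphic_space_second_countability by blast
  have cm: "completely_metrizable_space T"
    using homeomorphic_completely_metrizable_space[OF hs] completely_metrizable_space_euclidean by blast
  have "sets ?M = sigma_sets (topspace T) {U. openin T U}"
  proof -
    have "sets ?M = {\<iota> ` A |A. A \<in> sets borel}" using sets_embed_measure[OF inj, of P] P(2) by simp
    also have "\<dots> = (`) \<iota> ` sigma_sets UNIV {V. open V}" by (auto simp: borel_def)
    also have "\<dots> = sigma_sets (range \<iota>) ((`) \<iota> ` {V. open V})"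
    proof (intro equalityI subsetI)
      fix Z assume "Z \<in> (`) \<iota> ` sigma_sets UNIV {V. open V}"
      then obtain A where A: "A \<in> sigma_sets UNIV {V. open V}" "Z = \<iota> ` A" by auto
      from A(1) have "\<iota> ` A \<in> sigma_sets (range \<iota>) ((`) \<iota> ` {V. open V})"
      proof induction
        case (Basic a) then show ?case by (intro sigma_sets.Basic) auto
      next
        case Empty then show ?case by (simp add: sigma_sets.Empty)
      next
        case (Compl a)
        have "\<iota> ` (UNIV - a) = range \<iota> - \<iota> ` a" using inj by (simp add: image_set_diff)
        then show ?case using sigma_sets.Compl[OF Compl.IH] by simp
      next
        case (Union a)
        then show ?case using sigma_sets.Union[of "\<lambda>i. \<iota> ` a i"] by (simp add: image_UN)
      qed
      then show "Z \<in> sigma_sets (range \<iota>) ((`) \<iota> ` {V. open V})" using A by simp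
    next
      fix Z assume "Z \<in> sigma_sets (range \<iota>) ((`) \<iota> ` {V. open V})"
      then show "Z \<in> (`) \<iota> ` sigma_sets UNIV {V. open V}"
      proof induction
        case (Basic a) then show ?case by (auto intro: sigma_sets.Basic)
      next
        case Empty then show ?case by (auto intro: image_eqI[of _ _ "{}"] sigma_sets.Empty)
      next
        case (Compl a)
        then obtain A where A: "A \<in> sigma_sets UNIV {V. open V}" "a = \<iota> ` A" by auto
        have "\<iota> ` (UNIV - A) = range \<iota> - \<iota> ` A" using inj by (simp add: image_set_diff)
        then show ?case using sigma_sets.Compl[OF A(1)] A(2) by (intro image_eqI[of _ _ "UNIV - A"]) auto
      next
        case (Union a)
        then have "\<forall>i. \<exists>A. A \<in> sigma_sets UNIV {V. open V} \<and> a i = \<iota> ` A" by blast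
        then obtain A where A: "\<forall>i. A i \<in> sigma_sets UNIV {V. open V} \<and> a i = \<iota> ` A i"
          by (rule choice[THEN exE])
        then show ?case
          by (intro image_eqI[of _ _ "\<Union>i. A i"] sigma_sets.Union) (auto simp: image_UN)
      qed
    qed
    also have "(`) \<iota> ` {V. open V} = {U. openin T U}" by (auto simp: openT)
    finally show ?thesis by (simp add: topT)
  qed
  then have borel: "is_borel_of ?M T" by (simp add: is_borel_of_def space_embed_measure sp topT)
  have "prob_space ?M"
    using prob_space_distr[OF measurable_embed_measure2[OF inj, of P]] embed_measure_eq_distr[OF inj, of P] by simp
  moreover have "emeasure ?M {z} = 0" if "z \<in> space ?M" for z
  proof -
    obtain x where x: "z = \<iota> x" using \<open>z \<in> space ?M\<close> by (auto simp: space_embed_measure)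
    have "{z} \<in> sets ?M" using sets_embed_measure[OF inj, of P] P(2) x by auto
    moreover have "\<iota> -` {z} \<inter> space P = {x}" using x inj sp by (auto dest: injD)
    ultimately show ?thesis using P(3) by (simp add: emeasure_embed_measure[OF inj])
  qed
  ultimately show ?thesis using borel cm sc by (auto simp: standard_nonatomic_def)
qed

lemma pmp_action_embed:
  fixes P :: "'x measure" and \<iota> :: "'x \<Rightarrow> 'z"
  assumes a: "pmp_action G P a" and inj: "inj \<iota>" and sp: "space P = UNIV"
  shows "pmp_action G (embed_measure P \<iota>) (\<lambda>g. \<lambda>z\<in>range \<iota>. \<iota> (a g (inv_into UNIV \<iota> z)))"
proof (rule pmp_actionI[OF pmp_actionD(2)[OF a]])
  let ?M = "embed_measure P \<iota>" and ?a = "\<lambda>g. \<lambda>z\<in>range \<iota>. \<iota> (a g (inv_into UNIV \<iota> z))"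
  interpret prob_space P using a by (rule pmp_actionD)
  have spM: "space ?M = range \<iota>" by (simp add: space_embed_measure sp)
  have im: "\<iota> \<in> measurable P ?M" by (rule measurable_embed_measure2[OF inj])
  have MD: "?M = distr P ?M \<iota>" by (rule embed_measure_eq_distr[OF inj])
  show "prob_space ?M" by (subst MD) (rule prob_space_distr[OF im])
  fix g assume g: "g \<in> carrier G"
  show "?a g \<in> extensional (space ?M)" by (simp add: spM)
  have am: "(\<lambda>x. \<iota> (a g x)) \<in> measurable P ?M"
    using measurable_compose[OF pmp_actionD(3)[OF a g] im] .
  show m: "?a g \<in> measurable ?M ?M"
    by (rule measurable_embed_measure1) (use inj am in simp)
  have "distr ?M ?M (?a g) = distr (distr P ?M \<iota>) ?M (?a g)" using MD by simp
  also have "\<dots> = distr P ?M (?a g \<circ> \<iota>)" using m im by (rule distr_distr)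
  also have "?a g \<circ> \<iota> = \<iota> \<circ> a g" using inj by auto
  also have "distr P ?M (\<iota> \<circ> a g) = distr (distr P P (a g)) ?M \<iota>"
    by (rule distr_distr[OF im pmp_actionD(3)[OF a g], symmetric])
  also have "\<dots> = ?M" using pmp_actionD(4)[OF a g] MD by simp
  finally show "distr ?M ?M (?a g) = ?M" .
qed (use inj pmp_actionD(6,7)[OF a] sp in \<open>auto simp: space_embed_measure\<close>)

lemma distr_pair_map_fst:
  assumes N: "prob_space N" and f: "f \<in> measurable M M'"
  shows "distr (M \<Otimes>\<^sub>M N) (M' \<Otimes>\<^sub>M N) (\<lambda>(x, t). (f x, t)) = distr M M' f \<Otimes>\<^sub>M N"
proof -
  interpret N: prob_space N by fact
  have "distr M M' f \<Otimes>\<^sub>M distr N N (\<lambda>t. t) = distr (M \<Otimes>\<^sub>M N) (M' \<Otimes>\<^sub>M N) (\<lambda>(x, t). (f x, t))"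
    by (rule pair_measure_distr[OF f]) (auto simp: N.sigma_finite_measure_axioms distr_id2)
  then show ?thesis by (simp add: distr_id2)
qed

lemma prob_space_unit_interval: "prob_space (restrict_space lborel {0..1::real})"
  by (rule prob_spaceI) (simp add: emeasure_restrict_space space_restrict_space)

section \<open>Finite models of processes\<close>

abbreviation unit_interval :: "real measure" where
  "unit_interval \<equiv> restrict_space lborel {0..1}"

lemma pair_measure_event:
  assumes Y: "prob_space Y" and U: "prob_space U"
    and A: "{y\<in>space Y. P y} \<in> sets Y" and B: "{t\<in>space U. Q t} \<in> sets U"
  shows "{z\<in>space (Y \<Otimes>\<^sub>M U). P (fst z) \<and> Q (snd z)} \<in> sets (Y \<Otimes>\<^sub>M U)"
    and "measure (Y \<Otimes>\<^sub>M U) {z\<in>space (Y \<Otimes>\<^sub>M U). P (fst z) \<and> Q (snd z)} =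
      measure Y {y\<in>space Y. P y} * measure U {t\<in>space U. Q t}"
proof -
  interpret U: prob_space U by fact
  have eq: "{z\<in>space (Y \<Otimes>\<^sub>M U). P (fst z) \<and> Q (snd z)} = {y\<in>space Y. P y} \<times> {t\<in>space U. Q t}"
    by (auto simp: space_pair_measure)
  show "{z\<in>space (Y \<Otimes>\<^sub>M U). P (fst z) \<and> Q (snd z)} \<in> sets (Y \<Otimes>\<^sub>M U)"
    unfolding eq by (rule pair_measureI[OF A B])
  show "measure (Y \<Otimes>\<^sub>M U) {z\<in>space (Y \<Otimes>\<^sub>M U). P (fst z) \<and> Q (snd z)} =
      measure Y {y\<in>space Y. P y} * measure U {t\<in>space U. Q t}"
    unfolding eq using U.emeasure_pair_measure_Times[OF A B] by (simp add: measure_def enn2real_mult)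
qed

lemma pair_measure_event_fst:
  assumes Y: "prob_space Y" and U: "prob_space U" and A: "{y\<in>space Y. P y} \<in> sets Y"
  shows "{z\<in>space (Y \<Otimes>\<^sub>M U). P (fst z)} \<in> sets (Y \<Otimes>\<^sub>M U)"
    and "measure (Y \<Otimes>\<^sub>M U) {z\<in>space (Y \<Otimes>\<^sub>M U). P (fst z)} = measure Y {y\<in>space Y. P y}"
  using pair_measure_event[OF Y U A, of "\<lambda>_. True"] prob_space.prob_space[OF U] by simp_all

lemma pair_measure_event_snd:
  assumes Y: "prob_space Y" and U: "prob_space U" and B: "{t\<in>space U. Q t} \<in> sets U"
  shows "{z\<in>space (Y \<Otimes>\<^sub>M U). Q (snd z)} \<in> sets (Y \<Otimes>\<^sub>M U)"
    and "measure (Y \<Otimes>\<^sub>M U) {z\<in>space (Y \<Otimes>\<^sub>M U). Q (snd z)} = measure U {t\<in>space U. Q t}"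
  using pair_measure_event[OF Y U _ B, of "\<lambda>_. True"] prob_space.prob_space[OF Y] by simp_all

text \<open>The estimates to come see an action only through the joint law of finitely many
  translates of \<open>f\<close>. Sending \<open>y\<close> to the family of all its translated
  values realises this law on a sequence space, where countability of the group provides the
  indexing by naturals and the group acts by permuting indices.\<close>

lemma standard_model:
  fixes Y :: "'y measure" and f :: "'y \<Rightarrow> nat"
  assumes b: "pmp_action G Y b" and cG: "countable (carrier G)"
    and f: "f \<in> measurable Y (count_space {..<k})"
  shows "\<exists>(P :: (nat \<Rightarrow> real) measure) a F. sets P = sets borel \<and> (\<forall>x. emeasure P {x} = 0) \<and>
    pmp_action G P a \<and> F \<in> measurable P (count_space {..<k}) \<and>
    (\<forall>S R. finite S \<longrightarrow> S \<subseteq> carrier G \<longrightarrow>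
      measure Y {y\<in>space Y. R (\<lambda>s\<in>S. f (b (inv\<^bsub>G\<^esub> s) y))} =
      measure P {x\<in>space P. R (\<lambda>s\<in>S. F (a (inv\<^bsub>G\<^esub> s) x))})"
proof -
  interpret group G using b by (rule pmp_actionD)
  interpret Y: prob_space Y using b by (rule pmp_actionD)
  interpret U: prob_space unit_interval by (rule prob_space_unit_interval)
  interpret YU: pair_prob_space Y unit_interval ..
  define C where "C = carrier G"
  define e where "e = to_nat_on C"
  define d where "d = inv_into C e"
  have inje: "inj_on e C" unfolding e_def C_def using cG by (rule inj_on_to_nat_on)
  then have de: "d (e g) = g" if "g \<in> C" for g using that by (simp add: d_def)
  \<comment> \<open>The left shift of indices. The slot of \<open>k\<close> in \<open>a g x\<close>
    is the slot of \<open>inv g \<otimes> k\<close> in \<open>x\<close>, which turns the entry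
    \<open>f (b (inv k) y)\<close> into \<open>f (b (inv k) (b g y))\<close>. Index 0 and the
    indices that code no group element stay fixed.\<close>
  define \<sigma> where "\<sigma> g n = (case n of 0 \<Rightarrow> 0 | Suc m \<Rightarrow>
    if m \<in> e ` C then Suc (e (inv\<^bsub>G\<^esub> g \<otimes>\<^bsub>G\<^esub> d m)) else Suc m)" for g n
  define a where "a g x n = x (\<sigma> g n)" for g n and x :: "nat \<Rightarrow> real"
  have \<sigma>0: "\<sigma> g 0 = 0" and \<sigma>1: "k \<in> C \<Longrightarrow> \<sigma> g (Suc (e k)) = Suc (e (inv\<^bsub>G\<^esub> g \<otimes>\<^bsub>G\<^esub> k))"
    and \<sigma>2: "m \<notin> e ` C \<Longrightarrow> \<sigma> g (Suc m) = Suc m" for g k m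
    by (auto simp: \<sigma>_def de)
  have nat_split: "n = 0 \<or> (\<exists>k\<in>C. n = Suc (e k)) \<or> (\<exists>m. m \<notin> e ` C \<and> n = Suc m)" for n
    by (cases n) auto
  have \<sigma>_one: "\<sigma> \<one>\<^bsub>G\<^esub> n = n" for n
    using nat_split[of n] by (auto simp: \<sigma>0 \<sigma>1 \<sigma>2 C_def)
  have \<sigma>_mult: "\<sigma> h (\<sigma> g n) = \<sigma> (g \<otimes>\<^bsub>G\<^esub> h) n" if "g \<in> C" "h \<in> C" for g h n
    using nat_split[of n] that by (auto simp: \<sigma>0 \<sigma>1 \<sigma>2 C_def inv_mult_group m_assoc)
  \<comment> \<open>Coordinate \<open>0\<close> holds an independent uniform variable, which makes the law non-atomic; the
    others hold the process \<open>f (g\<^sup>-\<^sup>1 y)\<close>.\<close>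
  define \<Psi> where "\<Psi> z n = (case n of 0 \<Rightarrow> snd z | Suc m \<Rightarrow>
    if m \<in> e ` C then real (f (b (inv\<^bsub>G\<^esub> (d m)) (fst z))) else 0)" for z :: "'y \<times> real" and n
  have \<Psi>0: "\<Psi> z 0 = snd z"
    and \<Psi>1: "k \<in> C \<Longrightarrow> \<Psi> z (Suc (e k)) = real (f (b (inv\<^bsub>G\<^esub> k) (fst z)))"
    and \<Psi>2: "m \<notin> e ` C \<Longrightarrow> \<Psi> z (Suc m) = 0" for z k m
    by (auto simp: \<Psi>_def de)
  have fr: "(\<lambda>y. real (f (b g y))) \<in> borel_measurable Y" if "g \<in> C" for g
  proof -
    have "(\<lambda>y. f (b g y)) \<in> measurable Y (count_space {..<k})"
      using measurable_compose[OF pmp_actionD(3)[OF b] f] that by (simp add: C_def)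
    then show ?thesis by (rule measurable_compose) simp
  qed
  have \<Psi>m: "\<Psi> \<in> measurable (Y \<Otimes>\<^sub>M unit_interval) borel"
  proof (rule measurable_coordinatewise_then_product)
    fix n
    consider "n = 0" | k where "k \<in> C" "n = Suc (e k)" | m where "m \<notin> e ` C" "n = Suc m"
      using nat_split[of n] by auto
    then show "(\<lambda>z. \<Psi> z n) \<in> borel_measurable (Y \<Otimes>\<^sub>M unit_interval)"
    proof cases
      case 1
      have "(\<lambda>t. t) \<in> measurable unit_interval borel"
        by (rule measurable_restrict_space1) simp
      then show ?thesis using measurable_compose[OF measurable_snd] 1 by (simp add: \<Psi>0)
    next
      case (2 k)
      then show ?thesis
        using measurable_compose[OF measurable_fst fr[of "inv\<^bsub>G\<^esub> k"]] by (simp add: \<Psi>1 C_def)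
    qed (simp add: \<Psi>2)
  qed
  define P where "P = distr (Y \<Otimes>\<^sub>M unit_interval) borel \<Psi>"
  have sP: "sets P = sets borel" and spP: "space P = UNIV" by (simp_all add: P_def)
  interpret P: prob_space P unfolding P_def by (rule YU.prob_space_distr[OF \<Psi>m])
  have spYU: "z \<in> space (Y \<Otimes>\<^sub>M unit_interval) \<longleftrightarrow> fst z \<in> space Y \<and> snd z \<in> {0..1}" for z
    by (auto simp: space_pair_measure space_restrict_space mem_Times_iff)
  have am: "a g \<in> measurable borel borel" for g
    unfolding a_def[abs_def] by (rule measurable_coordinatewise_then_product) simp
  have a\<Psi>: "a g (\<Psi> z) = \<Psi> (b g (fst z), snd z)" if g: "g \<in> C" and z: "fst z \<in> space Y" for g z
  proof
    fix n
    consider "n = 0" | k where "k \<in> C" "n = Suc (e k)" | m where "m \<notin> e ` C" "n = Suc m"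
      using nat_split[of n] by auto
    then show "a g (\<Psi> z) n = \<Psi> (b g (fst z), snd z) n"
    proof cases
      case (2 k)
      have ic: "inv\<^bsub>G\<^esub> g \<otimes>\<^bsub>G\<^esub> k \<in> C" using g 2 by (simp add: C_def)
      have "inv\<^bsub>G\<^esub> (inv\<^bsub>G\<^esub> g \<otimes>\<^bsub>G\<^esub> k) = inv\<^bsub>G\<^esub> k \<otimes>\<^bsub>G\<^esub> g"
        using g 2 by (simp add: C_def inv_mult_group)
      moreover have "b (inv\<^bsub>G\<^esub> k \<otimes>\<^bsub>G\<^esub> g) (fst z) = b (inv\<^bsub>G\<^esub> k) (b g (fst z))"
        using g 2 z by (intro pmp_actionD(7)[OF b]) (auto simp: C_def)
      ultimately show ?thesis using 2 ic by (simp add: a_def \<sigma>1 \<Psi>1)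
    qed (simp_all add: a_def \<sigma>0 \<sigma>2 \<Psi>0 \<Psi>2)
  qed
  have aP: "distr P P (a g) = P" if g: "g \<in> C" for g
  proof -
    let ?b = "\<lambda>(y, t). (b g y, t)"
    have bg: "b g \<in> measurable Y Y" using pmp_actionD(3)[OF b] g by (simp add: C_def)
    have bm: "?b \<in> measurable (Y \<Otimes>\<^sub>M unit_interval) (Y \<Otimes>\<^sub>M unit_interval)"
      using bg by (auto simp: case_prod_beta' intro!: measurable_Pair measurable_compose[OF measurable_fst])
    have "distr P P (a g) = distr (distr (Y \<Otimes>\<^sub>M unit_interval) borel \<Psi>) borel (a g)"
      by (auto simp: P_def intro: distr_cong)
    also have "\<dots> = distr (Y \<Otimes>\<^sub>M unit_interval) borel (a g \<circ> \<Psi>)" by (rule distr_distr[OF am \<Psi>m])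
    also have "\<dots> = distr (Y \<Otimes>\<^sub>M unit_interval) borel (\<Psi> \<circ> ?b)"
      by (rule distr_cong) (auto simp: spYU a\<Psi>[OF g] split: prod.splits)
    also have "\<dots> = distr (distr (Y \<Otimes>\<^sub>M unit_interval) (Y \<Otimes>\<^sub>M unit_interval) ?b) borel \<Psi>"
      by (rule distr_distr[OF \<Psi>m bm, symmetric])
    also have "distr (Y \<Otimes>\<^sub>M unit_interval) (Y \<Otimes>\<^sub>M unit_interval) ?b = Y \<Otimes>\<^sub>M unit_interval"
      using distr_pair_map_fst[OF U.prob_space_axioms bg] pmp_actionD(4)[OF b] g by (simp add: C_def)
    finally show ?thesis by (simp add: P_def)
  qed
  have pa: "pmp_action G P a"
  proof (rule pmp_actionI[OF is_group P.prob_space_axioms])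
    fix g assume g: "g \<in> carrier G"
    show "a g \<in> extensional (space P)" by (simp add: spP)
    show "a g \<in> measurable P P" using am by (simp add: P_def)
    show "distr P P (a g) = P" using aP g by (simp add: C_def)
  qed (use \<sigma>_one \<sigma>_mult in \<open>auto simp: a_def fun_eq_iff C_def\<close>)
  \<comment> \<open>A single sequence prescribes coordinate 0, and the uniform variable stored there
    takes any prescribed value with probability zero.\<close>
  have nonat: "emeasure P {x} = 0" for x
  proof -
    have sI: "{x 0} \<inter> {0..1} \<in> sets unit_interval" by (simp add: sets_restrict_space_iff)
    have "emeasure P {x} = emeasure (Y \<Otimes>\<^sub>M unit_interval) (\<Psi> -` {x} \<inter> space (Y \<Otimes>\<^sub>M unit_interval))"
      unfolding P_def by (rule emeasure_distr[OF \<Psi>m]) simp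
    also have "\<dots> \<le> emeasure (Y \<Otimes>\<^sub>M unit_interval) (space Y \<times> ({x 0} \<inter> {0..1}))"
    proof (rule emeasure_mono)
      show "\<Psi> -` {x} \<inter> space (Y \<Otimes>\<^sub>M unit_interval) \<subseteq> space Y \<times> ({x 0} \<inter> {0..1})"
        by (auto simp: spYU \<Psi>0)
      show "space Y \<times> ({x 0} \<inter> {0..1}) \<in> sets (Y \<Otimes>\<^sub>M unit_interval)"
        using sI by (intro pair_measureI sets.top)
    qed
    also have "\<dots> = emeasure unit_interval ({x 0} \<inter> {0..1})"
      using U.emeasure_pair_measure_Times[OF sets.top[of Y] sI] by (simp add: Y.emeasure_space_1)
    also have "\<dots> = 0"
    proof -
      have "emeasure unit_interval ({x 0} \<inter> {0..1}) = emeasure lborel ({x 0} \<inter> {0..1})"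
        by (rule emeasure_restrict_space) auto
      also have "\<dots> = 0" by (cases "x 0 \<in> {0..1}") auto
      finally show ?thesis .
    qed
    finally show ?thesis by simp
  qed
  have kpos: "0 < k" using Y.not_empty measurable_space[OF f] by fastforce
  have oneC: "\<one>\<^bsub>G\<^esub> \<in> C" by (simp add: C_def)
  \<comment> \<open>The slot of the identity stores \<open>f y\<close> itself. The truncation at
    \<open>k - 1\<close> changes nothing on the range of \<open>\<Psi>\<close>; it keeps
    \<open>F\<close> below \<open>k\<close> on the remaining sequences, whose entries are arbitrary
    reals.\<close>
  define F where "F x = min (nat \<lfloor>x (Suc (e \<one>\<^bsub>G\<^esub>))\<rfloor>) (k - 1)" for x :: "nat \<Rightarrow> real"
  have Fm: "F \<in> measurable P (count_space {..<k})"
  proof -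
    have m0: "(\<lambda>x. x (Suc (e \<one>\<^bsub>G\<^esub>))) \<in> borel_measurable P" using measurable_product_coordinates by (simp add: P_def)
    have m: "(\<lambda>x. \<lfloor>x (Suc (e \<one>\<^bsub>G\<^esub>))\<rfloor>) \<in> measurable P (count_space UNIV)"
      by (rule measurable_compose[OF m0]) simp
    have "F \<in> measurable P (count_space UNIV)"
      unfolding F_def[abs_def] by (rule measurable_compose[OF m]) simp
    then show ?thesis by (rule measurable_count_space_extend[rotated 2]) (use kpos in \<open>auto simp: F_def\<close>)
  qed
  have F\<Psi>: "F (a g (\<Psi> z)) = f (b g (fst z))" if "g \<in> C" "fst z \<in> space Y" for g z
  proof -
    have y: "b g (fst z) \<in> space Y" using pmp_actionD(8)[OF b] that by (simp add: C_def)
    then have "f (b g (fst z)) < k" using measurable_space[OF f] by auto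
    then show ?thesis using that oneC y pmp_actionD(6)[OF b y] by (simp add: a\<Psi> F_def \<Psi>1)
  qed
  have "measure Y {y\<in>space Y. R (\<lambda>s\<in>S. f (b (inv\<^bsub>G\<^esub> s) y))} =
      measure P {x\<in>space P. R (\<lambda>s\<in>S. F (a (inv\<^bsub>G\<^esub> s) x))}" if S: "finite S" "S \<subseteq> carrier G" for S R
  proof -
    have Fa: "(\<lambda>x. F (a (inv\<^bsub>G\<^esub> s) x)) \<in> measurable P (count_space {..<k})" if "s \<in> S" for s
      using that S by (intro measurable_compose[OF pmp_actionD(3)[OF pa] Fm]) auto
    have fb: "(\<lambda>y. f (b (inv\<^bsub>G\<^esub> s) y)) \<in> measurable Y (count_space {..<k})" if "s \<in> S" for s
      using that S by (intro measurable_compose[OF pmp_actionD(3)[OF b] f]) auto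
    have A: "{x\<in>space P. R (\<lambda>s\<in>S. F (a (inv\<^bsub>G\<^esub> s) x))} \<in> sets P"
      by (rule pattern_sets[OF S(1) Fa]) auto
    have "measure P {x\<in>space P. R (\<lambda>s\<in>S. F (a (inv\<^bsub>G\<^esub> s) x))} =
      measure (Y \<Otimes>\<^sub>M unit_interval) (\<Psi> -` {x\<in>space P. R (\<lambda>s\<in>S. F (a (inv\<^bsub>G\<^esub> s) x))} \<inter> space (Y \<Otimes>\<^sub>M unit_interval))"
      unfolding P_def by (rule measure_distr[OF \<Psi>m]) (use A in \<open>simp add: P_def\<close>)
    also have "\<Psi> -` {x\<in>space P. R (\<lambda>s\<in>S. F (a (inv\<^bsub>G\<^esub> s) x))} \<inter> space (Y \<Otimes>\<^sub>M unit_interval) =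
      {z\<in>space (Y \<Otimes>\<^sub>M unit_interval). R (\<lambda>s\<in>S. f (b (inv\<^bsub>G\<^esub> s) (fst z)))}"
    proof -
      have "(\<lambda>s\<in>S. F (a (inv\<^bsub>G\<^esub> s) (\<Psi> z))) = (\<lambda>s\<in>S. f (b (inv\<^bsub>G\<^esub> s) (fst z)))"
        if "z \<in> space (Y \<Otimes>\<^sub>M unit_interval)" for z
        by (rule restrict_ext) (use that S in \<open>auto simp: spYU C_def intro!: F\<Psi>\<close>)
      then show ?thesis by (auto simp: spP)
    qed
    also have "measure (Y \<Otimes>\<^sub>M unit_interval) \<dots> = measure Y {y\<in>space Y. R (\<lambda>s\<in>S. f (b (inv\<^bsub>G\<^esub> s) y))}"
      by (rule pair_measure_event_fst(2)[OF Y.prob_space_axioms U.prob_space_axioms])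
         (rule pattern_sets[OF S(1) fb], auto)
    finally show ?thesis by (rule sym)
  qed
  then show ?thesis using sP nonat pa Fm by blast
qed

section \<open>Finite invariant partitions as models\<close>

lemma partition_ex1:
  assumes "partition_on X D" "x \<in> X"
  shows "\<exists>!A. A \<in> D \<and> x \<in> A"
proof -
  obtain A where A: "A \<in> D" "x \<in> A" using assms by (auto simp: partition_on_def)
  have u: "B = A" if "B \<in> D" "x \<in> B" for B
  proof (rule ccontr)
    assume "B \<noteq> A"
    then have "B \<inter> A = {}" by (rule disjointD[OF partition_onD2[OF assms(1)] that(1) A(1)])
    then show False using that A by auto
  qed
  show ?thesis
    by (rule ex1I[of _ A], rule conjI[OF A], elim conjE, rule u)
qed

lemma partition_piece:
  assumes "partition_on X D" "x \<in> X"
  shows "(THE A. A \<in> D \<and> x \<in> A) \<in> D" "x \<in> (THE A. A \<in> D \<and> x \<in> A)"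
proof -
  have "\<exists>!A. A \<in> D \<and> x \<in> A" by (rule partition_ex1[OF assms])
  then have "(THE A. A \<in> D \<and> x \<in> A) \<in> D \<and> x \<in> (THE A. A \<in> D \<and> x \<in> A)" by (rule theI')
  then show "(THE A. A \<in> D \<and> x \<in> A) \<in> D" "x \<in> (THE A. A \<in> D \<and> x \<in> A)" by auto
qed

lemma partition_piece_eq:
  assumes "partition_on X D" "A \<in> D" "x \<in> A"
  shows "(THE A. A \<in> D \<and> x \<in> A) = A"
proof -
  have "x \<in> X" using assms by (auto simp: partition_on_def)
  then have "\<exists>!A. A \<in> D \<and> x \<in> A" by (rule partition_ex1[OF assms(1)])
  then show ?thesis using assms by (intro the1_equality) auto
qed

lemma partition_sum:
  assumes M: "finite_measure M" and D: "partition_on (space M) D" "finite D" "D \<subseteq> sets M"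
  shows "measure M {z\<in>space M. Q (THE A. A \<in> D \<and> z \<in> A)} = (\<Sum>A | A \<in> D \<and> Q A. measure M A)"
    and "{z\<in>space M. Q (THE A. A \<in> D \<and> z \<in> A)} \<in> sets M"
proof -
  interpret finite_measure M by fact
  have eq: "{z\<in>space M. Q (THE A. A \<in> D \<and> z \<in> A)} = (\<Union>A\<in>{A. A \<in> D \<and> Q A}. A)"
  proof (intro equalityI subsetI)
    fix z assume "z \<in> {z\<in>space M. Q (THE A. A \<in> D \<and> z \<in> A)}"
    then show "z \<in> (\<Union>A\<in>{A. A \<in> D \<and> Q A}. A)" using partition_piece[OF D(1)]
      by (intro UN_I[of "THE A. A \<in> D \<and> z \<in> A"]) auto
  next
    fix z assume "z \<in> (\<Union>A\<in>{A. A \<in> D \<and> Q A}. A)"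
    then obtain A where A: "A \<in> D" "Q A" "z \<in> A" by auto
    then have "z \<in> space M" using D(1) by (auto simp: partition_on_def)
    then show "z \<in> {z\<in>space M. Q (THE A. A \<in> D \<and> z \<in> A)}"
      using A partition_piece_eq[OF D(1) A(1,3)] by simp
  qed
  show "{z\<in>space M. Q (THE A. A \<in> D \<and> z \<in> A)} \<in> sets M"
    unfolding eq using D by (intro sets.finite_UN) auto
  show "measure M {z\<in>space M. Q (THE A. A \<in> D \<and> z \<in> A)} = (\<Sum>A | A \<in> D \<and> Q A. measure M A)"
    unfolding eq using D partition_onD2[OF D(1)]
    by (intro finite_measure_finite_Union) (auto simp: disjoint_family_on_def disjoint_def)
qed

text \<open>Density gives a profinite action \<open>c\<close> that moves the level sets of
  \<open>FM\<close> almost as \<open>a'\<close> does. One of its invariant partitions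
  \<open>D m\<close> is fine enough for \<open>FM\<close> to be almost constant on pieces. Since
  \<open>c\<close> permutes the pieces, patterns of the process become patterns on the finite set
  \<open>D m\<close>, weighted by measure. The predicate \<open>Q\<close> is carried along so that
  one argument serves both MD and EMD.\<close>

lemma finite_model_aux:
  fixes Y :: "'y measure" and f :: "'y \<Rightarrow> nat" and Q :: "real measure \<Rightarrow> ('g \<Rightarrow> real \<Rightarrow> real) \<Rightarrow> bool"
  assumes b: "pmp_action G Y b" and cG: "countable (carrier G)"
    and dense: "\<forall>M :: real measure. standard_nonatomic M \<longrightarrow> action_space G M closure_of
      {a \<in> topspace (action_space G M). Q M a \<and> profinite_action G M a} = topspace (action_space G M)"
    and f: "f \<in> measurable Y (count_space {..<k})" and S: "finite S" "S \<subseteq> carrier G" and e: "0 < \<epsilon>"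
  shows "\<exists>(M :: real measure) c D f'. pmp_action G M c \<and> Q M c \<and> partition_on (space M) D \<and> finite D \<and>
    D \<subseteq> sets M \<and> (\<forall>g\<in>carrier G. \<forall>A\<in>D. c g ` A \<in> D) \<and> (\<forall>A. f' A < k) \<and>
    (\<forall>R. \<bar>measure Y {y\<in>space Y. R (\<lambda>s\<in>S. f (b (inv\<^bsub>G\<^esub> s) y))} -
      (\<Sum>A | A \<in> D \<and> R (\<lambda>s\<in>S. f' (c (inv\<^bsub>G\<^esub> s) ` A)). measure M A)\<bar> < \<epsilon>)"
proof -
  interpret group G using b by (rule pmp_actionD)
  have kpos: "0 < k"
    using prob_space.not_empty[OF pmp_actionD(1)[OF b]] measurable_space[OF f] by fastforce
  obtain P :: "(nat \<Rightarrow> real) measure" and a F where sP: "sets P = sets borel"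
    and nonat: "\<And>x. emeasure P {x} = 0" and a: "pmp_action G P a"
    and F: "F \<in> measurable P (count_space {..<k})"
    and law: "\<And>S R. finite S \<Longrightarrow> S \<subseteq> carrier G \<Longrightarrow>
      measure Y {y\<in>space Y. R (\<lambda>s\<in>S. f (b (inv\<^bsub>G\<^esub> s) y))} =
      measure P {x\<in>space P. R (\<lambda>s\<in>S. F (a (inv\<^bsub>G\<^esub> s) x))}"
    using standard_model[OF b cG f] by auto
  interpret P: prob_space P using a by (rule pmp_actionD)
  have spP: "space P = UNIV" using sets_eq_imp_space_eq[OF sP] by simp
  obtain \<iota> :: "(nat \<Rightarrow> real) \<Rightarrow> real" where inj: "inj \<iota>" using inj_embedding_real by blast
  define M where "M = embed_measure P \<iota>"
  define j where "j = inv_into UNIV \<iota>"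
  have j\<iota>: "j (\<iota> x) = x" for x using inj by (simp add: j_def)
  have spM: "space M = range \<iota>" by (simp add: M_def space_embed_measure spP)
  define a' where "a' g = (\<lambda>z\<in>range \<iota>. \<iota> (a g (j z)))" for g
  have a'_eq: "a' = (\<lambda>g. \<lambda>z\<in>range \<iota>. \<iota> (a g (inv_into UNIV \<iota> z)))"
    by (rule ext) (simp add: a'_def j_def)
  have a': "pmp_action G M a'"
    unfolding a'_eq M_def by (rule pmp_action_embed[OF a inj spP])
  have im: "\<iota> \<in> measurable P M" unfolding M_def by (rule measurable_embed_measure2[OF inj])
  have MD: "M = distr P M \<iota>" unfolding M_def by (rule embed_measure_eq_distr[OF inj])
  interpret M: prob_space M using a' by (rule pmp_actionD)
  have mM: "measure M A = measure P (\<iota> -` A)" if "A \<in> sets M" for A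
    using measure_distr[OF im that] MD spP by simp
  have std: "standard_nonatomic M"
    unfolding M_def by (rule standard_nonatomic_embed[OF P.prob_space_axioms sP nonat inj])
  define FM where "FM z = F (j z)" for z
  have FM: "FM \<in> measurable M (count_space {..<k})"
    unfolding M_def FM_def[abs_def] by (rule measurable_embed_measure1) (use F j\<iota> in simp)
  define Av where "Av v = {z\<in>space M. FM z = v}" for v
  have Av: "Av v \<in> sets M" for v
  proof -
    have "FM \<in> measurable M (count_space UNIV)"
      by (rule measurable_compose[OF FM]) simp
    then have "FM -` {v} \<inter> space M \<in> sets M" by (rule measurable_sets) simp
    also have "FM -` {v} \<inter> space M = Av v" by (auto simp: Av_def)
    finally show ?thesis .
  qed
  \<comment> \<open>Each \<open>s \<in> S\<close> contributes the two exceptional sets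
    \<open>B1 s\<close> and \<open>B2 s\<close> of measure at most \<open>e1\<close>. The additional
    1 makes the final inequality strict and covers an empty \<open>S\<close>.\<close>
  define n where "n = real (card S) + 1"
  define e1 where "e1 = \<epsilon> / (2 * n)"
  have n: "n > 0" by (simp add: n_def)
  have e1: "e1 > 0" using e n by (simp add: e1_def)
  \<comment> \<open>The mismatch of \<open>a'\<close> and \<open>c\<close> at one \<open>s\<close>
    is covered by the symmetric differences of \<open>k\<close> level sets, so each of them is
    allowed a \<open>k\<close>-th part of \<open>e1\<close>.\<close>
  have "e1 / real k > 0" using e1 kpos by simp
  have AvF: "Av ` {..<k} \<subseteq> sets M" using Av by auto
  from dense_actions_approx[OF dense[rule_format, OF std] a' S _ AvF \<open>e1 / real k > 0\<close>]
  obtain c where c: "pmp_action G M c" and Qc: "Q M c" and prof: "profinite_action G M c"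
    and close: "\<And>s v. s \<in> S \<Longrightarrow> v < k \<Longrightarrow> measure M (sym_diff (c s ` Av v) (a' s ` Av v)) < e1 / real k"
    by auto
  obtain D where DD: "\<forall>n. partition_on (space M) (D n) \<and> finite (D n) \<and> D n \<subseteq> sets M \<and>
      (\<forall>g\<in>carrier G. \<forall>A\<in>D n. c g ` A \<in> D n)"
    "\<forall>n. refines (space M) (D (Suc n)) (D n)"
    "\<forall>x\<in>space M. \<forall>y\<in>space M. x \<noteq> y \<longrightarrow> (\<exists>n. \<exists>A\<in>D n. x \<in> A \<and> y \<notin> A)"
    using prof unfolding profinite_action_def by (elim exE conjE)
  have D: "partition_on (space M) (D n)" "finite (D n)" "D n \<subseteq> sets M"
    "g \<in> carrier G \<Longrightarrow> A \<in> D n \<Longrightarrow> c g ` A \<in> D n" for n g A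
    using DD(1) by simp_all
  have Dref: "refines (space M) (D (Suc n)) (D n)" for n using DD(2) by simp
  have Dsep: "\<exists>n. \<exists>A\<in>D n. x \<in> A \<and> y \<notin> A" if "x \<in> space M" "y \<in> space M" "x \<noteq> y" for x y
    using DD(3) that by simp
  define L where "L n z = (THE A. A \<in> D n \<and> z \<in> A)" for n z
  have L: "L n z \<in> D n" "z \<in> L n z" if "z \<in> space M" for n z
    unfolding L_def using partition_piece[OF D(1) that] by auto
  have L_eq: "L n z = A" if "A \<in> D n" "z \<in> A" for n z A
    unfolding L_def by (rule partition_piece_eq[OF D(1) that])
  define l where "l n x = L n (\<iota> x)" for n x
  have l: "l n x \<in> D n" "\<iota> x \<in> l n x" for n x using L[of "\<iota> x"] spM by (auto simp: l_def)
  have lm: "l n -` {d} \<in> sets P" for n d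
  proof (cases "d \<in> D n")
    case True
    then have "l n -` {d} = \<iota> -` d \<inter> space P" using l L_eq spP by (auto simp: l_def)
    moreover have "d \<in> sets M" using True D(3)[of n] by auto
    ultimately show ?thesis using measurable_sets[OF im] by simp
  next
    case False
    then have "l n -` {d} = {}" using l by auto
    then show ?thesis by simp
  qed
  have lr: "finite (range (l n))" for n
    using l D(2) by (meson finite_subset image_subsetI)
  have lref: "\<exists>u. \<forall>x. l n x = u (l (Suc n) x)" for n
  proof -
    have "\<forall>A\<in>D (Suc n). \<exists>B. B \<in> D n \<and> A \<subseteq> B" using Dref[of n] by (auto simp: refines_def)
    then obtain u where u: "\<forall>A\<in>D (Suc n). u A \<in> D n \<and> A \<subseteq> u A" by (rule bchoice[THEN exE])
    have "l n x = u (l (Suc n) x)" for x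
    proof -
      have "l (Suc n) x \<in> D (Suc n)" "\<iota> x \<in> l (Suc n) x" by (rule l)+
      then show ?thesis unfolding l_def[of n] using u by (intro L_eq) auto
    qed
    then show ?thesis by (intro exI[of _ u]) simp
  qed
  have lsep: "\<exists>n. l n x \<noteq> l n y" if "x \<noteq> y" for x y
  proof -
    have "\<iota> x \<noteq> \<iota> y" using that inj by (auto dest: injD)
    then obtain n A where A: "A \<in> D n" "\<iota> x \<in> A" "\<iota> y \<notin> A" using Dsep[of "\<iota> x" "\<iota> y"] spM by auto
    have "l n x = A" unfolding l_def by (rule L_eq[OF A(1,2)])
    moreover have "\<iota> y \<in> l n y" by (rule l)
    ultimately show ?thesis using A by (intro exI[of _ n]) auto
  qed
  note fmP = P.finite_measure_axioms
  \<comment> \<open>The partitions live on the image in the reals, which does not carry the usual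
    topology. They are pulled back along \<open>\<iota>\<close> to the Polish space of
    \<open>P\<close>, where a separating refining sequence approximates every Borel set.\<close>
  note polish = approx_set_polish[OF fmP sP lr lm lref lsep]
  have "\<exists>q\<in>range l. \<exists>u. (\<forall>d. u d < k) \<and> measure P {x\<in>space P. F x \<noteq> u (q x)} < e1"
  proof (rule P.approx_fun[OF polish(1) kpos F _ e1])
    fix v assume v: "v < k"
    have "F -` {v} \<inter> space P \<in> sets P" using F v by (intro measurable_sets) auto
    also have "F -` {v} \<inter> space P = {x\<in>space P. F x = v}" by auto
    finally show "approx_set P (range l) {x\<in>space P. F x = v}" by (rule polish(2)[rotated -1])
  qed
  then obtain m u where u: "\<And>d. u d < k" and um: "measure P {x\<in>space P. F x \<noteq> u (l m x)} < e1" by auto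
  have uL: "(\<lambda>z. u (L m z)) \<in> measurable M (count_space {..<k})"
  proof (subst measurable_count_space_eq2)
    have "(\<lambda>z. u (L m z)) -` {v} \<inter> space M = {z\<in>space M. u (L m z) = v}" for v by auto
    then show "(\<lambda>z. u (L m z)) \<in> space M \<rightarrow> {..<k} \<and>
      (\<forall>v\<in>{..<k}. (\<lambda>z. u (L m z)) -` {v} \<inter> space M \<in> sets M)"
      using u partition_sum(2)[OF M.finite_measure_axioms D(1,2,3), of "\<lambda>A. u A = _" m] by (simp add: L_def)
  qed simp
  have neq_sets: "{z\<in>space M. p z \<noteq> q z} \<in> sets M"
    if "p \<in> measurable M (count_space {..<k})" "q \<in> measurable M (count_space {..<k})" for p q
  proof -
    have "{z\<in>space M. p z \<noteq> q z} = space M - (\<Union>v<k. (p -` {v} \<inter> space M) \<inter> (q -` {v} \<inter> space M))"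
      using measurable_space[OF that(1)] by fastforce
    also have "\<dots> \<in> sets M"
      by (intro sets.Diff sets.top sets.finite_UN sets.Int measurable_sets[OF that(1)] measurable_sets[OF that(2)]) auto
    finally show ?thesis .
  qed
  have bad0: "measure M {z\<in>space M. FM z \<noteq> u (L m z)} < e1"
  proof -
    have "\<iota> -` {z\<in>space M. FM z \<noteq> u (L m z)} = {x\<in>space P. F x \<noteq> u (l m x)}"
      by (auto simp: FM_def j\<iota> l_def spM spP)
    then show ?thesis using um mM[OF neq_sets[OF FM uL]] by simp
  qed
  have Lc: "L m (c g z) = c g ` L m z" if "g \<in> carrier G" "z \<in> space M" for g z
    using L[OF that(2)] D(4)[OF that(1)] by (intro L_eq) auto
  have FMa: "(\<lambda>z. FM (a' (inv\<^bsub>G\<^esub> s) z)) \<in> measurable M (count_space {..<k})" if "s \<in> S" for s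
    using that S by (intro measurable_compose[OF pmp_actionD(3)[OF a'] FM]) auto
  have FMc: "(\<lambda>z. FM (c (inv\<^bsub>G\<^esub> s) z)) \<in> measurable M (count_space {..<k})" if "s \<in> S" for s
    using that S by (intro measurable_compose[OF pmp_actionD(3)[OF c] FM]) auto
  have uLc: "(\<lambda>z. u (L m (c (inv\<^bsub>G\<^esub> s) z))) \<in> measurable M (count_space {..<k})" if "s \<in> S" for s
    using that S by (intro measurable_compose[OF pmp_actionD(3)[OF c] uL]) auto
  \<comment> \<open>\<open>B1 s\<close> records where replacing \<open>a'\<close> by
    \<open>c\<close> changes the observed value, and \<open>B2 s\<close> where replacing
    \<open>FM\<close> by its approximation on pieces does. The second is a translate of a single
    small set, so its measure does not depend on \<open>s\<close>.\<close>
  define B1 where "B1 s = {z\<in>space M. FM (a' (inv\<^bsub>G\<^esub> s) z) \<noteq> FM (c (inv\<^bsub>G\<^esub> s) z)}" for s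
  define B2 where "B2 s = {z\<in>space M. FM (c (inv\<^bsub>G\<^esub> s) z) \<noteq> u (L m (c (inv\<^bsub>G\<^esub> s) z))}" for s
  have Bs: "B1 s \<in> sets M" "B2 s \<in> sets M" if "s \<in> S" for s
    unfolding B1_def B2_def using neq_sets[OF FMa[OF that] FMc[OF that]] neq_sets[OF FMc[OF that] uLc[OF that]] by auto
  have B1: "measure M (B1 s) \<le> e1" if s: "s \<in> S" for s
  proof -
    have sG: "s \<in> carrier G" using s S by auto
    have ds: "sym_diff (c s ` Av v) (a' s ` Av v) \<in> sets M" for v
      using pmp_action_image_sets[OF c sG Av] pmp_action_image_sets[OF a' sG Av] by auto
    have "B1 s \<subseteq> (\<Union>v<k. sym_diff (c s ` Av v) (a' s ` Av v))"
    proof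
      fix z assume z: "z \<in> B1 s"
      define v where "v = FM (a' (inv\<^bsub>G\<^esub> s) z)"
      have zM: "z \<in> space M" using z by (simp add: B1_def)
      have az: "a' (inv\<^bsub>G\<^esub> s) z \<in> space M" "c (inv\<^bsub>G\<^esub> s) z \<in> space M"
        using pmp_actionD(8)[OF a'] pmp_actionD(8)[OF c] zM sG by auto
      have "v < k" unfolding v_def using measurable_space[OF FM az(1)] by simp
      moreover have "z \<in> a' s ` Av v"
        using pmp_action_image[OF a' sG, of "Av v"] zM az by (simp add: Av_def v_def)
      moreover have "z \<notin> c s ` Av v"
        using pmp_action_image[OF c sG, of "Av v"] z by (simp add: Av_def v_def B1_def)
      ultimately show "z \<in> (\<Union>v<k. sym_diff (c s ` Av v) (a' s ` Av v))"
        by (intro UN_I[of v]) auto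
    qed
    then have "measure M (B1 s) \<le> measure M (\<Union>v<k. sym_diff (c s ` Av v) (a' s ` Av v))"
      using ds by (intro M.finite_measure_mono) auto
    also have "\<dots> \<le> (\<Sum>v<k. measure M (sym_diff (c s ` Av v) (a' s ` Av v)))"
      using ds by (intro measure_UNION_le) auto
    also have "\<dots> \<le> (\<Sum>v<k. e1 / real k)" using close[OF s] by (intro sum_mono) (auto intro: less_imp_le)
    also have "\<dots> = e1" using kpos by simp
    finally show ?thesis .
  qed
  have B2: "measure M (B2 s) \<le> e1" if s: "s \<in> S" for s
  proof -
    have "inv\<^bsub>G\<^esub> s \<in> carrier G" using s S by auto
    then have "measure M (B2 s) = measure M {z\<in>space M. FM z \<noteq> u (L m z)}"
      unfolding B2_def using neq_sets[OF FM uL] by (rule pmp_action_measure[OF c])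
    then show ?thesis using bad0 by simp
  qed
  define B where "B = (\<Union>s\<in>S. B1 s \<union> B2 s)"
  have Bm: "B \<in> sets M" unfolding B_def using S Bs by (intro sets.finite_UN) auto
  have "measure M B \<le> (\<Sum>s\<in>S. measure M (B1 s \<union> B2 s))"
    unfolding B_def using S Bs by (intro measure_UNION_le) auto
  also have "\<dots> \<le> (\<Sum>s\<in>S. 2 * e1)"
  proof (rule sum_mono)
    fix s assume s: "s \<in> S"
    have "measure M (B1 s \<union> B2 s) \<le> measure M (B1 s) + measure M (B2 s)"
      using Bs[OF s] by (intro measure_Un_le) auto
    then show "measure M (B1 s \<union> B2 s) \<le> 2 * e1" using B1[OF s] B2[OF s] by simp
  qed
  also have "\<dots> = real (card S) * (2 * e1)" by simp
  also have "\<dots> < n * (2 * e1)" using e1 by (intro mult_strict_right_mono) (auto simp: n_def)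
  also have "\<dots> = \<epsilon>" using n by (simp add: e1_def)
  finally have B: "measure M B < \<epsilon>" .
  have "\<bar>measure Y {y\<in>space Y. R (\<lambda>s\<in>S. f (b (inv\<^bsub>G\<^esub> s) y))} -
      (\<Sum>A | A \<in> D m \<and> R (\<lambda>s\<in>S. u (c (inv\<^bsub>G\<^esub> s) ` A)). measure M A)\<bar> < \<epsilon>" for R
  proof -
    let ?E1 = "{z\<in>space M. R (\<lambda>s\<in>S. FM (a' (inv\<^bsub>G\<^esub> s) z))}"
    let ?E2 = "{z\<in>space M. R (\<lambda>s\<in>S. u (L m (c (inv\<^bsub>G\<^esub> s) z)))}"
    have E1: "?E1 \<in> sets M" by (rule pattern_sets[OF S(1) FMa]) auto
    have E2: "?E2 \<in> sets M" by (rule pattern_sets[OF S(1) uLc]) auto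
    have "measure M ?E1 = measure P (\<iota> -` ?E1)" by (rule mM[OF E1])
    also have "\<iota> -` ?E1 = {x\<in>space P. R (\<lambda>s\<in>S. F (a (inv\<^bsub>G\<^esub> s) x))}"
      by (auto simp: spM spP FM_def a'_def j\<iota>)
    finally have 1: "measure M ?E1 = measure Y {y\<in>space Y. R (\<lambda>s\<in>S. f (b (inv\<^bsub>G\<^esub> s) y))}"
      by (rule trans[OF _ law[OF S, symmetric]])
    have "(\<lambda>s\<in>S. u (L m (c (inv\<^bsub>G\<^esub> s) z))) = (\<lambda>s\<in>S. u (c (inv\<^bsub>G\<^esub> s) ` L m z))" if "z \<in> space M" for z
      by (rule restrict_ext) (use that S in \<open>auto simp: Lc\<close>)
    then have "?E2 = {z\<in>space M. R (\<lambda>s\<in>S. u (c (inv\<^bsub>G\<^esub> s) ` L m z))}" by auto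
    then have 2: "measure M ?E2 = (\<Sum>A | A \<in> D m \<and> R (\<lambda>s\<in>S. u (c (inv\<^bsub>G\<^esub> s) ` A)). measure M A)"
      using partition_sum(1)[OF M.finite_measure_axioms D(1,2,3),
          of "\<lambda>A. R (\<lambda>s\<in>S. u (c (inv\<^bsub>G\<^esub> s) ` A))" m] by (simp add: L_def)
    have "\<bar>measure M ?E1 - measure M ?E2\<bar> \<le> measure M B"
    proof (rule M.measure_neq_le[OF E1 E2 Bm])
      fix z assume z: "z \<in> space M"
        and ne: "R (\<lambda>s\<in>S. FM (a' (inv\<^bsub>G\<^esub> s) z)) \<noteq> R (\<lambda>s\<in>S. u (L m (c (inv\<^bsub>G\<^esub> s) z)))"
      have "\<exists>s\<in>S. FM (a' (inv\<^bsub>G\<^esub> s) z) \<noteq> u (L m (c (inv\<^bsub>G\<^esub> s) z))"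
      proof (rule ccontr)
        assume "\<not> ?thesis"
        then have "(\<lambda>s\<in>S. FM (a' (inv\<^bsub>G\<^esub> s) z)) = (\<lambda>s\<in>S. u (L m (c (inv\<^bsub>G\<^esub> s) z)))"
          by (intro restrict_ext) simp
        then show False using ne by simp
      qed
      then obtain s where s: "s \<in> S" "FM (a' (inv\<^bsub>G\<^esub> s) z) \<noteq> u (L m (c (inv\<^bsub>G\<^esub> s) z))" by auto
      then have "z \<in> B1 s \<union> B2 s" using z by (auto simp: B1_def B2_def)
      then show "z \<in> B" unfolding B_def using s(1) by (rule UN_I[rotated])
    qed
    then show ?thesis using 1 2 B by simp
  qed
  then show ?thesis using c Qc D u
    by (intro exI[of _ M] exI[of _ c] exI[of _ "D m"] exI[of _ u]) auto
qed

text \<open>A finite set with a left action, without the extensionality demanded by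
  \<open>group_action\<close>. The actions used below, such as taking images of pieces or
  multiplying cosets, are given by total functions.\<close>

definition gset :: "('g, 'm) monoid_scheme \<Rightarrow> 'd set \<Rightarrow> ('g \<Rightarrow> 'd \<Rightarrow> 'd) \<Rightarrow> bool" where
  "gset G D c \<longleftrightarrow> finite D \<and> (\<forall>g\<in>carrier G. \<forall>d\<in>D. c g d \<in> D) \<and> (\<forall>d\<in>D. c \<one>\<^bsub>G\<^esub> d = d) \<and>
     (\<forall>g\<in>carrier G. \<forall>h\<in>carrier G. \<forall>d\<in>D. c (g \<otimes>\<^bsub>G\<^esub> h) d = c g (c h d))"

definition weights :: "('g, 'm) monoid_scheme \<Rightarrow> 'd set \<Rightarrow> ('g \<Rightarrow> 'd \<Rightarrow> 'd) \<Rightarrow> ('d \<Rightarrow> real) \<Rightarrow> bool" where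
  "weights G D c w \<longleftrightarrow> (\<forall>d\<in>D. 0 \<le> w d) \<and> (\<forall>g\<in>carrier G. \<forall>d\<in>D. w (c g d) = w d) \<and> sum w D = 1"

lemma partition_gset:
  assumes c: "pmp_action G M c" and D: "partition_on (space M) D" "finite D" "D \<subseteq> sets M"
    "\<And>g A. g \<in> carrier G \<Longrightarrow> A \<in> D \<Longrightarrow> c g ` A \<in> D"
  shows "gset G D (\<lambda>g. (`) (c g))" and "weights G D (\<lambda>g. (`) (c g)) (measure M)"
proof -
  interpret prob_space M using c by (rule pmp_actionD)
  have sub: "A \<subseteq> space M" if "A \<in> D" for A
    using D(3) that sets.sets_into_space[of A M] by auto
  show "gset G D (\<lambda>g. (`) (c g))"
    unfolding gset_def
  proof (intro conjI ballI D(2,4))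
    fix A assume A: "A \<in> D"
    show "c \<one>\<^bsub>G\<^esub> ` A = A"
      using pmp_actionD(6)[OF c] sub[OF A] by (auto simp: subset_eq image_iff)
    fix g h assume "g \<in> carrier G" "h \<in> carrier G"
    then have "c (g \<otimes>\<^bsub>G\<^esub> h) x = c g (c h x)" if "x \<in> A" for x
      using pmp_actionD(7)[OF c] sub[OF A] that by auto
    then show "c (g \<otimes>\<^bsub>G\<^esub> h) ` A = c g ` c h ` A" by (simp add: image_image)
  qed
  have "(\<Sum>A | A \<in> D \<and> True. measure M A) = 1"
    using partition_sum(1)[OF finite_measure_axioms D(1,2,3), of "\<lambda>_. True"] by (simp add: prob_space)
  then show "weights G D (\<lambda>g. (`) (c g)) (measure M)"
    using pmp_action_image_measure[OF c] D(3) by (auto simp: weights_def)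
qed

lemma gset_inv:
  assumes "group G" "gset G D c" "g \<in> carrier G" "d \<in> D"
  shows "c (inv\<^bsub>G\<^esub> g) (c g d) = d" "c g (c (inv\<^bsub>G\<^esub> g) d) = d"
proof -
  interpret group G by fact
  have m: "c (h \<otimes>\<^bsub>G\<^esub> k) d = c h (c k d)" if "h \<in> carrier G" "k \<in> carrier G" for h k
    using assms(2,4) that by (simp add: gset_def)
  have "c \<one>\<^bsub>G\<^esub> d = d" using assms(2,4) by (simp add: gset_def)
  then show "c (inv\<^bsub>G\<^esub> g) (c g d) = d" "c g (c (inv\<^bsub>G\<^esub> g) d) = d"
    using m[of "inv\<^bsub>G\<^esub> g" g] m[of g "inv\<^bsub>G\<^esub> g"] assms(3) by simp_all
qed

lemma gset_bij:
  assumes "group G" "gset G D c" "g \<in> carrier G"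
  shows "bij_betw (c g) D D"
proof -
  interpret group G by fact
  show ?thesis
    by (rule bij_betw_byWitness[where f' = "c (inv\<^bsub>G\<^esub> g)"])
      (use gset_inv[OF assms] assms in \<open>auto simp: gset_def\<close>)
qed

lemma weights_sum_translate:
  assumes "group G" "gset G D c" "weights G D c w" "g \<in> carrier G"
  shows "(\<Sum>d | d \<in> D \<and> P (c g d). w d) = (\<Sum>d | d \<in> D \<and> P d. w d)"
proof -
  have fin: "finite D" using assms by (simp add: gset_def)
  have "(\<Sum>d | d \<in> D \<and> P d. w d) = (\<Sum>d\<in>D. if P d then w d else 0)"
    using fin by (simp add: sum.inter_filter)
  also have "\<dots> = (\<Sum>d\<in>D. if P (c g d) then w (c g d) else 0)"
    by (rule sum.reindex_bij_betw[OF gset_bij[OF assms(1,2,4)], symmetric])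
  also have "\<dots> = (\<Sum>d\<in>D. if P (c g d) then w d else 0)"
    using assms(3,4) by (intro sum.cong) (auto simp: weights_def)
  also have "\<dots> = (\<Sum>d | d \<in> D \<and> P (c g d). w d)"
    using fin by (simp add: sum.inter_filter)
  finally show ?thesis by simp
qed

text \<open>The values in \<open>V\<close> are coded by the numbers below \<open>card V\<close>, and
  the test predicate on patterns is composed with the decoding. This makes room for functions whose
  values are themselves tuples.\<close>

lemma finite_model_partition:
  fixes Y :: "'y measure" and f :: "'y \<Rightarrow> 'v" and Q :: "real measure \<Rightarrow> ('g \<Rightarrow> real \<Rightarrow> real) \<Rightarrow> bool"
  assumes b: "pmp_action G Y b" and cG: "countable (carrier G)"
    and dense: "\<forall>M :: real measure. standard_nonatomic M \<longrightarrow> action_space G M closure_of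
      {a \<in> topspace (action_space G M). Q M a \<and> profinite_action G M a} = topspace (action_space G M)"
    and f: "f \<in> measurable Y (count_space V)" and V: "finite V"
    and S: "finite S" "S \<subseteq> carrier G" and e: "0 < \<epsilon>"
  shows "\<exists>(M :: real measure) c D f'. pmp_action G M c \<and> Q M c \<and> partition_on (space M) D \<and> finite D \<and>
    D \<subseteq> sets M \<and> (\<forall>g\<in>carrier G. \<forall>A\<in>D. c g ` A \<in> D) \<and> (\<forall>A. f' A \<in> V) \<and>
    (\<forall>R. \<bar>measure Y {y\<in>space Y. R (\<lambda>s\<in>S. f (b (inv\<^bsub>G\<^esub> s) y))} -
      (\<Sum>A | A \<in> D \<and> R (\<lambda>s\<in>S. f' (c (inv\<^bsub>G\<^esub> s) ` A)). measure M A)\<bar> < \<epsilon>)"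
proof -
  interpret group G using b by (rule pmp_actionD)
  obtain h where "bij_betw h V {0..<card V}" using ex_bij_betw_finite_nat[OF V] by blast
  then have h: "bij_betw h V {..<card V}" by (simp add: atLeast0LessThan)
  have hf: "(\<lambda>y. h (f y)) \<in> measurable Y (count_space {..<card V})"
    by (rule measurable_compose[OF f]) (use h in \<open>auto simp: bij_betw_def\<close>)
  define k where "k = inv_into V h"
  have kh: "k (h v) = v" if "v \<in> V" for v using h that by (simp add: k_def bij_betw_def)
  have kV: "k n \<in> V" if "n < card V" for n
  proof -
    have "n \<in> h ` V" using h that by (auto simp: bij_betw_def)
    then show ?thesis unfolding k_def by (rule inv_into_into)
  qed
  obtain M :: "real measure" and c D f' where
    c: "pmp_action G M c" "Q M c" "partition_on (space M) D" "finite D" "D \<subseteq> sets M"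
       "\<forall>g\<in>carrier G. \<forall>A\<in>D. c g ` A \<in> D" and f': "\<forall>A. f' A < card V" and
    *: "\<forall>R. \<bar>measure Y {y\<in>space Y. R (\<lambda>s\<in>S. h (f (b (inv\<^bsub>G\<^esub> s) y)))} -
      (\<Sum>A | A \<in> D \<and> R (\<lambda>s\<in>S. f' (c (inv\<^bsub>G\<^esub> s) ` A)). measure M A)\<bar> < \<epsilon>"
    using finite_model_aux[where Q = Q, OF b cG dense hf S e] by (elim exE conjE) (rule that)
  have "\<bar>measure Y {y\<in>space Y. R (\<lambda>s\<in>S. f (b (inv\<^bsub>G\<^esub> s) y))} -
      (\<Sum>A | A \<in> D \<and> R (\<lambda>s\<in>S. k (f' (c (inv\<^bsub>G\<^esub> s) ` A))). measure M A)\<bar> < \<epsilon>" for R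
  proof -
    define R' where "R' p \<longleftrightarrow> R (\<lambda>s\<in>S. k (p s))" for p
    have 1: "R' (\<lambda>s\<in>S. h (f (b (inv\<^bsub>G\<^esub> s) y))) = R (\<lambda>s\<in>S. f (b (inv\<^bsub>G\<^esub> s) y))" if "y \<in> space Y" for y
    proof -
      have "(\<lambda>s\<in>S. k ((\<lambda>s\<in>S. h (f (b (inv\<^bsub>G\<^esub> s) y))) s)) = (\<lambda>s\<in>S. f (b (inv\<^bsub>G\<^esub> s) y))"
        by (rule restrict_ext)
          (use S that measurable_space[OF f] pmp_actionD(8)[OF b] in \<open>auto intro!: kh\<close>)
      then show ?thesis by (simp only: R'_def)
    qed
    have 2: "R' (\<lambda>s\<in>S. f' (c (inv\<^bsub>G\<^esub> s) ` A)) = R (\<lambda>s\<in>S. k (f' (c (inv\<^bsub>G\<^esub> s) ` A)))" for A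
    proof -
      have "(\<lambda>s\<in>S. k ((\<lambda>s\<in>S. f' (c (inv\<^bsub>G\<^esub> s) ` A)) s)) = (\<lambda>s\<in>S. k (f' (c (inv\<^bsub>G\<^esub> s) ` A)))"
        by (rule restrict_ext) simp
      then show ?thesis by (simp only: R'_def)
    qed
    have "{y\<in>space Y. R' (\<lambda>s\<in>S. h (f (b (inv\<^bsub>G\<^esub> s) y)))} = {y\<in>space Y. R (\<lambda>s\<in>S. f (b (inv\<^bsub>G\<^esub> s) y))}"
      using 1 by blast
    then show ?thesis using *[rule_format, of R'] by (simp only: 2)
  qed
  then show ?thesis using c kV f'
    by (intro exI[of _ M] exI[of _ c] exI[of _ D] exI[of _ "\<lambda>A. k (f' A)"]) simp
qed

lemma finite_model_MD:
  fixes Y :: "'y measure" and f :: "'y \<Rightarrow> 'v"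
  assumes MD: "property_MD G" and b: "pmp_action G Y b" and cG: "countable (carrier G)"
    and f: "f \<in> measurable Y (count_space V)" and V: "finite V"
    and S: "finite S" "S \<subseteq> carrier G" and e: "0 < \<epsilon>"
  shows "\<exists>(D :: real set set) c w f'. gset G D c \<and> weights G D c w \<and> (\<forall>d. f' d \<in> V) \<and>
    (\<forall>R. \<bar>measure Y {y\<in>space Y. R (\<lambda>s\<in>S. f (b (inv\<^bsub>G\<^esub> s) y))} -
      (\<Sum>d | d \<in> D \<and> R (\<lambda>s\<in>S. f' (c (inv\<^bsub>G\<^esub> s) d)). w d)\<bar> < \<epsilon>)"
proof -
  have dense: "\<forall>M :: real measure. standard_nonatomic M \<longrightarrow> action_space G M closure_of
      {a \<in> topspace (action_space G M). True \<and> profinite_action G M a} = topspace (action_space G M)"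
    using MD by (simp add: property_MD_def)
  obtain M :: "real measure" and c D f' where
    c: "pmp_action G M c" and D: "partition_on (space M) D" "finite D" "D \<subseteq> sets M"
       "\<forall>g\<in>carrier G. \<forall>A\<in>D. c g ` A \<in> D" and f': "\<forall>A. f' A \<in> V" and
    *: "\<forall>R. \<bar>measure Y {y\<in>space Y. R (\<lambda>s\<in>S. f (b (inv\<^bsub>G\<^esub> s) y))} -
      (\<Sum>A | A \<in> D \<and> R (\<lambda>s\<in>S. f' (c (inv\<^bsub>G\<^esub> s) ` A)). measure M A)\<bar> < \<epsilon>"
    using finite_model_partition[where Q = "\<lambda>_ _. True", OF b cG dense f V S e]
    by (elim exE conjE) (rule that)
  have D4: "c g ` A \<in> D" if "g \<in> carrier G" "A \<in> D" for g A using D(4) that by simp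
  show ?thesis
    by (intro exI[of _ D] exI[of _ "\<lambda>g. (`) (c g)"] exI[of _ "measure M"] exI[of _ f'] conjI
        partition_gset[OF c D(1,2,3) D4] f' *)
qed

lemma finite_model_EMD:
  fixes Y :: "'y measure" and f :: "'y \<Rightarrow> 'v"
  assumes EMD: "property_EMD G" and b: "pmp_action G Y b" and cG: "countable (carrier G)"
    and f: "f \<in> measurable Y (count_space V)" and V: "finite V"
    and S: "finite S" "S \<subseteq> carrier G" and e: "0 < \<epsilon>"
  shows "\<exists>(D :: real set set) c w f'. gset G D c \<and> weights G D c w \<and> (\<forall>d. f' d \<in> V) \<and>
    (\<forall>d\<in>D. \<forall>d'\<in>D. \<exists>g\<in>carrier G. c g d = d') \<and>
    (\<forall>R. \<bar>measure Y {y\<in>space Y. R (\<lambda>s\<in>S. f (b (inv\<^bsub>G\<^esub> s) y))} -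
      (\<Sum>d | d \<in> D \<and> R (\<lambda>s\<in>S. f' (c (inv\<^bsub>G\<^esub> s) d)). w d)\<bar> < \<epsilon>)"
proof -
  interpret group G using b by (rule pmp_actionD)
  have dense: "\<forall>M :: real measure. standard_nonatomic M \<longrightarrow> action_space G M closure_of
      {a \<in> topspace (action_space G M). ergodic G M a \<and> profinite_action G M a} = topspace (action_space G M)"
    using EMD by (simp add: property_EMD_def)
  obtain M :: "real measure" and c D f' where
    c: "pmp_action G M c" and erg: "ergodic G M c" and D: "partition_on (space M) D" "finite D" "D \<subseteq> sets M"
       "\<forall>g\<in>carrier G. \<forall>A\<in>D. c g ` A \<in> D" and f': "\<forall>A. f' A \<in> V" and
    *: "\<forall>R. \<bar>measure Y {y\<in>space Y. R (\<lambda>s\<in>S. f (b (inv\<^bsub>G\<^esub> s) y))} -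
      (\<Sum>A | A \<in> D \<and> R (\<lambda>s\<in>S. f' (c (inv\<^bsub>G\<^esub> s) ` A)). measure M A)\<bar> < \<epsilon>"
    using finite_model_partition[where Q = "ergodic G", OF b cG dense f V S e]
    by (elim exE conjE) (rule that)
  interpret M: prob_space M using c by (rule pmp_actionD)
  have D4: "c g ` A \<in> D" if "g \<in> carrier G" "A \<in> D" for g A using D(4) that by simp
  have gs: "gset G D (\<lambda>g. (`) (c g))" and ws: "weights G D (\<lambda>g. (`) (c g)) (measure M)"
    using partition_gset[OF c D(1,2,3) D4] by auto
  have "\<exists>A\<in>D. measure M A \<noteq> 0"
  proof (rule ccontr)
    assume "\<not> ?thesis"
    then have "sum (measure M) D = 0" by simp
    then show False using ws by (simp add: weights_def)
  qed
  then obtain A0 where A0: "A0 \<in> D" "measure M A0 \<noteq> 0" by auto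
  define K where "K = (\<lambda>g. c g ` A0) ` carrier G"
  have KD: "K \<subseteq> D" using D4 A0 by (auto simp: K_def)
  have finK: "finite K" using KD D(2) by (rule finite_subset)
  have mult: "c g ` c h ` A0 = c (g \<otimes>\<^bsub>G\<^esub> h) ` A0" if "g \<in> carrier G" "h \<in> carrier G" for g h
    using gs that A0 by (simp add: gset_def)
  have Kc: "c g ` A \<in> K" if g: "g \<in> carrier G" and A: "A \<in> K" for g A
  proof -
    obtain h where "h \<in> carrier G" "A = c h ` A0" using A by (auto simp: K_def)
    then show ?thesis using mult[OF g] g unfolding K_def
      by (intro image_eqI[of _ _ "g \<otimes>\<^bsub>G\<^esub> h"]) auto
  qed
  have "c \<one>\<^bsub>G\<^esub> ` A0 = A0" using gs A0(1) by (simp add: gset_def)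
  then have A0K: "A0 \<in> K" unfolding K_def by (intro image_eqI[of _ _ "\<one>\<^bsub>G\<^esub>"] one_closed) (rule sym)
  have Us: "\<Union>K \<in> sets M" using KD D(3) finK by (intro sets.finite_Union) auto
  have sub: "c g ` \<Union>K \<subseteq> \<Union>K" if "g \<in> carrier G" for g using Kc[OF that] by blast
  have Uinv: "c g ` \<Union>K = \<Union>K" if g: "g \<in> carrier G" for g
  proof (intro equalityI sub[OF g] subsetI)
    fix x assume x: "x \<in> \<Union>K"
    have xM: "x \<in> space M" using x sets.sets_into_space[OF Us] by auto
    have "c (inv\<^bsub>G\<^esub> g) x \<in> \<Union>K" using sub[of "inv\<^bsub>G\<^esub> g"] g x by blast
    then show "x \<in> c g ` \<Union>K" using pmp_action_inv(1)[OF c g xM]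
      by (intro image_eqI[of _ _ "c (inv\<^bsub>G\<^esub> g) x"]) auto
  qed
  have "measure M (\<Union>K) = 0 \<or> measure M (\<Union>K) = 1"
    using erg Us Uinv unfolding ergodic_def by blast
  moreover have "measure M (\<Union>K) \<noteq> 0"
  proof
    assume "measure M (\<Union>K) = 0"
    moreover have "measure M A0 \<le> measure M (\<Union>K)" using A0K Us by (intro M.finite_measure_mono) auto
    ultimately show False using A0(2) measure_nonneg[of M A0] by simp
  qed
  ultimately have U1: "measure M (\<Union>K) = 1" by blast
  have zero: "measure M A = 0" if "A \<in> D - K" for A
  proof -
    have "A \<inter> B = {}" if "B \<in> K" for B
      by (rule disjointD[OF partition_onD2[OF D(1)]]) (use \<open>A \<in> D - K\<close> that KD in auto)
    then have "A \<subseteq> space M - \<Union>K" using that D(3) sets.sets_into_space[of A M] by auto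
    then have "measure M A \<le> measure M (space M - \<Union>K)" using Us by (intro M.finite_measure_mono) auto
    also have "\<dots> = 0" using U1 M.prob_compl[OF Us] by simp
    finally show ?thesis using measure_nonneg[of M A] by simp
  qed
  have sumK: "(\<Sum>A | A \<in> D \<and> P A. measure M A) = (\<Sum>A | A \<in> K \<and> P A. measure M A)" for P
    by (rule sum.mono_neutral_right) (use D(2) KD zero in auto)
  have gK: "gset G K (\<lambda>g. (`) (c g))"
    using gs finK Kc KD by (auto simp: gset_def subset_eq)
  have "sum (measure M) K = 1" using sumK[of "\<lambda>_. True"] ws by (simp add: weights_def)
  then have wK: "weights G K (\<lambda>g. (`) (c g)) (measure M)"
    using ws KD by (auto simp: weights_def subset_eq)
  have trans: "\<forall>d\<in>K. \<forall>d'\<in>K. \<exists>g\<in>carrier G. c g ` d = d'"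
  proof (intro ballI)
    fix d d' assume "d \<in> K" "d' \<in> K"
    then obtain g h where gh: "g \<in> carrier G" "d = c g ` A0" "h \<in> carrier G" "d' = c h ` A0"
      by (auto simp: K_def)
    have "h \<otimes>\<^bsub>G\<^esub> inv\<^bsub>G\<^esub> g \<otimes>\<^bsub>G\<^esub> g = h" using gh by (simp add: m_assoc)
    then have "c (h \<otimes>\<^bsub>G\<^esub> inv\<^bsub>G\<^esub> g) ` d = d'" using mult[of "h \<otimes>\<^bsub>G\<^esub> inv\<^bsub>G\<^esub> g" g] gh by simp
    then show "\<exists>g\<in>carrier G. c g ` d = d'" using gh by (intro bexI[of _ "h \<otimes>\<^bsub>G\<^esub> inv\<^bsub>G\<^esub> g"]) auto
  qed
  show ?thesis
    using * by (intro exI[of _ K] exI[of _ "\<lambda>g. (`) (c g)"] exI[of _ "measure M"] exI[of _ f'] conjI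
        gK wK f' trans) (simp only: sumK simp_thms)
qed

text \<open>The group permutes the factors by \<open>\<sigma>\<close> and moves the points inside
  them by \<open>b\<close>. Factor \<open>j\<close> is carried onto factor
  \<open>\<sigma> g j\<close> with its law, so on boxes the product of the measures is merely
  reindexed by the bijection \<open>\<sigma> g\<close>, and boxes determine the product
  measure.\<close>

lemma pmp_action_PiM:
  fixes \<nu> :: "'i \<Rightarrow> 'y measure"
  assumes G: "group G" and I: "gset G I \<sigma>" and prob: "\<And>j. prob_space (\<nu> j)"
    and sN: "\<And>j. sets (\<nu> j) = sets N" and b: "\<And>g. g \<in> carrier G \<Longrightarrow> b g \<in> measurable N N"
    and one: "\<And>y. y \<in> space N \<Longrightarrow> b \<one>\<^bsub>G\<^esub> y = y"
    and mult: "\<And>g h y. g \<in> carrier G \<Longrightarrow> h \<in> carrier G \<Longrightarrow> y \<in> space N \<Longrightarrow> b (g \<otimes>\<^bsub>G\<^esub> h) y = b g (b h y)"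
    and dis: "\<And>g j. g \<in> carrier G \<Longrightarrow> j \<in> I \<Longrightarrow> distr (\<nu> j) N (b g) = \<nu> (\<sigma> g j)"
  shows "pmp_action G (PiM I \<nu>) (\<lambda>g. \<lambda>x\<in>space (PiM I \<nu>). \<lambda>j\<in>I. b g (x (\<sigma> (inv\<^bsub>G\<^esub> g) j)))"
    (is "pmp_action G ?W ?a")
proof -
  interpret group G by fact
  interpret product_sigma_finite \<nu>
    by (rule product_sigma_finite.intro) (rule prob_space_imp_sigma_finite[OF prob])
  have fin: "finite I" using I by (simp add: gset_def)
  have spN: "space (\<nu> j) = space N" for j using sN by (rule sets_eq_imp_space_eq)
  have spW: "space ?W = I \<rightarrow>\<^sub>E space N" by (simp add: space_PiM spN)
  have \<sigma>I: "\<sigma> g j \<in> I" if "g \<in> carrier G" "j \<in> I" for g j using I that by (simp add: gset_def)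
  have m: "?a g \<in> measurable ?W ?W" if g: "g \<in> carrier G" for g
  proof -
    have "(\<lambda>x. \<lambda>j\<in>I. b g (x (\<sigma> (inv\<^bsub>G\<^esub> g) j))) \<in> measurable ?W ?W"
    proof (rule measurable_restrict)
      fix j assume j: "j \<in> I"
      have bj: "b g \<in> measurable (\<nu> (\<sigma> (inv\<^bsub>G\<^esub> g) j)) (\<nu> j)"
        using b[OF g] measurable_cong_sets[OF sN sN] by blast
      have cj: "(\<lambda>x. x (\<sigma> (inv\<^bsub>G\<^esub> g) j)) \<in> measurable ?W (\<nu> (\<sigma> (inv\<^bsub>G\<^esub> g) j))"
        by (rule measurable_component_singleton) (use \<sigma>I g j in auto)
      show "(\<lambda>x. b g (x (\<sigma> (inv\<^bsub>G\<^esub> g) j))) \<in> measurable ?W (\<nu> j)"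
        by (rule measurable_compose[OF cj bj])
    qed
    moreover have "?a g \<in> measurable ?W ?W \<longleftrightarrow> (\<lambda>x. \<lambda>j\<in>I. b g (x (\<sigma> (inv\<^bsub>G\<^esub> g) j))) \<in> measurable ?W ?W"
      by (rule measurable_cong) simp
    ultimately show ?thesis by (rule iffD2[rotated])
  qed
  show ?thesis
  proof (rule pmp_actionI[OF G])
    show "prob_space ?W" by (rule prob_space_PiM[OF prob])
    fix g assume g: "g \<in> carrier G"
    show "?a g \<in> extensional (space ?W)" by simp
    show "?a g \<in> measurable ?W ?W" by (rule m[OF g])
    show "distr ?W ?W (?a g) = ?W"
    proof (rule PiM_eqI[OF fin])
      fix A assume A: "\<And>i. i \<in> I \<Longrightarrow> A i \<in> sets (\<nu> i)"
      have As: "Pi\<^sub>E I A \<in> sets ?W" using A fin by (intro sets_PiM_I_finite) auto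
      \<comment> \<open>Coordinate \<open>\<sigma> g i\<close> of the translated point is
        \<open>b g (x i)\<close>, so the preimage of the box with sides \<open>A\<close> is the box
        whose side \<open>i\<close> is the preimage of \<open>A (\<sigma> g i)\<close>.\<close>
      define B where "B i = b g -` A (\<sigma> g i) \<inter> space N" for i
      have AN: "A i \<in> sets N" if "i \<in> I" for i using A[OF that] by (simp add: sN)
      have B: "B i \<in> sets (\<nu> i)" if "i \<in> I" for i
        unfolding B_def sN using b[OF g] AN[OF \<sigma>I[OF g that]] by (rule measurable_sets)
      have "emeasure (distr ?W ?W (?a g)) (Pi\<^sub>E I A) = emeasure ?W (?a g -` Pi\<^sub>E I A \<inter> space ?W)"
        by (rule emeasure_distr[OF m[OF g] As])
      also have "?a g -` Pi\<^sub>E I A \<inter> space ?W = Pi\<^sub>E I B"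
      proof (intro equalityI subsetI)
        fix x assume x: "x \<in> ?a g -` Pi\<^sub>E I A \<inter> space ?W"
        show "x \<in> Pi\<^sub>E I B"
        proof (rule PiE_I)
          fix i assume i: "i \<in> I"
          have "?a g x (\<sigma> g i) \<in> A (\<sigma> g i)" using x \<sigma>I[OF g i] by (auto simp: PiE_iff)
          then have "b g (x i) \<in> A (\<sigma> g i)"
            using x \<sigma>I[OF g i] gset_inv(1)[OF G I g i] by simp
          then show "x i \<in> B i" using x i by (auto simp: B_def spW)
        qed (use x in \<open>auto simp: spW PiE_iff extensional_def\<close>)
      next
        fix x assume x: "x \<in> Pi\<^sub>E I B"
        have xW: "x \<in> space ?W" using x by (auto simp: spW B_def PiE_iff)
        have "?a g x \<in> Pi\<^sub>E I A"
        proof (rule PiE_I)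
          fix j assume j: "j \<in> I"
          have i: "\<sigma> (inv\<^bsub>G\<^esub> g) j \<in> I" using \<sigma>I g j by simp
          have "x (\<sigma> (inv\<^bsub>G\<^esub> g) j) \<in> B (\<sigma> (inv\<^bsub>G\<^esub> g) j)" using x i by (auto simp: PiE_iff)
          then show "?a g x j \<in> A j" using xW j gset_inv(2)[OF G I g j] by (simp add: B_def)
        qed (use xW in auto)
        then show "x \<in> ?a g -` Pi\<^sub>E I A \<inter> space ?W" using xW by simp
      qed
      also have "emeasure ?W (Pi\<^sub>E I B) = (\<Prod>i\<in>I. emeasure (\<nu> i) (B i))"
        using B fin by (intro emeasure_PiM) auto
      also have "\<dots> = (\<Prod>i\<in>I. emeasure (\<nu> (\<sigma> g i)) (A (\<sigma> g i)))"
      proof (rule prod.cong[OF refl])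
        fix i assume i: "i \<in> I"
        have "emeasure (\<nu> (\<sigma> g i)) (A (\<sigma> g i)) = emeasure (distr (\<nu> i) N (b g)) (A (\<sigma> g i))"
          using dis[OF g i] by simp
        also have "\<dots> = emeasure (\<nu> i) (b g -` A (\<sigma> g i) \<inter> space (\<nu> i))"
          by (rule emeasure_distr) (use b[OF g] AN[OF \<sigma>I[OF g i]] measurable_cong_sets[OF sN refl] in auto)
        finally show "emeasure (\<nu> i) (B i) = emeasure (\<nu> (\<sigma> g i)) (A (\<sigma> g i))"
          by (simp add: B_def spN)
      qed
      also have "\<dots> = (\<Prod>i\<in>I. emeasure (\<nu> i) (A i))"
        by (rule prod.reindex_bij_betw[OF gset_bij[OF G I g]])
      finally show "emeasure (distr ?W ?W (?a g)) (Pi\<^sub>E I A) = (\<Prod>i\<in>I. emeasure (\<nu> i) (A i))" .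
    qed simp
  next
    fix x assume x: "x \<in> space ?W"
    have "(\<lambda>j\<in>I. b \<one>\<^bsub>G\<^esub> (x (\<sigma> (inv\<^bsub>G\<^esub> \<one>\<^bsub>G\<^esub>) j))) = x"
      by (rule extensionalityI[where A = I])
        (use x I one in \<open>auto simp: spW PiE_iff gset_def\<close>)
    then show "?a \<one>\<^bsub>G\<^esub> x = x" using x by simp
  next
    fix g h x assume g: "g \<in> carrier G" and h: "h \<in> carrier G" and x: "x \<in> space ?W"
    have hx: "?a h x \<in> space ?W" using measurable_space[OF m[OF h] x] .
    have "(\<lambda>j\<in>I. b (g \<otimes>\<^bsub>G\<^esub> h) (x (\<sigma> (inv\<^bsub>G\<^esub> (g \<otimes>\<^bsub>G\<^esub> h)) j))) =
      (\<lambda>j\<in>I. b g (?a h x (\<sigma> (inv\<^bsub>G\<^esub> g) j)))"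
    proof (rule restrict_ext)
      fix j assume j: "j \<in> I"
      have "\<sigma> (inv\<^bsub>G\<^esub> (g \<otimes>\<^bsub>G\<^esub> h)) j = \<sigma> (inv\<^bsub>G\<^esub> h) (\<sigma> (inv\<^bsub>G\<^esub> g) j)"
        using I g h j by (simp add: inv_mult_group gset_def)
      moreover have "x (\<sigma> (inv\<^bsub>G\<^esub> h) (\<sigma> (inv\<^bsub>G\<^esub> g) j)) \<in> space N"
        using x \<sigma>I g h j by (auto simp: spW PiE_iff)
      ultimately show "b (g \<otimes>\<^bsub>G\<^esub> h) (x (\<sigma> (inv\<^bsub>G\<^esub> (g \<otimes>\<^bsub>G\<^esub> h)) j)) = b g (?a h x (\<sigma> (inv\<^bsub>G\<^esub> g) j))"
        using x \<sigma>I g j mult[OF g h] by simp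
    qed
    then show "?a (g \<otimes>\<^bsub>G\<^esub> h) x = ?a g (?a h x)" using x hx by simp
  qed
qed

section \<open>Relative models\<close>

text \<open>In the product of the conditional laws, coordinate \<open>j\<close> is distributed as
  \<open>y\<close> given \<open>\<psi> y = j\<close>. The action is twisted so that coordinate
  \<open>\<sigma> (inv s) j\<close> of the translate of \<open>x\<close> by \<open>inv s\<close> is
  \<open>b (inv s) (x j)\<close>. Reading that coordinate for every \<open>s\<close> therefore shows
  exactly the pattern of the point \<open>x j\<close>. A model of all coordinates at once thus
  approximates every conditional law, with the dependence on \<open>j\<close> exact.\<close>

lemma relative_model:
  fixes Y :: "'y measure" and \<psi> :: "'y \<Rightarrow> 'i"
  assumes MD: "property_MD G" and b: "pmp_action G Y b" and cG: "countable (carrier G)"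
    and I: "gset G I \<sigma>" and \<psi>: "\<psi> \<in> measurable Y (count_space I)"
    and eq: "\<forall>g\<in>carrier G. AE y in Y. \<psi> (b g y) = \<sigma> g (\<psi> y)"
    and pos: "\<forall>j\<in>I. 0 < measure Y {y\<in>space Y. \<psi> y = j}"
    and \<alpha>: "\<alpha> \<in> measurable Y (count_space {..<p::nat})"
    and S: "finite S" "S \<subseteq> carrier G" and e: "0 < \<epsilon>"
  shows "\<exists>(D :: real set set) c w f'. gset G D c \<and> weights G D c w \<and> (\<forall>d. \<forall>j\<in>I. f' d j < p) \<and>
    (\<forall>j\<in>I. \<forall>R. \<bar>measure Y {y\<in>space Y. \<psi> y = j \<and> R (\<lambda>s\<in>S. \<alpha> (b (inv\<^bsub>G\<^esub> s) y))} -
      measure Y {y\<in>space Y. \<psi> y = j} *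
        (\<Sum>d | d \<in> D \<and> R (\<lambda>s\<in>S. f' (c (inv\<^bsub>G\<^esub> s) d) (\<sigma> (inv\<^bsub>G\<^esub> s) j)). w d)\<bar> < \<epsilon>)"
proof -
  interpret group G using b by (rule pmp_actionD)
  interpret Y: prob_space Y using b by (rule pmp_actionD)
  have finI: "finite I" using I by (simp add: gset_def)
  have \<sigma>I: "\<sigma> g j \<in> I" if "g \<in> carrier G" "j \<in> I" for g j using I that by (simp add: gset_def)
  define Z where "Z j = {y\<in>space Y. \<psi> y = j}" for j
  have Z: "Z j \<in> sets Y" if "j \<in> I" for j
  proof -
    have "\<psi> -` {j} \<inter> space Y \<in> sets Y" using \<psi> that by (intro measurable_sets) auto
    also have "\<psi> -` {j} \<inter> space Y = Z j" by (auto simp: Z_def)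
    finally show ?thesis .
  qed
  have Zpos: "measure Y (Z j) > 0" if "j \<in> I" for j using pos[rule_format, OF that] by (simp add: Z_def)
  have Ze: "emeasure Y (Z j) \<noteq> 0" "emeasure Y (Z j) \<noteq> \<infinity>" if "j \<in> I" for j
    using Zpos[rule_format, OF that] by (auto simp: Y.emeasure_eq_measure)
  have bm: "b g \<in> measurable Y Y" if "g \<in> carrier G" for g using pmp_actionD(3)[OF b that] .
  \<comment> \<open>The fibres of \<open>\<psi>\<close> are permuted by the group only up to null
    sets, because \<open>\<psi>\<close> is equivariant almost everywhere. Passing to measures at
    this point gives exact statements from here on.\<close>
  have bZ: "emeasure Y (Z j \<inter> (b g -` A \<inter> space Y)) = emeasure Y (Z (\<sigma> g j) \<inter> A)"
    if g: "g \<in> carrier G" and j: "j \<in> I" and A: "A \<in> sets Y" for g j A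
  proof -
    have ZA: "Z (\<sigma> g j) \<inter> A \<in> sets Y" using Z[OF \<sigma>I[OF g j]] A by auto
    have "emeasure Y (Z (\<sigma> g j) \<inter> A) = emeasure (distr Y Y (b g)) (Z (\<sigma> g j) \<inter> A)"
      using pmp_actionD(4)[OF b g] by simp
    also have "\<dots> = emeasure Y (b g -` (Z (\<sigma> g j) \<inter> A) \<inter> space Y)"
      by (rule emeasure_distr[OF bm[OF g] ZA])
    also have "\<dots> = emeasure Y (Z j \<inter> (b g -` A \<inter> space Y))"
    proof (rule emeasure_eq_AE)
      show "b g -` (Z (\<sigma> g j) \<inter> A) \<inter> space Y \<in> sets Y" using bm[OF g] ZA by (rule measurable_sets)
      show "Z j \<inter> (b g -` A \<inter> space Y) \<in> sets Y"
        using Z[OF j] measurable_sets[OF bm[OF g] A] by auto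
      show "AE y in Y. (y \<in> b g -` (Z (\<sigma> g j) \<inter> A) \<inter> space Y) = (y \<in> Z j \<inter> (b g -` A \<inter> space Y))"
        using eq[rule_format, OF g] AE_space
      proof eventually_elim
        fix y assume y: "\<psi> (b g y) = \<sigma> g (\<psi> y)" "y \<in> space Y"
        have "\<psi> y \<in> I" using measurable_space[OF \<psi> y(2)] by simp
        then have "\<sigma> g (\<psi> y) = \<sigma> g j \<longleftrightarrow> \<psi> y = j"
          using gset_bij[OF is_group I g] j by (auto simp: bij_betw_def inj_on_def)
        then show "(y \<in> b g -` (Z (\<sigma> g j) \<inter> A) \<inter> space Y) = (y \<in> Z j \<inter> (b g -` A \<inter> space Y))"
          using y pmp_actionD(8)[OF b g y(2)] by (auto simp: Z_def)
      qed
    qed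
    finally show ?thesis by simp
  qed
  \<comment> \<open>The value outside \<open>I\<close> is a default: the product construction asks
    for a probability measure at every index of the type. Inside \<open>I\<close> the conditioning
    is legitimate because the fibres have positive measure.\<close>
  define \<nu> where "\<nu> j = (if j \<in> I then uniform_measure Y (Z j) else Y)" for j
  have prob: "prob_space (\<nu> j)" for j
    using prob_space_uniform_measure[OF Ze] Y.prob_space_axioms by (auto simp: \<nu>_def)
  have s\<nu>: "sets (\<nu> j) = sets Y" for j by (simp add: \<nu>_def)
  have sp\<nu>: "space (\<nu> j) = space Y" for j by (simp add: \<nu>_def)
  have dis: "distr (\<nu> j) Y (b g) = \<nu> (\<sigma> g j)" if g: "g \<in> carrier G" and j: "j \<in> I" for g j
  proof (rule measure_eqI)
    fix A assume "A \<in> sets (distr (\<nu> j) Y (b g))"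
    then have A: "A \<in> sets Y" by simp
    have m: "b g \<in> measurable (\<nu> j) Y" using bm[OF g] measurable_cong_sets[OF s\<nu> refl] by blast
    have e: "emeasure Y (Z j) = emeasure Y (Z (\<sigma> g j))"
    proof -
      have "b g -` space Y \<inter> space Y = space Y" using pmp_actionD(8)[OF b g] by auto
      moreover have "Z i \<inter> space Y = Z i" for i by (auto simp: Z_def)
      ultimately show ?thesis using bZ[OF g j sets.top] by simp
    qed
    have "emeasure (distr (\<nu> j) Y (b g)) A = emeasure (\<nu> j) (b g -` A \<inter> space Y)"
      using emeasure_distr[OF m A] by (simp add: sp\<nu>)
    also have "\<dots> = emeasure Y (Z j \<inter> (b g -` A \<inter> space Y)) / emeasure Y (Z j)"
      using j Z[OF j] measurable_sets[OF bm[OF g] A] by (simp add: \<nu>_def)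
    also have "\<dots> = emeasure Y (Z (\<sigma> g j) \<inter> A) / emeasure Y (Z (\<sigma> g j))"
      using bZ[OF g j A] e by simp
    also have "\<dots> = emeasure (\<nu> (\<sigma> g j)) A"
      using \<sigma>I[OF g j] Z[OF \<sigma>I[OF g j]] A by (simp add: \<nu>_def)
    finally show "emeasure (distr (\<nu> j) Y (b g)) A = emeasure (\<nu> (\<sigma> g j)) A" .
  qed (simp add: s\<nu>)
  define W where "W = PiM I \<nu>"
  define a where "a g = (\<lambda>x\<in>space W. \<lambda>j\<in>I. b g (x (\<sigma> (inv\<^bsub>G\<^esub> g) j)))" for g
  have a: "pmp_action G W a"
    unfolding W_def a_def[abs_def]
    by (rule pmp_action_PiM[where N = Y and b = b and \<sigma> = \<sigma> and \<nu> = \<nu>, OF is_group I prob s\<nu> bm pmp_actionD(6)[OF b] pmp_actionD(7)[OF b] dis])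
  have spW: "space W = I \<rightarrow>\<^sub>E space Y" by (simp add: W_def space_PiM sp\<nu>)
  define F where "F x = (\<lambda>j\<in>I. \<alpha> (x j))" for x :: "'i \<Rightarrow> 'y"
  have \<alpha>j: "(\<lambda>x. \<alpha> (x j)) \<in> measurable W (count_space {..<p})" if "j \<in> I" for j
  proof -
    have "\<alpha> \<in> measurable (\<nu> j) (count_space {..<p})" using \<alpha> measurable_cong_sets[OF s\<nu> refl] by blast
    moreover have "(\<lambda>x. x j) \<in> measurable W (\<nu> j)"
      unfolding W_def using that by (rule measurable_component_singleton)
    ultimately show ?thesis by (rule measurable_compose[rotated])
  qed
  have finV: "finite (I \<rightarrow>\<^sub>E {..<p})" using finI by (intro finite_PiE) auto
  have F: "F \<in> measurable W (count_space (I \<rightarrow>\<^sub>E {..<p}))"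
  proof (subst measurable_count_space_eq2[OF finV], intro conjI ballI)
    show "F \<in> space W \<rightarrow> I \<rightarrow>\<^sub>E {..<p}" using measurable_space[OF \<alpha>] by (auto simp: F_def spW PiE_iff)
    fix \<pi> assume "\<pi> \<in> I \<rightarrow>\<^sub>E {..<p}"
    have "{x\<in>space W. (\<lambda>j\<in>I. \<alpha> (x j)) = \<pi>} \<in> sets W"
      by (rule pattern_sets[OF finI, where R = "\<lambda>q. q = \<pi>"]) (use \<alpha>j in auto)
    also have "{x\<in>space W. (\<lambda>j\<in>I. \<alpha> (x j)) = \<pi>} = F -` {\<pi>} \<inter> space W" by (auto simp: F_def)
    finally show "F -` {\<pi>} \<inter> space W \<in> sets W" .
  qed
  obtain D :: "real set set" and c w f' where D: "gset G D c" "weights G D c w"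
    and f': "\<forall>d. f' d \<in> I \<rightarrow>\<^sub>E {..<p}"
    and *: "\<forall>R. \<bar>measure W {x\<in>space W. R (\<lambda>s\<in>S. F (a (inv\<^bsub>G\<^esub> s) x))} -
      (\<Sum>d | d \<in> D \<and> R (\<lambda>s\<in>S. f' (c (inv\<^bsub>G\<^esub> s) d)). w d)\<bar> < \<epsilon>"
    using finite_model_MD[OF MD a cG F finV S e] by (elim exE conjE) (rule that)
  have main: "\<bar>measure Y {y\<in>space Y. \<psi> y = j \<and> R (\<lambda>s\<in>S. \<alpha> (b (inv\<^bsub>G\<^esub> s) y))} -
      measure Y {y\<in>space Y. \<psi> y = j} *
        (\<Sum>d | d \<in> D \<and> R (\<lambda>s\<in>S. f' (c (inv\<^bsub>G\<^esub> s) d) (\<sigma> (inv\<^bsub>G\<^esub> s) j)). w d)\<bar> < \<epsilon>"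
    if j: "j \<in> I" for j R
  proof -
    \<comment> \<open>A test on the patterns of the whole tuple that inspects one coordinate per
      group element, namely the one to which \<open>inv s\<close> has carried the point starting in
      coordinate \<open>j\<close>.\<close>
    define R' where "R' q \<longleftrightarrow> R (\<lambda>s\<in>S. q s (\<sigma> (inv\<^bsub>G\<^esub> s) j))" for q :: "'a \<Rightarrow> 'i \<Rightarrow> nat"
    define E where "E = {y\<in>space Y. R (\<lambda>s\<in>S. \<alpha> (b (inv\<^bsub>G\<^esub> s) y))}"
    have "(\<lambda>y. \<alpha> (b (inv\<^bsub>G\<^esub> s) y)) \<in> measurable Y (count_space {..<p})" if "s \<in> S" for s
      using that S by (intro measurable_compose[OF bm \<alpha>]) auto
    then have E: "E \<in> sets Y" unfolding E_def by (intro pattern_sets[OF S(1)]) auto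
    have 1: "R' (\<lambda>s\<in>S. F (a (inv\<^bsub>G\<^esub> s) x)) \<longleftrightarrow> x j \<in> E" if x: "x \<in> space W" for x
    proof -
      have "(\<lambda>s\<in>S. (\<lambda>s\<in>S. F (a (inv\<^bsub>G\<^esub> s) x)) s (\<sigma> (inv\<^bsub>G\<^esub> s) j)) = (\<lambda>s\<in>S. \<alpha> (b (inv\<^bsub>G\<^esub> s) (x j)))"
      proof (rule restrict_ext)
        fix s assume s: "s \<in> S"
        then have sG: "s \<in> carrier G" using S by auto
        have "\<sigma> (inv\<^bsub>G\<^esub> s) j \<in> I" "\<sigma> s (\<sigma> (inv\<^bsub>G\<^esub> s) j) = j"
          using \<sigma>I sG j gset_inv(2)[OF is_group I sG j] by auto
        then show "(\<lambda>s\<in>S. F (a (inv\<^bsub>G\<^esub> s) x)) s (\<sigma> (inv\<^bsub>G\<^esub> s) j) = \<alpha> (b (inv\<^bsub>G\<^esub> s) (x j))"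
          using s sG x by (simp add: F_def a_def)
      qed
      moreover have "x j \<in> space Y" using x j by (auto simp: spW PiE_iff)
      ultimately show ?thesis by (simp only: R'_def E_def mem_Collect_eq simp_thms)
    qed
    have 2: "R' (\<lambda>s\<in>S. f' (c (inv\<^bsub>G\<^esub> s) d)) \<longleftrightarrow>
      R (\<lambda>s\<in>S. f' (c (inv\<^bsub>G\<^esub> s) d) (\<sigma> (inv\<^bsub>G\<^esub> s) j))" for d
    proof -
      have "(\<lambda>s\<in>S. (\<lambda>s\<in>S. f' (c (inv\<^bsub>G\<^esub> s) d)) s (\<sigma> (inv\<^bsub>G\<^esub> s) j)) =
        (\<lambda>s\<in>S. f' (c (inv\<^bsub>G\<^esub> s) d) (\<sigma> (inv\<^bsub>G\<^esub> s) j))"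
        by (rule restrict_ext) simp
      then show ?thesis by (simp only: R'_def)
    qed
    have "{x\<in>space W. R' (\<lambda>s\<in>S. F (a (inv\<^bsub>G\<^esub> s) x))} = (\<lambda>x. x j) -` E \<inter> space W"
      using 1 by blast
    moreover have "measure W ((\<lambda>x. x j) -` E \<inter> space W) = measure (distr W (\<nu> j) (\<lambda>x. x j)) E"
      unfolding W_def by (rule measure_distr[symmetric]) (use j E s\<nu> in auto)
    moreover have "distr W (\<nu> j) (\<lambda>x. x j) = \<nu> j"
      unfolding W_def by (rule distr_PiM_component[OF prob j])
    moreover have "measure (\<nu> j) E = measure Y (Z j \<inter> E) / measure Y (Z j)"
      using j Ze[OF j] E by (simp add: \<nu>_def)
    ultimately have WE: "measure W {x\<in>space W. R' (\<lambda>s\<in>S. F (a (inv\<^bsub>G\<^esub> s) x))} =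
      measure Y (Z j \<inter> E) / measure Y (Z j)" by (simp only:)
    define T where "T = (\<Sum>d | d \<in> D \<and> R (\<lambda>s\<in>S. f' (c (inv\<^bsub>G\<^esub> s) d) (\<sigma> (inv\<^bsub>G\<^esub> s) j)). w d)"
    have le: "\<bar>measure Y (Z j \<inter> E) / measure Y (Z j) - T\<bar> < \<epsilon>"
      using *[rule_format, of R'] unfolding WE 2 T_def .
    \<comment> \<open>The model bounds the error of the conditional probability. Multiplying by the
      measure of the fibre, which is at most 1, turns this into the bound for the joint
      probability.\<close>
    have "\<bar>measure Y (Z j \<inter> E) - measure Y (Z j) * T\<bar> =
      measure Y (Z j) * \<bar>measure Y (Z j \<inter> E) / measure Y (Z j) - T\<bar>"
      using Zpos[OF j] by (simp add: abs_mult_pos' right_diff_distrib)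
    also have "\<dots> < measure Y (Z j) * \<epsilon>" using le Zpos[OF j] by (intro mult_strict_left_mono)
    also have "\<dots> \<le> 1 * \<epsilon>" using e by (intro mult_right_mono) auto
    finally have "\<bar>measure Y (Z j \<inter> E) - measure Y (Z j) * T\<bar> < \<epsilon>" by simp
    moreover have "Z j \<inter> E = {y\<in>space Y. \<psi> y = j \<and> R (\<lambda>s\<in>S. \<alpha> (b (inv\<^bsub>G\<^esub> s) y))}"
      by (auto simp: Z_def E_def)
    ultimately show ?thesis by (simp only: T_def Z_def)
  qed
  have "\<forall>d. \<forall>j\<in>I. f' d j < p" using f' by (auto simp: PiE_iff)
  then show ?thesis using D main
    by (intro exI[of _ D] exI[of _ c] exI[of _ w] exI[of _ f'] conjI ballI allI) auto
qed

section \<open>A criterion for existential closedness\<close>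

text \<open>Conditioning on a finite-valued map \<open>t\<close>: on each fibre the first argument
  of \<open>R\<close> is a constant, so measurability has to be known only for fixed
  \<open>j\<close>. Applied twice it handles every event determined by two finite-valued
  maps.\<close>

lemma measure_split:
  assumes M: "finite_measure M" and t: "t \<in> measurable M (count_space J)" and J: "finite J"
    and R: "\<And>j. j \<in> J \<Longrightarrow> {x\<in>space M. R j x} \<in> sets M"
  shows "measure M {x\<in>space M. R (t x) x} = (\<Sum>j\<in>J. measure M {x\<in>space M. t x = j \<and> R j x})"
    and "{x\<in>space M. R (t x) x} \<in> sets M"
proof -
  interpret finite_measure M by fact
  have tJ: "t x \<in> J" if "x \<in> space M" for x using measurable_space[OF t that] by simp
  have eq: "{x\<in>space M. R (t x) x} = (\<Union>j\<in>J. {x\<in>space M. t x = j \<and> R j x})" using tJ by auto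
  have s: "{x\<in>space M. t x = j \<and> R j x} \<in> sets M" if "j \<in> J" for j
  proof -
    have "t -` {j} \<inter> space M \<in> sets M" using t that by (intro measurable_sets) auto
    then have "(t -` {j} \<inter> space M) \<inter> {x\<in>space M. R j x} \<in> sets M" using R[OF that] by (rule sets.Int)
    also have "(t -` {j} \<inter> space M) \<inter> {x\<in>space M. R j x} = {x\<in>space M. t x = j \<and> R j x}" by auto
    finally show ?thesis .
  qed
  show "{x\<in>space M. R (t x) x} \<in> sets M" unfolding eq using J s by (rule sets.finite_UN)
  show "measure M {x\<in>space M. R (t x) x} = (\<Sum>j\<in>J. measure M {x\<in>space M. t x = j \<and> R j x})"
    unfolding eq using J s by (intro finite_measure_finite_Union) (auto simp: disjoint_family_on_def)
qed

lemma sum_abs_le: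
  fixes f h :: "'i \<Rightarrow> real"
  assumes "finite I" "\<And>i. i \<in> I \<Longrightarrow> \<bar>f i - h i\<bar> \<le> e" "real (card I) * e \<le> e'"
  shows "\<bar>sum f I - sum h I\<bar> \<le> e'"
proof -
  have "\<bar>sum f I - sum h I\<bar> \<le> (\<Sum>i\<in>I. \<bar>f i - h i\<bar>)" by (simp add: sum_subtractf[symmetric] sum_abs)
  also have "\<dots> \<le> (\<Sum>i\<in>I. e)" using assms(2) by (rule sum_mono)
  finally show ?thesis using assms(3) by simp
qed

text \<open>A triple in \<open>L\<close> is a finite equivariant quotient of \<open>X\<close>: a
  map, its values, and the action on them. Pulling the quotient back to \<open>Y\<close> and
  modelling \<open>Y\<close> over it leaves a finite set \<open>D\<close> with a colouring
  \<open>f'\<close> of the pairs from \<open>D\<close> and \<open>I\<close>. The map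
  \<open>\<eta>\<close> together with \<open>l\<close> sends \<open>X\<close> to these pairs with
  nearly the product law and nearly equivariantly, so the pulled-back colouring has nearly the
  required statistics.\<close>

theorem existentially_closed_criterion:
  fixes X :: "'x measure" and L :: "(('x \<Rightarrow> 'd) \<times> 'd set \<times> ('g \<Rightarrow> 'd \<Rightarrow> 'd)) set"
  assumes MD: "property_MD G" and cG: "countable (carrier G)" and a: "pmp_action G X a"
    and lev: "\<And>l I \<sigma>. (l, I, \<sigma>) \<in> L \<Longrightarrow> gset G I \<sigma> \<and> l \<in> measurable X (count_space I) \<and>
      (\<forall>g\<in>carrier G. \<forall>x\<in>space X. l (a g x) = \<sigma> g (l x)) \<and>
      (\<forall>j\<in>I. 0 < measure X {x\<in>space X. l x = j})"
    and approx: "\<And>q \<beta> \<epsilon>. \<beta> \<in> measurable X (count_space {..<q::nat}) \<Longrightarrow> (0::real) < \<epsilon> \<Longrightarrow>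
      \<exists>l I \<sigma> v. (l, I, \<sigma>) \<in> L \<and> measure X {x\<in>space X. \<beta> x \<noteq> v (l x)} < \<epsilon>"
    and rand: "\<And>l I \<sigma> D c w S \<epsilon>. (l, I, \<sigma>) \<in> L \<Longrightarrow> gset G (D :: real set set) c \<Longrightarrow> weights G D c w \<Longrightarrow>
      finite S \<Longrightarrow> S \<subseteq> carrier G \<Longrightarrow> 0 < \<epsilon> \<Longrightarrow>
      \<exists>\<eta>\<in>measurable X (count_space D).
        measure X {x\<in>space X. \<exists>s\<in>S. \<eta> (a (inv\<^bsub>G\<^esub> s) x) \<noteq> c (inv\<^bsub>G\<^esub> s) (\<eta> x)} < \<epsilon> \<and>
        (\<forall>j\<in>I. \<forall>d\<in>D. \<bar>measure X {x\<in>space X. l x = j \<and> \<eta> x = d} -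
          measure X {x\<in>space X. l x = j} * w d\<bar> < \<epsilon>)"
  shows "existentially_closed TYPE('y) G X a"
  unfolding existentially_closed_def
proof (intro conjI allI impI a)
  fix Y :: "'y measure" and b \<phi>
  assume fac: "factor_map G Y b X a \<phi>"
  then have b: "pmp_action G Y b" and \<phi>: "\<phi> \<in> measurable Y X" and d\<phi>: "distr Y X \<phi> = X"
    and eq\<phi>: "\<And>g. g \<in> carrier G \<Longrightarrow> AE y in Y. \<phi> (b g y) = a g (\<phi> y)"
    by (auto simp: factor_map_def)
  interpret group G using b by (rule pmp_actionD)
  interpret Y: prob_space Y using b by (rule pmp_actionD)
  interpret X: prob_space X using a by (rule pmp_actionD)
  have m\<phi>: "measure Y {y\<in>space Y. P (\<phi> y)} = measure X {x\<in>space X. P x}"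
    if "{x\<in>space X. P x} \<in> sets X" for P
  proof -
    have "measure X {x\<in>space X. P x} = measure Y (\<phi> -` {x\<in>space X. P x} \<inter> space Y)"
      using measure_distr[OF \<phi> that] d\<phi> by simp
    also have "\<phi> -` {x\<in>space X. P x} \<inter> space Y = {y\<in>space Y. P (\<phi> y)}"
      using measurable_space[OF \<phi>] by auto
    finally show ?thesis by simp
  qed
  show "existentially_closed_map G Y b X a \<phi>"
    unfolding existentially_closed_map_def
  proof (intro allI ballI impI)
    fix p q :: nat and \<alpha> \<beta> S and \<epsilon> :: real
    assume \<alpha>: "\<alpha> \<in> measurable Y (count_space {..<p})" and \<beta>: "\<beta> \<in> measurable X (count_space {..<q})"
      and S: "finite S" "S \<subseteq> carrier G" and e: "0 < \<epsilon>"
    from e have "0 < \<epsilon> / 4" by simp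
    from approx[OF \<beta> this] obtain l I \<sigma> v where l: "(l, I, \<sigma>) \<in> L"
      and v: "measure X {x\<in>space X. \<beta> x \<noteq> v (l x)} < \<epsilon> / 4" by (elim exE conjE)
    have I: "gset G I \<sigma>" and lm: "l \<in> measurable X (count_space I)"
      and leq: "\<And>g x. g \<in> carrier G \<Longrightarrow> x \<in> space X \<Longrightarrow> l (a g x) = \<sigma> g (l x)"
      and lpos: "\<And>j. j \<in> I \<Longrightarrow> 0 < measure X {x\<in>space X. l x = j}"
      using lev[OF l] by auto
    have finI: "finite I" using I by (simp add: gset_def)
    have lI: "l x \<in> I" if "x \<in> space X" for x using measurable_space[OF lm that] by simp
    have ls: "{x\<in>space X. l x = i} \<in> sets X" for i
      using measure_split(2)[OF X.finite_measure_axioms lm finI, of "\<lambda>j _. j = i"] by simp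
    define \<psi> where "\<psi> y = l (\<phi> y)" for y
    have \<psi>: "\<psi> \<in> measurable Y (count_space I)"
      unfolding \<psi>_def[abs_def] by (rule measurable_compose[OF \<phi> lm])
    have eq: "\<forall>g\<in>carrier G. AE y in Y. \<psi> (b g y) = \<sigma> g (\<psi> y)"
    proof
      fix g assume g: "g \<in> carrier G"
      show "AE y in Y. \<psi> (b g y) = \<sigma> g (\<psi> y)"
        using eq\<phi>[OF g] AE_space
      proof eventually_elim
        fix y assume "\<phi> (b g y) = a g (\<phi> y)" "y \<in> space Y"
        then show "\<psi> (b g y) = \<sigma> g (\<psi> y)" using leq[OF g] measurable_space[OF \<phi>] by (simp add: \<psi>_def)
      qed
    qed
    define m where "m i = measure X {x\<in>space X. l x = i}" for i
    have m\<psi>: "measure Y {y\<in>space Y. \<psi> y = i} = m i" for i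
      unfolding \<psi>_def m_def by (rule m\<phi>[OF ls])
    have pos: "\<forall>j\<in>I. 0 < measure Y {y\<in>space Y. \<psi> y = j}"
      using lpos by (simp add: m\<psi> m_def)
    \<comment> \<open>One error \<open>e1\<close> for each \<open>i \<in> I\<close> has to add up to
      at most a quarter of \<open>\<epsilon>\<close>; the additional 1 keeps the denominator
      positive.\<close>
    define e1 where "e1 = \<epsilon> / (4 * (real (card I) + 1))"
    have e1: "0 < e1" using e by (simp add: e1_def add_nonneg_pos)
    have e1': "real (card I) * e1 \<le> \<epsilon> / 4"
      using e by (simp add: e1_def field_simps)
    obtain D :: "real set set" and c w f' where D: "gset G D c" and w: "weights G D c w"
      and f': "\<forall>d. \<forall>j\<in>I. f' d j < p"
      and model: "\<forall>j\<in>I. \<forall>R. \<bar>measure Y {y\<in>space Y. \<psi> y = j \<and> R (\<lambda>s\<in>S. \<alpha> (b (inv\<^bsub>G\<^esub> s) y))} -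
        measure Y {y\<in>space Y. \<psi> y = j} *
          (\<Sum>d | d \<in> D \<and> R (\<lambda>s\<in>S. f' (c (inv\<^bsub>G\<^esub> s) d) (\<sigma> (inv\<^bsub>G\<^esub> s) j)). w d)\<bar> < e1"
      using relative_model[OF MD b cG I \<psi> eq pos \<alpha> S e1] by (elim exE conjE) (rule that)
    have finD: "finite D" using D by (simp add: gset_def)
    \<comment> \<open>The same tolerance is used in two ways: once as the measure of the set where
      \<open>\<eta>\<close> is not equivariant, and once for every pair from \<open>I\<close> and
      \<open>D\<close>. The denominator makes each of these contributions at most an eighth of
      \<open>\<epsilon>\<close>.\<close>
    define e2 where "e2 = \<epsilon> / (8 * (real (card I) * real (card D) + 1))"
    have e2: "0 < e2" using e by (simp add: e2_def add_nonneg_pos)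
    have k2: "(real (card I) * real (card D) + 1) * e2 = \<epsilon> / 8"
    proof -
      have "k * (\<epsilon> / (8 * k)) = \<epsilon> / 8" if "k > 0" for k :: real using that by (simp add: field_simps)
      from this[of "real (card I) * real (card D) + 1"] show ?thesis
        unfolding e2_def by (simp add: add_nonneg_pos)
    qed
    have "real (card I) * (real (card D) * e2) \<le> (real (card I) * real (card D) + 1) * e2"
      using e2 by (simp add: distrib_right)
    then have e2': "real (card I) * (real (card D) * e2) \<le> \<epsilon> / 8" unfolding k2 .
    have "1 * e2 \<le> (real (card I) * real (card D) + 1) * e2"
      using e2 by (intro mult_right_mono) auto
    then have e2'': "e2 \<le> \<epsilon> / 8" unfolding k2 by simp
    obtain \<eta> where \<eta>: "\<eta> \<in> measurable X (count_space D)"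
      and bad: "measure X {x\<in>space X. \<exists>s\<in>S. \<eta> (a (inv\<^bsub>G\<^esub> s) x) \<noteq> c (inv\<^bsub>G\<^esub> s) (\<eta> x)} < e2"
      and ind: "\<forall>j\<in>I. \<forall>d\<in>D. \<bar>measure X {x\<in>space X. l x = j \<and> \<eta> x = d} -
          measure X {x\<in>space X. l x = j} * w d\<bar> < e2"
      using rand[OF l D w S e2] by (elim bexE conjE) (rule that)
    have \<eta>D: "\<eta> x \<in> D" if "x \<in> space X" for x using measurable_space[OF \<eta> that] by simp
    \<comment> \<open>The witness: the colouring of the finite model, read along the map from
      \<open>X\<close> to the pairs from \<open>D\<close> and \<open>I\<close>.\<close>
    define \<alpha>' where "\<alpha>' x = f' (\<eta> x) (l x)" for x
    have finX: "finite_measure X" by (rule X.finite_measure_axioms)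
    have joint: "{x\<in>space X. P (\<eta> x) (l x)} \<in> sets X" for P
      by (rule measure_split(2)[OF finX \<eta> finD], rule measure_split(2)[OF finX lm finI]) simp
    have \<alpha>'m: "\<alpha>' \<in> measurable X (count_space {..<p})"
    proof (subst measurable_count_space_eq2, simp, intro conjI ballI)
      show "\<alpha>' \<in> space X \<rightarrow> {..<p}" using f' lI by (auto simp: \<alpha>'_def)
      fix i
      have "\<alpha>' -` {i} \<inter> space X = {x\<in>space X. f' (\<eta> x) (l x) = i}" by (auto simp: \<alpha>'_def)
      then show "\<alpha>' -` {i} \<inter> space X \<in> sets X" using joint[of "\<lambda>d j. f' d j = i"] by simp
    qed
    show "\<exists>\<alpha>'\<in>measurable X (count_space {..<p}). \<forall>\<pi>\<in>S \<rightarrow>\<^sub>E {..<p}. \<forall>j<q.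
      \<bar>measure Y {y \<in> space Y. shift_map G b \<alpha> S y = \<pi> \<and> \<beta> (\<phi> y) = j}
              - measure X {x \<in> space X. shift_map G a \<alpha>' S x = \<pi> \<and> \<beta> x = j}\<bar> < \<epsilon>"
    proof (intro bexI[OF _ \<alpha>'m] ballI allI impI)
      fix \<pi> j assume \<pi>: "\<pi> \<in> S \<rightarrow>\<^sub>E {..<p}" and j: "j < q"
      have shY: "{y\<in>space Y. shift_map G b \<alpha> S y = \<pi>} \<in> sets Y"
      proof -
        have "(\<lambda>y. \<alpha> (b (inv\<^bsub>G\<^esub> s) y)) \<in> measurable Y (count_space {..<p})" if "s \<in> S" for s
          using that S by (intro measurable_compose[OF pmp_actionD(3)[OF b] \<alpha>]) auto
        then show ?thesis unfolding shift_map_def by (intro pattern_sets[OF S(1)]) auto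
      qed
      have shX: "{x\<in>space X. shift_map G a \<alpha>' S x = \<pi>} \<in> sets X"
      proof -
        have "(\<lambda>x. \<alpha>' (a (inv\<^bsub>G\<^esub> s) x)) \<in> measurable X (count_space {..<p})" if "s \<in> S" for s
          using that S by (intro measurable_compose[OF pmp_actionD(3)[OF a] \<alpha>'m]) auto
        then show ?thesis unfolding shift_map_def by (intro pattern_sets[OF S(1)]) auto
      qed
      have B0: "{x\<in>space X. P (\<beta> x) (l x)} \<in> sets X" for P
        by (rule measure_split(2)[OF finX \<beta> finite_lessThan], rule measure_split(2)[OF finX lm finI]) simp
      have conjY: "{y\<in>space Y. shift_map G b \<alpha> S y = \<pi> \<and> P (\<phi> y)} \<in> sets Y"
        if "{x\<in>space X. P x} \<in> sets X" for P
      proof -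
        have "\<phi> -` {x\<in>space X. P x} \<inter> space Y \<in> sets Y" using \<phi> that by (rule measurable_sets)
        then have "{y\<in>space Y. shift_map G b \<alpha> S y = \<pi>} \<inter> (\<phi> -` {x\<in>space X. P x} \<inter> space Y) \<in> sets Y"
          by (rule sets.Int[OF shY])
        also have "{y\<in>space Y. shift_map G b \<alpha> S y = \<pi>} \<inter> (\<phi> -` {x\<in>space X. P x} \<inter> space Y) =
          {y\<in>space Y. shift_map G b \<alpha> S y = \<pi> \<and> P (\<phi> y)}" using measurable_space[OF \<phi>] by auto
        finally show ?thesis .
      qed
      have conjX: "{x\<in>space X. shift_map G a \<alpha>' S x = \<pi> \<and> P x} \<in> sets X"
        if "{x\<in>space X. P x} \<in> sets X" for P
      proof -
        have "{x\<in>space X. shift_map G a \<alpha>' S x = \<pi>} \<inter> {x\<in>space X. P x} \<in> sets X"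
          using shX that by (rule sets.Int)
        also have "{x\<in>space X. shift_map G a \<alpha>' S x = \<pi>} \<inter> {x\<in>space X. P x} =
          {x\<in>space X. shift_map G a \<alpha>' S x = \<pi> \<and> P x}" by auto
        finally show ?thesis .
      qed
      have \<beta>j: "{x\<in>space X. \<beta> x = j} \<in> sets X" using B0[of "\<lambda>b _. b = j"] .
      have vj: "{x\<in>space X. v (l x) = j} \<in> sets X" using B0[of "\<lambda>_ i. v i = j"] .
      have ne: "{x\<in>space X. \<beta> x \<noteq> v (l x)} \<in> sets X" using B0[of "\<lambda>b i. b \<noteq> v i"] .
      \<comment> \<open>The event in question as it appears at the point \<open>(d, i)\<close> of
        the finite model. Its weighted total, the sum of \<open>m i * T i\<close>, is the number
        through which \<open>Y\<close> and \<open>X\<close> are compared.\<close>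
      define \<kappa> where "\<kappa> i d \<longleftrightarrow> v i = j \<and> (\<lambda>s\<in>S. f' (c (inv\<^bsub>G\<^esub> s) d) (\<sigma> (inv\<^bsub>G\<^esub> s) i)) = \<pi>" for i d
      define T where "T i = (\<Sum>d\<in>D. if \<kappa> i d then w d else 0)" for i
      let ?Y1 = "measure Y {y \<in> space Y. shift_map G b \<alpha> S y = \<pi> \<and> \<beta> (\<phi> y) = j}"
      let ?Y2 = "measure Y {y \<in> space Y. shift_map G b \<alpha> S y = \<pi> \<and> v (l (\<phi> y)) = j}"
      let ?X1 = "measure X {x \<in> space X. shift_map G a \<alpha>' S x = \<pi> \<and> \<beta> x = j}"
      let ?X2 = "measure X {x \<in> space X. shift_map G a \<alpha>' S x = \<pi> \<and> v (l x) = j}"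
      let ?X3 = "measure X {x \<in> space X. \<kappa> (l x) (\<eta> x)}"
      have s1: "\<bar>?Y1 - ?Y2\<bar> < \<epsilon> / 4"
      proof -
        have neY: "{y\<in>space Y. \<beta> (\<phi> y) \<noteq> v (l (\<phi> y))} \<in> sets Y"
        proof -
          have "\<phi> -` {x\<in>space X. \<beta> x \<noteq> v (l x)} \<inter> space Y \<in> sets Y" using \<phi> ne by (rule measurable_sets)
          also have "\<phi> -` {x\<in>space X. \<beta> x \<noteq> v (l x)} \<inter> space Y = {y\<in>space Y. \<beta> (\<phi> y) \<noteq> v (l (\<phi> y))}"
            using measurable_space[OF \<phi>] by auto
          finally show ?thesis .
        qed
        have "\<bar>?Y1 - ?Y2\<bar> \<le> measure Y {y\<in>space Y. \<beta> (\<phi> y) \<noteq> v (l (\<phi> y))}"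
          by (rule Y.measure_neq_le[OF conjY[OF \<beta>j] conjY[OF vj] neY]) auto
        also have "\<dots> = measure X {x\<in>space X. \<beta> x \<noteq> v (l x)}" by (rule m\<phi>[OF ne])
        finally show ?thesis using v by simp
      qed
      have s2: "\<bar>?Y2 - (\<Sum>i\<in>I. m i * T i)\<bar> \<le> \<epsilon> / 4"
      proof -
        have "{y\<in>space Y. v i = j \<and> shift_map G b \<alpha> S y = \<pi>} \<in> sets Y" for i
          using shY by (cases "v i = j") simp_all
        then have "measure Y {y\<in>space Y. v (\<psi> y) = j \<and> shift_map G b \<alpha> S y = \<pi>} =
          (\<Sum>i\<in>I. measure Y {y\<in>space Y. \<psi> y = i \<and> v i = j \<and> shift_map G b \<alpha> S y = \<pi>})"
          by (rule measure_split(1)[OF Y.finite_measure_axioms \<psi> finI, of "\<lambda>i y. v i = j \<and> shift_map G b \<alpha> S y = \<pi>"])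
        moreover have "{y\<in>space Y. v (\<psi> y) = j \<and> shift_map G b \<alpha> S y = \<pi>} =
          {y\<in>space Y. shift_map G b \<alpha> S y = \<pi> \<and> v (l (\<phi> y)) = j}" by (auto simp: \<psi>_def)
        ultimately have "?Y2 = (\<Sum>i\<in>I. measure Y {y\<in>space Y. \<psi> y = i \<and> v i = j \<and> shift_map G b \<alpha> S y = \<pi>})"
          by simp
        moreover have "\<bar>measure Y {y\<in>space Y. \<psi> y = i \<and> v i = j \<and> shift_map G b \<alpha> S y = \<pi>} - m i * T i\<bar> \<le> e1"
          if i: "i \<in> I" for i
        proof -
          have "T i = (\<Sum>d | d \<in> D \<and> \<kappa> i d. w d)"
            unfolding T_def using finD by (simp add: sum.inter_filter)
          then show ?thesis
            using model[rule_format, OF i, of "\<lambda>r. v i = j \<and> r = \<pi>"]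
            unfolding m\<psi> \<kappa>_def shift_map_def by (simp only: less_imp_le)
        qed
        ultimately show ?thesis using sum_abs_le[OF finI _ e1'] by simp
      qed
      have s3: "\<bar>?X2 - ?X3\<bar> \<le> e2"
      proof -
        have badm: "{x\<in>space X. \<exists>s\<in>S. \<eta> (a (inv\<^bsub>G\<^esub> s) x) \<noteq> c (inv\<^bsub>G\<^esub> s) (\<eta> x)} \<in> sets X"
        proof -
          have "{x\<in>space X. \<eta> (a (inv\<^bsub>G\<^esub> s) x) \<noteq> c (inv\<^bsub>G\<^esub> s) (\<eta> x)} \<in> sets X" if "s \<in> S" for s
          proof -
            have h: "(\<lambda>x. \<eta> (a (inv\<^bsub>G\<^esub> s) x)) \<in> measurable X (count_space D)"
              using that S by (intro measurable_compose[OF pmp_actionD(3)[OF a] \<eta>]) auto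
            have "{x\<in>space X. d \<noteq> c (inv\<^bsub>G\<^esub> s) (\<eta> x)} \<in> sets X" for d
              using joint[of "\<lambda>e _. d \<noteq> c (inv\<^bsub>G\<^esub> s) e"] .
            then show ?thesis
              by (rule measure_split(2)[OF finX h finD, of "\<lambda>d x. d \<noteq> c (inv\<^bsub>G\<^esub> s) (\<eta> x)"])
          qed
          then show ?thesis using S(1) by (intro sets.sets_Collect_finite_Ex)
        qed
        have "\<bar>?X2 - ?X3\<bar> \<le> measure X {x\<in>space X. \<exists>s\<in>S. \<eta> (a (inv\<^bsub>G\<^esub> s) x) \<noteq> c (inv\<^bsub>G\<^esub> s) (\<eta> x)}"
        proof (rule X.measure_neq_le[OF conjX[OF vj] joint[of "\<lambda>d i. \<kappa> i d"] badm])
          fix x assume x: "x \<in> space X" and neq: "(shift_map G a \<alpha>' S x = \<pi> \<and> v (l x) = j) \<noteq> \<kappa> (l x) (\<eta> x)"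
          show "x \<in> {x\<in>space X. \<exists>s\<in>S. \<eta> (a (inv\<^bsub>G\<^esub> s) x) \<noteq> c (inv\<^bsub>G\<^esub> s) (\<eta> x)}"
          proof (rule ccontr)
            assume "\<not> ?thesis"
            then have good: "\<eta> (a (inv\<^bsub>G\<^esub> s) x) = c (inv\<^bsub>G\<^esub> s) (\<eta> x)" if "s \<in> S" for s using x that by auto
            \<comment> \<open>The map \<open>l\<close> commutes with the action everywhere and
              \<open>\<eta>\<close> does so at a good point, so the whole window of
              \<open>\<alpha>'\<close> is determined by the values of \<open>\<eta>\<close> and
              \<open>l\<close> at the point itself.\<close>
            have "shift_map G a \<alpha>' S x = (\<lambda>s\<in>S. f' (c (inv\<^bsub>G\<^esub> s) (\<eta> x)) (\<sigma> (inv\<^bsub>G\<^esub> s) (l x)))"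
              unfolding shift_map_def
              by (rule restrict_ext) (use S x good in \<open>auto simp: \<alpha>'_def leq\<close>)
            then show False using neq by (auto simp: \<kappa>_def)
          qed
        qed
        then show ?thesis using bad by simp
      qed
      have s4: "\<bar>?X3 - (\<Sum>i\<in>I. m i * T i)\<bar> \<le> \<epsilon> / 8"
      proof -
        have "?X3 = (\<Sum>i\<in>I. measure X {x\<in>space X. l x = i \<and> \<kappa> i (\<eta> x)})"
          by (rule measure_split(1)[OF finX lm finI, of "\<lambda>i x. \<kappa> i (\<eta> x)"])
            (use joint[of "\<lambda>d _. \<kappa> _ d"] in simp)
        moreover have "measure X {x\<in>space X. l x = i \<and> \<kappa> i (\<eta> x)} =
          (\<Sum>d\<in>D. if \<kappa> i d then measure X {x\<in>space X. l x = i \<and> \<eta> x = d} else 0)" for i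
        proof -
          have "measure X {x\<in>space X. l x = i \<and> \<kappa> i (\<eta> x)} =
            (\<Sum>d\<in>D. measure X {x\<in>space X. \<eta> x = d \<and> l x = i \<and> \<kappa> i d})"
            by (rule measure_split(1)[OF finX \<eta> finD, of "\<lambda>d x. l x = i \<and> \<kappa> i d"])
              (use joint[of "\<lambda>_ k. k = i \<and> \<kappa> i _"] in simp)
          also have "\<dots> = (\<Sum>d\<in>D. if \<kappa> i d then measure X {x\<in>space X. l x = i \<and> \<eta> x = d} else 0)"
            by (rule sum.cong) (auto simp: conj_commute)
          finally show ?thesis .
        qed
        moreover have "m i * T i = (\<Sum>d\<in>D. if \<kappa> i d then m i * w d else 0)" for i
          unfolding T_def sum_distrib_left by (rule sum.cong) auto
        moreover have "\<bar>(\<Sum>d\<in>D. if \<kappa> i d then measure X {x\<in>space X. l x = i \<and> \<eta> x = d} else 0) -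
          (\<Sum>d\<in>D. if \<kappa> i d then m i * w d else 0)\<bar> \<le> real (card D) * e2" if "i \<in> I" for i
          by (rule sum_abs_le[OF finD _ order_refl])
            (use ind[rule_format, OF that] e2 in \<open>auto simp: m_def intro: less_imp_le\<close>)
        ultimately show ?thesis using sum_abs_le[OF finI _ e2'] by simp
      qed
      have s5: "\<bar>?X1 - ?X2\<bar> < \<epsilon> / 4"
      proof -
        have "\<bar>?X1 - ?X2\<bar> \<le> measure X {x\<in>space X. \<beta> x \<noteq> v (l x)}"
          by (rule X.measure_neq_le[OF conjX[OF \<beta>j] conjX[OF vj] ne]) auto
        then show ?thesis using v by simp
      qed
      \<comment> \<open>Quarters of \<open>\<epsilon>\<close> are spent on replacing
        \<open>\<beta>\<close> in \<open>Y\<close>, on the relative model, and on replacing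
        \<open>\<beta>\<close> in \<open>X\<close>; eighths on the equivariance and on the
        independence of \<open>\<eta>\<close>.\<close>
      show "\<bar>?Y1 - ?X1\<bar> < \<epsilon>" using s1 s2 s3 s4 s5 e2'' by linarith
    qed
  qed
qed

section \<open>The profinite completion\<close>

locale completion = group G for G :: "('g, 'm) monoid_scheme" (structure) +
  fixes \<mu> :: "('g set \<Rightarrow> 'g set) measure"
  assumes haar: "normalized_haar_measure (profinite_completion G) (profinite_topology G) \<mu>"
begin

abbreviation "\<F> \<equiv> fin_index_normals G"
abbreviation "K \<equiv> carrier (profinite_completion G)"
abbreviation "T \<equiv> profinite_topology G"

text \<open>Multiplication by the image of \<open>g\<close> in the quotient by \<open>N\<close>,
  written on plain sets so that it coincides with the coordinate of \<open>left_translation\<close>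
  at \<open>N\<close>.\<close>

definition coset_act :: "'g set \<Rightarrow> 'g \<Rightarrow> 'g set \<Rightarrow> 'g set" where
  "coset_act N g C = (N #> g) <#> C"

lemma fin_index_normalsD: "N \<in> \<F> \<Longrightarrow> N \<lhd> G" "N \<in> \<F> \<Longrightarrow> finite (rcosets N)"
  by (auto simp: fin_index_normals_def FactGroup_def)

lemma carrier_Mod: "carrier (G Mod N) = rcosets N"
  by (simp add: FactGroup_def)

lemma mult_Mod: "x \<otimes>\<^bsub>G Mod N\<^esub> y = x <#> y"
  by (simp add: FactGroup_def)

lemma rcosetsE: "C \<in> rcosets N \<Longrightarrow> (\<And>g. g \<in> carrier G \<Longrightarrow> C = N #> g \<Longrightarrow> thesis) \<Longrightarrow> thesis"
  by (auto simp: RCOSETS_def)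

lemma rcosetsI: "g \<in> carrier G \<Longrightarrow> N #> g \<in> rcosets N"
  by (auto simp: RCOSETS_def)

lemma coset_act_rcos: "N \<in> \<F> \<Longrightarrow> g \<in> carrier G \<Longrightarrow> h \<in> carrier G \<Longrightarrow> coset_act N g (N #> h) = N #> (g \<otimes> h)"
  unfolding coset_act_def using normal.rcos_sum[OF fin_index_normalsD(1)] by simp

lemma gset_coset_act:
  assumes N: "N \<in> \<F>" shows "gset G (rcosets N) (coset_act N)"
  unfolding gset_def
proof (intro conjI ballI)
  show "finite (rcosets N)" using fin_index_normalsD(2)[OF N] .
  fix C assume "C \<in> rcosets N"
  then obtain k where k: "k \<in> carrier G" "C = N #> k" by (rule rcosetsE)
  show "coset_act N \<one> C = C" using k coset_act_rcos[OF N] by simp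
  fix g assume g: "g \<in> carrier G"
  show "coset_act N g C \<in> rcosets N" using k g coset_act_rcos[OF N] by (simp add: rcosetsI)
  fix h assume h: "h \<in> carrier G"
  show "coset_act N (g \<otimes> h) C = coset_act N g (coset_act N h C)"
    using k g h by (simp add: coset_act_rcos[OF N] m_assoc)
qed

lemma coset_act_trans:
  assumes N: "N \<in> \<F>" and "C \<in> rcosets N" "C' \<in> rcosets N"
  shows "\<exists>g\<in>carrier G. coset_act N g C = C'"
proof -
  obtain k k' where k: "k \<in> carrier G" "C = N #> k" "k' \<in> carrier G" "C' = N #> k'"
    using assms(2,3) by (auto elim!: rcosetsE)
  have "k' \<otimes> inv k \<otimes> k = k'" using k by (simp add: m_assoc)
  then show ?thesis using k by (intro bexI[of _ "k' \<otimes> inv k"]) (simp_all add: coset_act_rcos[OF N])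
qed

lemma rcos_larger:
  assumes N: "N \<in> \<F>" and M: "M \<in> \<F>" and NM: "N \<subseteq> M" and g: "g \<in> carrier G"
  shows "M <#> (N #> g) = M #> g"
proof -
  have sM: "subgroup M G" and sN: "subgroup N G" using fin_index_normalsD(1) N M by (auto simp: normal_imp_subgroup)
  have sub: "M \<subseteq> carrier G" "N \<subseteq> carrier G" using sM sN by (auto simp: subgroup.subset)
  have "M <#> N = M"
  proof (intro equalityI subsetI)
    fix x assume "x \<in> M <#> N"
    then obtain m n where "m \<in> M" "n \<in> N" "x = m \<otimes> n" by (auto simp: set_mult_def)
    then show "x \<in> M" using NM sM by (auto intro: subgroup.m_closed)
  next
    fix x assume x: "x \<in> M"
    then have "x = x \<otimes> \<one>" using sub by auto
    then show "x \<in> M <#> N" using x subgroup.one_closed[OF sN] unfolding set_mult_def by blast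
  qed
  then show ?thesis using setmult_rcos_assoc[OF sub g] by simp
qed

text \<open>The trivial quotient. It keeps the families of levels nonempty, and it is the coordinate
  to take when only the interval variable is to be tested.\<close>

lemma carrier_in_F: "carrier G \<in> \<F>"
proof -
  have "carrier G #> g = carrier G" if "g \<in> carrier G" for g
    using that coset_join2 subgroup_self by blast
  then have "rcosets (carrier G) \<subseteq> {carrier G}" by (auto elim!: rcosetsE)
  then have "finite (rcosets (carrier G))" by (rule finite_subset) simp
  moreover have "carrier G \<lhd> G"
    by (rule normalI[OF subgroup_self]) (metis coset_join2 coset_join3 subgroup_self)
  ultimately show ?thesis by (simp add: fin_index_normals_def carrier_Mod)
qed

text \<open>A coset of the intersection is the intersection of a coset of \<open>N\<close> with a
  coset of \<open>M\<close>, which leaves finitely many possibilities. This makes the finite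
  quotients directed.\<close>

lemma Int_in_F:
  assumes N: "N \<in> \<F>" and M: "M \<in> \<F>" shows "N \<inter> M \<in> \<F>"
proof -
  have nrm: "N \<inter> M \<lhd> G" using normal_subgroup_intersect[OF fin_index_normalsD(1)[OF N] fin_index_normalsD(1)[OF M]] .
  have "(N \<inter> M) #> g = (N #> g) \<inter> (M #> g)" if g: "g \<in> carrier G" for g
  proof (intro equalityI subsetI)
    fix x assume "x \<in> (N #> g) \<inter> (M #> g)"
    then obtain n m where nm: "n \<in> N" "m \<in> M" "x = n \<otimes> g" "x = m \<otimes> g"
      by (auto simp: r_coset_def)
    have "n \<in> carrier G" "m \<in> carrier G"
      using nm(1,2) subgroup.mem_carrier[OF normal_imp_subgroup[OF fin_index_normalsD(1)[OF N]]]
        subgroup.mem_carrier[OF normal_imp_subgroup[OF fin_index_normalsD(1)[OF M]]] by auto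
    then have "n = m" using nm g by simp
    then show "x \<in> (N \<inter> M) #> g" using nm by (auto simp: r_coset_def)
  qed (auto simp: r_coset_def)
  then have eq: "(N \<inter> M) #> g = (\<lambda>(A, B). A \<inter> B) (N #> g, M #> g)" if "g \<in> carrier G" for g
    using that by simp
  have "rcosets (N \<inter> M) \<subseteq> (\<lambda>(A, B). A \<inter> B) ` ((rcosets N) \<times> (rcosets M))"
  proof
    fix C assume "C \<in> rcosets (N \<inter> M)"
    then obtain g where g: "g \<in> carrier G" "C = (N \<inter> M) #> g" by (rule rcosetsE)
    show "C \<in> (\<lambda>(A, B). A \<inter> B) ` ((rcosets N) \<times> (rcosets M))"
      unfolding g(2) eq[OF g(1)] using rcosetsI[OF g(1)] by (intro imageI SigmaI) auto
  qed
  then have "finite (rcosets (N \<inter> M))" by (rule finite_subset) (simp add: fin_index_normalsD(2) N M)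
  then show ?thesis using nrm by (simp add: fin_index_normals_def carrier_Mod)
qed

lemma Inter_in_F:
  assumes "finite A" "A \<subseteq> \<F>" shows "\<exists>N\<in>\<F>. \<forall>M\<in>A. N \<subseteq> M"
  using assms
proof induction
  case empty then show ?case using carrier_in_F by auto
next
  case (insert M A)
  then obtain N where "N \<in> \<F>" "\<forall>M\<in>A. N \<subseteq> M" by auto
  then show ?case using Int_in_F[of N M] insert.prems by (intro bexI[of _ "N \<inter> M"]) auto
qed

lemma K_iff: "x \<in> K \<longleftrightarrow> x \<in> (\<Pi>\<^sub>E N\<in>\<F>. rcosets N) \<and> (\<forall>N\<in>\<F>. \<forall>M\<in>\<F>. N \<subseteq> M \<longrightarrow> M <#> x N = x M)"
  by (simp add: profinite_completion_def carrier_Mod)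

lemma K_coset: "x \<in> K \<Longrightarrow> N \<in> \<F> \<Longrightarrow> x N \<in> rcosets N"
  by (auto simp: K_iff PiE_iff)

lemma K_compat: "x \<in> K \<Longrightarrow> N \<in> \<F> \<Longrightarrow> M \<in> \<F> \<Longrightarrow> N \<subseteq> M \<Longrightarrow> x M = M <#> x N"
  by (simp add: K_iff)

lemma K_ext: "x \<in> K \<Longrightarrow> x \<in> extensional \<F>"
  by (simp add: K_iff PiE_iff)

lemma K_eqI: "x \<in> K \<Longrightarrow> y \<in> K \<Longrightarrow> (\<And>N. N \<in> \<F> \<Longrightarrow> x N = y N) \<Longrightarrow> x = y"
  using extensionalityI[OF K_ext K_ext] by blast

lemma left_translation_apply:
  assumes "g \<in> carrier G" "x \<in> K" "N \<in> \<F>"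
  shows "left_translation G g x N = coset_act N g (x N)"
  using assms by (simp add: left_translation_def to_completion_def profinite_completion_def
      product_group_def mult_Mod coset_act_def)

lemma left_translation_closed:
  assumes g: "g \<in> carrier G" and x: "x \<in> K" shows "left_translation G g x \<in> K"
  unfolding K_iff
proof (intro conjI ballI impI)
  show "left_translation G g x \<in> (\<Pi>\<^sub>E N\<in>\<F>. rcosets N)"
  proof (rule PiE_I)
    fix N assume N: "N \<in> \<F>"
    show "left_translation G g x N \<in> rcosets N"
      using gset_coset_act[OF N] g K_coset[OF x N]
      by (simp add: left_translation_apply[OF g x N] gset_def)
  next
    fix N assume "N \<notin> \<F>"
    then show "left_translation G g x N = undefined"
      using x by (simp add: left_translation_def profinite_completion_def product_group_def)
  qed
  fix N M assume NM: "N \<in> \<F>" "M \<in> \<F>" "N \<subseteq> M"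
  obtain k where k: "k \<in> carrier G" "x N = N #> k" using K_coset[OF x NM(1)] by (rule rcosetsE)
  have xM: "x M = M #> k" using K_compat[OF x NM] k rcos_larger[OF NM k(1)] by simp
  show "M <#> left_translation G g x N = left_translation G g x M"
    using k g NM xM by (simp add: left_translation_apply[OF g x] coset_act_rcos rcos_larger)
qed

lemma to_completion_closed:
  assumes g: "g \<in> carrier G" shows "to_completion G g \<in> K"
  unfolding K_iff using g rcos_larger by (auto simp: to_completion_def rcosetsI)

lemma left_translation_one: "x \<in> K \<Longrightarrow> left_translation G \<one> x = x"
proof (rule K_eqI[OF left_translation_closed])
  fix N assume x: "x \<in> K" and N: "N \<in> \<F>"
  then show "left_translation G \<one> x N = x N"
    using gset_coset_act[OF N] K_coset[OF x N] by (simp add: left_translation_apply gset_def)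
qed auto

lemma left_translation_mult:
  assumes g: "g \<in> carrier G" and h: "h \<in> carrier G" and x: "x \<in> K"
  shows "left_translation G (g \<otimes> h) x = left_translation G g (left_translation G h x)"
proof (rule K_eqI[OF left_translation_closed left_translation_closed[OF g left_translation_closed]])
  fix N assume N: "N \<in> \<F>"
  then show "left_translation G (g \<otimes> h) x N = left_translation G g (left_translation G h x) N"
    using gset_coset_act[OF N] K_coset[OF x N] g h x left_translation_closed[OF h x]
    by (simp add: left_translation_apply gset_def)
qed (use g h x in auto)

lemma topspace_T: "topspace T = K"
proof -
  have "K \<subseteq> (\<Pi>\<^sub>E N\<in>\<F>. rcosets N)"
    by (rule subsetI, drule iffD1[OF K_iff], elim conjE)
  then show ?thesis by (simp add: profinite_topology_def carrier_Mod Int_absorb1)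
qed

lemma continuous_eval: "N \<in> \<F> \<Longrightarrow> continuous_map T (discrete_topology (rcosets N)) (\<lambda>x. x N)"
  unfolding profinite_topology_def carrier_Mod
  by (intro continuous_map_from_subtopology continuous_map_product_projection)

lemma open_cylinder: assumes "N \<in> \<F>" shows "openin T {x\<in>K. x N \<in> E}"
proof -
  have "openin T {x\<in>topspace T. x N \<in> E \<inter> rcosets N}"
    by (rule openin_continuous_map_preimage[OF continuous_eval[OF assms]]) simp
  also have "{x\<in>topspace T. x N \<in> E \<inter> rcosets N} = {x\<in>K. x N \<in> E}"
    using K_coset assms by (auto simp: topspace_T)
  finally show ?thesis .
qed

lemma continuous_left_translation:
  assumes g: "g \<in> carrier G" shows "continuous_map T T (left_translation G g)"
proof -
  have "continuous_map T (product_topology (\<lambda>N. discrete_topology (carrier (G Mod N))) \<F>) (left_translation G g)"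
    unfolding continuous_map_componentwise
  proof (intro conjI ballI)
    show "left_translation G g ` topspace T \<subseteq> extensional \<F>"
      using K_ext left_translation_closed[OF g] by (auto simp: topspace_T)
    fix N assume N: "N \<in> \<F>"
    have "continuous_map T (discrete_topology (rcosets N)) (coset_act N g \<circ> (\<lambda>x. x N))"
    proof (rule continuous_map_compose[OF continuous_eval[OF N]])
      show "continuous_map (discrete_topology (rcosets N)) (discrete_topology (rcosets N)) (coset_act N g)"
        using gset_coset_act[OF N] g by (simp add: gset_def image_subset_iff Pi_iff)
    qed
    then show "continuous_map T (discrete_topology (carrier (G Mod N))) (\<lambda>x. left_translation G g x N)"
      unfolding carrier_Mod
      by (rule continuous_map_eq) (use left_translation_apply[OF g _ N] in \<open>simp add: topspace_T\<close>)
  qed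
  then have "continuous_map T (subtopology (product_topology (\<lambda>N. discrete_topology (carrier (G Mod N))) \<F>) K)
      (left_translation G g)"
    unfolding continuous_map_in_subtopology using left_translation_closed[OF g] by (auto simp: topspace_T)
  then show ?thesis by (simp only: profinite_topology_def)
qed

lemma prob_space_\<mu>: "prob_space \<mu>" and space_\<mu>: "space \<mu> = K"
  and sets_\<mu>: "sets \<mu> = sigma_sets K {U. openin T U}"
  using haar by (auto simp: normalized_haar_measure_def is_borel_of_def topspace_T)

lemma open_sets: "openin T U \<Longrightarrow> U \<in> sets \<mu>"
  by (simp add: sets_\<mu> sigma_sets.Basic)

lemma left_translation_measurable:
  assumes g: "g \<in> carrier G" shows "left_translation G g \<in> measurable \<mu> \<mu>"
proof (rule measurable_sigma_sets[OF sets_\<mu>])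
  show "{U. openin T U} \<subseteq> Pow K" using openin_subset topspace_T by auto
  show "left_translation G g \<in> space \<mu> \<rightarrow> K" using left_translation_closed[OF g] by (simp add: space_\<mu>)
  fix U assume "U \<in> {U. openin T U}"
  then have "openin T {x\<in>topspace T. left_translation G g x \<in> U}"
    using openin_continuous_map_preimage[OF continuous_left_translation[OF g]] by simp
  also have "{x\<in>topspace T. left_translation G g x \<in> U} = left_translation G g -` U \<inter> space \<mu>"
    by (auto simp: topspace_T space_\<mu>)
  finally show "left_translation G g -` U \<inter> space \<mu> \<in> sets \<mu>" by (rule open_sets)
qed

text \<open>Haar invariance speaks of translated sets, the image measure of preimages. The preimage
  \<open>B\<close> of \<open>A\<close> is a set whose translate is \<open>A\<close>, so both have
  the same measure.\<close>

lemma left_translation_distr: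
  assumes g: "g \<in> carrier G" shows "distr \<mu> \<mu> (left_translation G g) = \<mu>"
proof (rule measure_eqI)
  fix A assume "A \<in> sets (distr \<mu> \<mu> (left_translation G g))"
  then have A: "A \<in> sets \<mu>" by simp
  define B where "B = left_translation G g -` A \<inter> space \<mu>"
  have B: "B \<in> sets \<mu>" unfolding B_def by (rule measurable_sets[OF left_translation_measurable[OF g] A])
  have AK: "A \<subseteq> K" using sets.sets_into_space[OF A] space_\<mu> by simp
  have "to_completion G g <#\<^bsub>profinite_completion G\<^esub> B = left_translation G g ` B"
    by (auto simp: l_coset_def left_translation_def B_def space_\<mu>)
  also have "\<dots> = A"
  proof (intro equalityI subsetI)
    fix x assume x: "x \<in> A"
    have "left_translation G g (left_translation G (inv g) x) = x"
      using left_translation_mult[of g "inv g" x] left_translation_one[of x] g x AK by auto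
    moreover have "left_translation G (inv g) x \<in> K" using left_translation_closed g x AK by auto
    ultimately show "x \<in> left_translation G g ` B" using x
      by (intro image_eqI[of _ _ "left_translation G (inv g) x"]) (auto simp: B_def space_\<mu>)
  qed (auto simp: B_def)
  finally have AB: "to_completion G g <#\<^bsub>profinite_completion G\<^esub> B = A" .
  have "\<forall>x\<in>K. \<forall>A\<in>sets \<mu>. emeasure \<mu> (x <#\<^bsub>profinite_completion G\<^esub> A) = emeasure \<mu> A"
    using haar unfolding normalized_haar_measure_def by (elim conjE)
  from this[rule_format, OF to_completion_closed[OF g] B] have "emeasure \<mu> A = emeasure \<mu> B"
    unfolding AB .
  then show "emeasure (distr \<mu> \<mu> (left_translation G g)) A = emeasure \<mu> A"
    using emeasure_distr[OF left_translation_measurable[OF g] A] by (simp add: B_def)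
qed simp

lemma pmp_left_translation: "pmp_action G \<mu> (left_translation G)"
proof (rule pmp_actionI[OF is_group prob_space_\<mu>])
  fix g assume g: "g \<in> carrier G"
  show "left_translation G g \<in> extensional (space \<mu>)" by (simp add: left_translation_def space_\<mu>)
qed (simp_all add: left_translation_measurable left_translation_distr left_translation_one
    left_translation_mult space_\<mu>)

lemma eval_measurable:
  assumes N: "N \<in> \<F>" shows "(\<lambda>x. x N) \<in> measurable \<mu> (count_space (rcosets N))"
proof (subst measurable_count_space_eq2[OF fin_index_normalsD(2)[OF N]], intro conjI ballI)
  show "(\<lambda>x. x N) \<in> space \<mu> \<rightarrow> rcosets N" using K_coset N by (simp add: space_\<mu>)
  fix C
  have "(\<lambda>x. x N) -` {C} \<inter> space \<mu> = {x\<in>K. x N \<in> {C}}" by (auto simp: space_\<mu>)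
  then show "(\<lambda>x. x N) -` {C} \<inter> space \<mu> \<in> sets \<mu>" using open_sets[OF open_cylinder[OF N, of "{C}"]] by simp
qed

definition levels :: "(('g set \<Rightarrow> 'g set) \<Rightarrow> 'g set) set" where
  "levels = (\<lambda>N x. x N) ` \<F>"

text \<open>The coordinate at \<open>N \<inter> M\<close> determines those at \<open>N\<close> and
  at \<open>M\<close> through the bonding maps of the inverse limit.\<close>

lemma level_family_levels: "level_family \<mu> levels"
  unfolding level_family_def
proof (intro conjI ballI)
  show "levels \<noteq> {}" using carrier_in_F by (auto simp: levels_def)
  fix l assume "l \<in> levels"
  then obtain N where N: "N \<in> \<F>" "l = (\<lambda>x. x N)" by (auto simp: levels_def)
  show "l \<in> measurable \<mu> (count_space UNIV)"
    unfolding N(2) by (rule measurable_compose[OF eval_measurable[OF N(1)]]) simp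
  fix l' assume "l' \<in> levels"
  then obtain M where M: "M \<in> \<F>" "l' = (\<lambda>x. x M)" by (auto simp: levels_def)
  have "l x = N <#> x (N \<inter> M) \<and> l' x = M <#> x (N \<inter> M)" if "x \<in> space \<mu>" for x
  proof -
    have x: "x \<in> K" using that by (simp add: space_\<mu>)
    show ?thesis
      using K_compat[OF x Int_in_F[OF N(1) M(1)] N(1)] K_compat[OF x Int_in_F[OF N(1) M(1)] M(1)] N(2) M(2)
      by auto
  qed
  then have *: "\<forall>x\<in>space \<mu>. l x = N <#> x (N \<inter> M) \<and> l' x = M <#> x (N \<inter> M)" by blast
  have "(\<lambda>x. x (N \<inter> M)) \<in> levels" using Int_in_F[OF N(1) M(1)] by (auto simp: levels_def)
  then show "\<exists>k\<in>levels. \<exists>u u'. \<forall>x\<in>space \<mu>. l x = u (k x) \<and> l' x = u' (k x)"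
    by (rule bexI[rotated]) (rule exI[of _ "\<lambda>C. N <#> C"], rule exI[of _ "\<lambda>C. M <#> C"], rule *)
qed

text \<open>A basic neighbourhood in the product restricts only finitely many coordinates, and one
  subgroup below all of them determines these coordinates by compatibility.\<close>

lemma open_contains_cylinder:
  assumes U: "openin T U" and x: "x \<in> U"
  shows "\<exists>N\<in>\<F>. {y\<in>K. y N = x N} \<subseteq> U"
proof -
  obtain V where V: "openin (product_topology (\<lambda>N. discrete_topology (rcosets N)) \<F>) V" "U = V \<inter> K"
    using U unfolding profinite_topology_def openin_subtopology carrier_Mod by auto
  obtain W where W: "finite {N\<in>\<F>. W N \<noteq> rcosets N}" "x \<in> Pi\<^sub>E \<F> W" "Pi\<^sub>E \<F> W \<subseteq> V"
    using V x unfolding openin_product_topology_alt by fastforce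
  obtain N where N: "N \<in> \<F>" "\<forall>M\<in>{N\<in>\<F>. W N \<noteq> rcosets N}. N \<subseteq> M"
    using Inter_in_F[OF W(1)] by auto
  have xK: "x \<in> K" using x V by auto
  have "y \<in> U" if y: "y \<in> K" "y N = x N" for y
  proof -
    have "y M \<in> W M" if M: "M \<in> \<F>" for M
    proof (cases "W M = rcosets M")
      case True then show ?thesis using K_coset[OF y(1) M] by simp
    next
      case False
      then have "N \<subseteq> M" using N M by auto
      then have "y M = x M" using K_compat[OF y(1) N(1) M] K_compat[OF xK N(1) M] y(2) by simp
      then show ?thesis using W(2) M by (auto simp: PiE_iff)
    qed
    then have "y \<in> Pi\<^sub>E \<F> W" using K_ext[OF y(1)] by (auto simp: PiE_iff)
    then show ?thesis using W(3) V(2) y(1) by auto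
  qed
  then show ?thesis using N(1) by auto
qed

text \<open>An open set of a non-metrizable completion may be an uncountable union of cylinders, so
  countable additivity does not suffice. Inner regularity supplies a compact subset of nearly full
  measure; finitely many cylinders inside \<open>U\<close> cover it, and their union is a union of
  fibres of one coordinate.\<close>

lemma approx_open:
  assumes U: "openin T U" shows "approx_set \<mu> levels U"
  unfolding approx_set_def
proof (intro conjI allI impI open_sets[OF U])
  interpret \<mu>: prob_space \<mu> by (rule prob_space_\<mu>)
  fix e :: real assume e: "0 < e"
  have "\<exists>C. compactin T C \<and> C \<subseteq> U \<and> measure \<mu> U < measure \<mu> C + e"
  proof (rule ccontr)
    assume n: "\<not> ?thesis"
    have "\<forall>U. openin T U \<longrightarrow> emeasure \<mu> U = (SUP C\<in>{C. compactin T C \<and> C \<subseteq> U}. emeasure \<mu> C)"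
      using haar unfolding normalized_haar_measure_def by (elim conjE)
    from this[rule_format, OF U]
    have "emeasure \<mu> U = (SUP C\<in>{C. compactin T C \<and> C \<subseteq> U}. emeasure \<mu> C)" .
    also have "\<dots> \<le> ennreal (measure \<mu> U - e)"
    proof (rule SUP_least)
      fix C assume C: "C \<in> {C. compactin T C \<and> C \<subseteq> U}"
      have "measure \<mu> C \<le> measure \<mu> U - e"
      proof (rule ccontr)
        assume "\<not> ?thesis"
        then have "compactin T C \<and> C \<subseteq> U \<and> measure \<mu> U < measure \<mu> C + e" using C by simp
        then have "\<exists>C. compactin T C \<and> C \<subseteq> U \<and> measure \<mu> U < measure \<mu> C + e" by (rule exI)
        with n show False by (rule notE)
      qed
      then show "emeasure \<mu> C \<le> ennreal (measure \<mu> U - e)"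
        by (simp add: \<mu>.emeasure_eq_measure ennreal_leI)
    qed
    finally have "measure \<mu> U \<le> max 0 (measure \<mu> U - e)"
      by (auto simp add: \<mu>.emeasure_eq_measure ennreal_le_iff2 max_def)
    then have "measure \<mu> U \<le> 0" using e by (simp add: max_def split: if_splits)
    then have "measure \<mu> U = 0" using measure_nonneg by (rule antisym)
    then have "compactin T {} \<and> {} \<subseteq> U \<and> measure \<mu> U < measure \<mu> {} + e" using e by simp
    then have "\<exists>C. compactin T C \<and> C \<subseteq> U \<and> measure \<mu> U < measure \<mu> C + e" by (rule exI)
    with n show False by (rule notE)
  qed
  then obtain C where C: "compactin T C" "C \<subseteq> U" "measure \<mu> U < measure \<mu> C + e"
    by (elim exE conjE)
  define nb where "nb x = (SOME N. N \<in> \<F> \<and> {y\<in>K. y N = x N} \<subseteq> U)" for x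
  have nb: "nb x \<in> \<F>" "{y\<in>K. y (nb x) = x (nb x)} \<subseteq> U" if "x \<in> C" for x
  proof -
    have "x \<in> U" using C(2) that by auto
    from open_contains_cylinder[OF U this]
    have "\<exists>N. N \<in> \<F> \<and> {y\<in>K. y N = x N} \<subseteq> U" unfolding Bex_def .
    then have "nb x \<in> \<F> \<and> {y\<in>K. y (nb x) = x (nb x)} \<subseteq> U"
      unfolding nb_def by (rule someI_ex[of "\<lambda>N. N \<in> \<F> \<and> {y\<in>K. y N = x N} \<subseteq> U"])
    then show "nb x \<in> \<F>" "{y\<in>K. y (nb x) = x (nb x)} \<subseteq> U" by auto
  qed
  define cyl where "cyl x = {y\<in>K. y (nb x) \<in> {x (nb x)}}" for x
  have CK: "C \<subseteq> K" using C(1) compactin_subset_topspace topspace_T by auto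
  have op: "openin T V" if V: "V \<in> cyl ` C" for V
  proof -
    obtain x where x: "x \<in> C" "V = cyl x" using V by auto
    show ?thesis unfolding x(2) cyl_def by (rule open_cylinder[OF nb(1)[OF x(1)]])
  qed
  have cov: "C \<subseteq> \<Union>(cyl ` C)" using CK by (auto simp: cyl_def)
  have "\<exists>V. finite V \<and> V \<subseteq> cyl ` C \<and> C \<subseteq> \<Union>V"
    by (rule compactinD[OF C(1) op cov])
  then obtain V where V: "finite V" "V \<subseteq> cyl ` C" "C \<subseteq> \<Union>V" by blast
  obtain X0 where X0: "X0 \<subseteq> C" "finite X0" "V = cyl ` X0" using finite_subset_image[OF V(1,2)] by blast
  obtain N where N: "N \<in> \<F>" "\<forall>M\<in>nb ` X0. N \<subseteq> M"
  proof -
    have "nb ` X0 \<subseteq> \<F>" using X0(1) nb(1) by auto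
    from Inter_in_F[OF finite_imageI[OF X0(2)] this] show ?thesis by (elim bexE) (rule that)
  qed
  \<comment> \<open>\<open>N\<close> lies below all subgroups that define the chosen cylinders, so
    membership in any of them depends on the coordinate at \<open>N\<close> alone and
    \<open>E\<close> recovers their union exactly.\<close>
  define E where "E = (\<lambda>y. y N) ` \<Union>V"
  have VK: "\<Union>V \<subseteq> K" using X0 by (auto simp: cyl_def)
  have VU: "\<Union>V \<subseteq> U"
  proof
    fix y assume "y \<in> \<Union>V"
    then obtain x where x: "x \<in> X0" "y \<in> cyl x" using X0(3) by auto
    then have "y \<in> {y\<in>K. y (nb x) = x (nb x)}" by (simp add: cyl_def)
    moreover have "x \<in> C" using x(1) X0(1) by auto
    ultimately show "y \<in> U" using nb(2) by auto
  qed
  have "{y\<in>space \<mu>. y N \<in> E} = \<Union>V"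
  proof (intro equalityI subsetI)
    fix y assume y: "y \<in> {y\<in>space \<mu>. y N \<in> E}"
    then obtain z x where z: "y N = z N" "x \<in> X0" "z \<in> cyl x" using X0 by (auto simp: E_def)
    have yz: "y \<in> K" "z \<in> K" using y z by (auto simp: space_\<mu> cyl_def)
    have nx: "nb x \<in> \<F>" "N \<subseteq> nb x" using nb(1) X0 z N by auto
    have "y (nb x) = z (nb x)" using K_compat[OF yz(1) N(1) nx] K_compat[OF yz(2) N(1) nx] z(1) by simp
    then have "y \<in> cyl x" using z yz by (auto simp: cyl_def)
    then show "y \<in> \<Union>V" using X0 z by auto
  qed (use VK in \<open>auto simp: E_def space_\<mu>\<close>)
  moreover have "sym_diff U (\<Union>V) = U - \<Union>V" using VU by auto
  moreover have "measure \<mu> (U - \<Union>V) = measure \<mu> U - measure \<mu> (\<Union>V)"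
  proof (rule \<mu>.finite_measure_Diff[OF open_sets[OF U]])
    show Vs: "\<Union>V \<in> sets \<mu>" using V(2) op by (intro open_sets openin_Union) auto
    show "\<Union>V \<subseteq> U" by (rule VU)
  qed
  moreover have "measure \<mu> C \<le> measure \<mu> (\<Union>V)"
    using V op by (intro \<mu>.finite_measure_mono V(3) open_sets openin_Union) auto
  ultimately have "measure \<mu> (sym_diff U {y\<in>space \<mu>. y N \<in> E}) < e" using C(3) by simp
  then show "\<exists>l\<in>levels. \<exists>E. measure \<mu> (sym_diff U {x \<in> space \<mu>. l x \<in> E}) < e"
    using N(1) by (intro bexI[of _ "\<lambda>x. x N"] exI[of _ E]) (auto simp: levels_def)
qed

lemma approx_\<mu>: assumes "A \<in> sets \<mu>" shows "approx_set \<mu> levels A"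
proof -
  interpret \<mu>: prob_space \<mu> by (rule prob_space_\<mu>)
  have A: "A \<in> sigma_sets (space \<mu>) {U. openin T U}"
    using assms unfolding sets_\<mu> space_\<mu> .
  show ?thesis
    by (rule \<mu>.approx_set_sigma_sets[OF level_family_levels _ A]) (rule approx_open, simp)
qed

end

section \<open>The completion acting on a finite set\<close>

definition ker_act :: "('g, 'm) monoid_scheme \<Rightarrow> 'd set \<Rightarrow> ('g \<Rightarrow> 'd \<Rightarrow> 'd) \<Rightarrow> 'g set" where
  "ker_act G D c = {g\<in>carrier G. \<forall>d\<in>D. c g d = d}"

text \<open>The action of the completion on a finite \<open>G\<close>-set. The action of
  \<open>G\<close> factors through the quotient by the kernel, so the coordinate of a point of the
  completion at the kernel acts on \<open>D\<close>; a representative of this coset is picked by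
  choice.\<close>

definition coset_apply :: "('g \<Rightarrow> 'd \<Rightarrow> 'd) \<Rightarrow> 'g set \<Rightarrow> 'd \<Rightarrow> 'd" where
  "coset_apply c B d = c (SOME g. g \<in> B) d"

context group begin

lemma gsetD:
  assumes "gset G D c"
  shows "finite D" "g \<in> carrier G \<Longrightarrow> d \<in> D \<Longrightarrow> c g d \<in> D" "d \<in> D \<Longrightarrow> c \<one> d = d"
    "g \<in> carrier G \<Longrightarrow> h \<in> carrier G \<Longrightarrow> d \<in> D \<Longrightarrow> c (g \<otimes> h) d = c g (c h d)"
  using assms by (auto simp: gset_def)

lemma ker_act_subgroup:
  assumes D: "gset G D c" shows "subgroup (ker_act G D c) G"
proof (rule subgroupI)
  show "ker_act G D c \<subseteq> carrier G" by (auto simp: ker_act_def)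
  show "ker_act G D c \<noteq> {}" using gsetD(3)[OF D] by (auto simp: ker_act_def intro!: exI[of _ \<one>])
  fix g assume g: "g \<in> ker_act G D c"
  then have gG: "g \<in> carrier G" by (simp add: ker_act_def)
  have "c (inv g) d = d" if "d \<in> D" for d
    using gset_inv(1)[OF is_group D gG that] g that by (simp add: ker_act_def)
  then show "inv g \<in> ker_act G D c" using gG by (simp add: ker_act_def)
  fix h assume "h \<in> ker_act G D c"
  then show "g \<otimes> h \<in> ker_act G D c" using g gsetD(4)[OF D] by (simp add: ker_act_def)
qed

text \<open>Two elements lie in the same coset of the kernel exactly if they act by the same
  self-map of \<open>D\<close>, and a finite set has finitely many self-maps.\<close>

lemma ker_act_fin_index:
  assumes D: "gset G D c" shows "ker_act G D c \<in> fin_index_normals G"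
proof -
  let ?L = "ker_act G D c"
  have sub: "subgroup ?L G" by (rule ker_act_subgroup[OF D])
  have "g \<otimes> h \<otimes> inv g \<in> ?L" if g: "g \<in> carrier G" and h: "h \<in> ?L" for g h
  proof -
    have hG: "h \<in> carrier G" using h by (simp add: ker_act_def)
    have "c (g \<otimes> h \<otimes> inv g) d = d" if d: "d \<in> D" for d
    proof -
      have gd: "c (inv g) d \<in> D" using gsetD(2)[OF D _ d] g by simp
      have "c (g \<otimes> h \<otimes> inv g) d = c g (c h (c (inv g) d))"
        using gsetD(4)[OF D] g hG d gd by simp
      also have "c h (c (inv g) d) = c (inv g) d" using h gd by (simp add: ker_act_def)
      also have "c g (c (inv g) d) = d" by (rule gset_inv(2)[OF is_group D g d])
      finally show ?thesis .
    qed
    then show ?thesis using g hG by (simp add: ker_act_def)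
  qed
  then have nrm: "?L \<lhd> G" using sub by (simp add: normal_inv_iff)
  define \<phi> where "\<phi> g = (\<lambda>d\<in>D. c g d)" for g
  have "?L #> g = {h\<in>carrier G. \<phi> h = \<phi> g}" if g: "g \<in> carrier G" for g
  proof (intro equalityI subsetI)
    fix h assume "h \<in> ?L #> g"
    then obtain l where l: "l \<in> ?L" "h = l \<otimes> g" by (auto simp: r_coset_def)
    then have lG: "l \<in> carrier G" by (simp add: ker_act_def)
    have "\<phi> h = \<phi> g" unfolding \<phi>_def
      by (rule restrict_ext) (use l lG g gsetD[OF D] in \<open>simp add: ker_act_def\<close>)
    then show "h \<in> {h\<in>carrier G. \<phi> h = \<phi> g}" using l lG g by simp
  next
    fix h assume "h \<in> {h\<in>carrier G. \<phi> h = \<phi> g}"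
    then have h: "h \<in> carrier G" "\<phi> h = \<phi> g" by auto
    have hg: "c h d = c g d" if "d \<in> D" for d
      using fun_cong[OF h(2), of d] that by (simp add: \<phi>_def)
    have "c (h \<otimes> inv g) d = d" if d: "d \<in> D" for d
    proof -
      have "c (h \<otimes> inv g) d = c h (c (inv g) d)" using gsetD(4)[OF D] h g d by simp
      also have "\<dots> = c g (c (inv g) d)" using gsetD(2)[OF D _ d] g by (intro hg) simp
      also have "\<dots> = d" by (rule gset_inv(2)[OF is_group D g d])
      finally show ?thesis .
    qed
    then have "h \<otimes> inv g \<in> ?L" using h g by (simp add: ker_act_def)
    moreover have "h = h \<otimes> inv g \<otimes> g" using h g by (simp add: m_assoc)
    ultimately show "h \<in> ?L #> g" unfolding r_coset_def by blast
  qed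
  then have "rcosets ?L \<subseteq> (\<lambda>f. {h\<in>carrier G. \<phi> h = f}) ` (D \<rightarrow>\<^sub>E D)"
    using gsetD(2)[OF D] by (auto simp: RCOSETS_def \<phi>_def intro!: image_eqI)
  moreover have "finite ((\<lambda>f. {h\<in>carrier G. \<phi> h = f}) ` (D \<rightarrow>\<^sub>E D))"
    using gsetD(1)[OF D] by (intro finite_imageI finite_PiE) auto
  ultimately have "finite (rcosets ?L)" by (rule finite_subset)
  then show ?thesis using nrm by (simp add: fin_index_normals_def FactGroup_def)
qed

text \<open>Two representatives of a coset differ by a kernel element on the left, which fixes the
  point \<open>c g d\<close>.\<close>

lemma coset_apply_rcos:
  assumes D: "gset G D c" and g: "g \<in> carrier G" and d: "d \<in> D"
  shows "coset_apply c (ker_act G D c #> g) d = c g d"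
proof -
  let ?L = "ker_act G D c"
  have "g \<in> ?L #> g" by (rule rcos_self[OF g ker_act_subgroup[OF D]])
  then have "(SOME h. h \<in> ?L #> g) \<in> ?L #> g" by (rule someI[of "\<lambda>h. h \<in> ?L #> g"])
  then obtain l where l: "l \<in> ?L" "(SOME h. h \<in> ?L #> g) = l \<otimes> g" by (auto simp: r_coset_def)
  have "c (l \<otimes> g) d = d'" if "c g d = d'" for d'
    using l(1) that gsetD(2,4)[OF D] g d by (auto simp: ker_act_def)
  then show ?thesis by (simp add: coset_apply_def l(2))
qed

end

text \<open>Translation preserves the measure and permutes the fibres of \<open>l\<close> as
  \<open>\<sigma>\<close> permutes \<open>I\<close>, so the image law is invariant.\<close>

lemma equivariant_weights:
  assumes a: "pmp_action G X a" and I: "gset G I \<sigma>" and l: "l \<in> measurable X (count_space I)"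
    and eq: "\<And>g x. g \<in> carrier G \<Longrightarrow> x \<in> space X \<Longrightarrow> l (a g x) = \<sigma> g (l x)"
  shows "weights G I \<sigma> (\<lambda>j. measure X {x\<in>space X. l x = j})"
proof -
  interpret group G using a by (rule pmp_actionD)
  interpret X: prob_space X using a by (rule pmp_actionD)
  have finI: "finite I" by (rule gsetD(1)[OF I])
  have ls: "{x\<in>space X. l x = i} \<in> sets X" for i
    using measure_split(2)[OF X.finite_measure_axioms l finI, of "\<lambda>j _. j = i"] by simp
  have "measure X {x\<in>space X. l x = \<sigma> g j} = measure X {x\<in>space X. l x = j}"
    if g: "g \<in> carrier G" and j: "j \<in> I" for g j
  proof -
    have "measure X {x\<in>space X. l x = \<sigma> g j} = measure X {x\<in>space X. l (a g x) = \<sigma> g j}"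
      by (rule pmp_action_measure[OF a g ls, symmetric])
    also have "{x\<in>space X. l (a g x) = \<sigma> g j} = {x\<in>space X. l x = j}"
    proof -
      have "l (a g x) = \<sigma> g j \<longleftrightarrow> l x = j" if x: "x \<in> space X" for x
      proof -
        have "l x \<in> I" using measurable_space[OF l x] by simp
        then show ?thesis using eq[OF g x] gset_bij[OF is_group I g] j by (auto simp: bij_betw_def inj_on_def)
      qed
      then show ?thesis by blast
    qed
    finally show ?thesis .
  qed
  moreover have "(\<Sum>j\<in>I. measure X {x\<in>space X. l x = j}) = 1"
    using measure_split(1)[OF X.finite_measure_axioms l finI, of "\<lambda>_ _. True"] X.prob_space by simp
  ultimately show ?thesis by (simp add: weights_def)
qed

text \<open>An invariant weight is constant on orbits. A transitive set thus has only one invariant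
  probability, which serves to identify the law of any equivariant map onto it.\<close>

lemma transitive_weights:
  assumes D: "gset G D c" and w: "weights G D c w"
    and trans: "\<And>d d'. d \<in> D \<Longrightarrow> d' \<in> D \<Longrightarrow> \<exists>g\<in>carrier G. c g d = d'" and d: "d \<in> D"
  shows "w d = 1 / card D"
proof -
  have "w d' = w d" if d': "d' \<in> D" for d'
  proof -
    obtain g where "g \<in> carrier G" "c g d = d'" using trans[OF d d'] by auto
    then show ?thesis using w d by (auto simp: weights_def)
  qed
  then have "sum w D = card D * w d" by simp
  then have 1: "card D * w d = 1" using w by (simp add: weights_def)
  have "card D > 0" using d D by (auto simp: gset_def card_gt_0_iff)
  then show ?thesis using 1 by (simp add: field_simps)
qed

text \<open>The index of the piece containing \<open>t\<close> when the unit interval is cut into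
  \<open>m\<close> equal half-open pieces. The \<open>min\<close> puts the endpoint 1 into the last
  piece, and for positive \<open>m\<close> it keeps the index below \<open>m\<close> even for
  numbers outside the interval.\<close>

definition cell :: "nat \<Rightarrow> real \<Rightarrow> nat" where
  "cell m t = min (nat \<lfloor>real m * t\<rfloor>) (m - 1)"

lemma space_unit_interval: "space unit_interval = {0..1}"
  by (simp add: space_restrict_space)

lemma sets_unit_interval: "A \<in> sets unit_interval \<longleftrightarrow> A \<subseteq> {0..1} \<and> A \<in> sets borel"
  by (subst sets_restrict_space_iff) auto

lemma measure_unit_interval: "A \<subseteq> {0..1} \<Longrightarrow> measure unit_interval A = measure lborel A"
  by (rule measure_restrict_space) auto

lemma cell_eq:
  assumes m: "0 < m" and t: "0 \<le> t" "t < 1"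
  shows "cell m t = nat \<lfloor>real m * t\<rfloor>"
proof -
  have "real m * t < real m" using m t by simp
  then have "\<lfloor>real m * t\<rfloor> < int m" by (simp add: floor_less_iff)
  then show ?thesis using m by (simp add: cell_def)
qed

lemma cell_mono: "s \<le> t \<Longrightarrow> cell m s \<le> cell m t"
proof -
  assume "s \<le> t"
  then have "real m * s \<le> real m * t" by (rule mult_left_mono) simp
  then have "nat \<lfloor>real m * s\<rfloor> \<le> nat \<lfloor>real m * t\<rfloor>" by (intro nat_mono floor_mono)
  then show ?thesis by (simp add: cell_def min_def)
qed

text \<open>Within each cell the fractional part of \<open>m * t\<close> runs uniformly through the
  interval from 0 to 1. Cutting that interval into consecutive pieces of lengths \<open>w d\<close>
  and letting \<open>h\<close> name the piece yields a variable with law \<open>w\<close> that is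
  independent of the cell.\<close>

lemma unit_interval_split:
  assumes m: "0 < m" and D: "finite D" and w: "\<And>d. d \<in> D \<Longrightarrow> (0::real) \<le> w d" "sum w D = 1"
  shows "\<exists>h\<in>measurable unit_interval (count_space D).
    \<forall>i<m. \<forall>d\<in>D. {t\<in>space unit_interval. cell m t = i \<and> h t = d} \<in> sets unit_interval \<and>
      measure unit_interval {t\<in>space unit_interval. cell m t = i \<and> h t = d} = w d / m"
proof -
  define k where "k = card D"
  obtain e where e: "bij_betw e {..<k} D"
    using ex_bij_betw_nat_finite[OF D] by (auto simp: k_def atLeast0LessThan)
  have eD: "e r \<in> D" if "r < k" for r using e that by (auto simp: bij_betw_def)
  define W where "W r = (\<Sum>s<r. w (e s))" for r
  have W0: "W 0 = 0" by (simp add: W_def)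
  have Wk: "W k = 1" using sum.reindex_bij_betw[OF e, of w] w(2) by (simp add: W_def)
  have WS: "W (Suc r) = W r + w (e r)" for r by (simp add: W_def)
  have Wmono: "W r \<le> W r'" if "r \<le> r'" "r' \<le> k" for r r'
    unfolding W_def using that by (intro sum_mono2) (auto intro!: w(1) eD)
  have kpos: "0 < k" using w(2) D by (auto simp: k_def card_gt_0_iff)
  define fr where "fr t = frac (real m * t)" for t
  have fr: "0 \<le> fr t" "fr t < 1" for t by (simp_all add: fr_def frac_lt_1)
  \<comment> \<open>The inverse of the distribution function \<open>W\<close>, with the elements of
    \<open>D\<close> enumerated by \<open>e\<close>. It never selects an index of weight
    zero.\<close>
  define q where "q t = (LEAST r. fr t < W (Suc r))" for t
  have qex: "fr t < W (Suc (k - 1))" for t using fr(2)[of t] Wk kpos by simp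
  have q1: "fr t < W (Suc (q t))" for t unfolding q_def by (rule LeastI, rule qex)
  have q2: "q t < k" for t
    using Least_le[of "\<lambda>r. fr t < W (Suc r)", OF qex[of t]] kpos by (simp add: q_def)
  have q3: "W (q t) \<le> fr t" for t
  proof (cases "q t")
    case 0 then show ?thesis using W0 fr(1) by simp
  next
    case (Suc r)
    then have "r < (LEAST r. fr t < W (Suc r))" by (simp add: q_def)
    then have "\<not> fr t < W (Suc r)" by (rule not_less_Least)
    then show ?thesis using Suc by simp
  qed
  have q_iff: "q t = r \<longleftrightarrow> W r \<le> fr t \<and> fr t < W (Suc r)" if r: "r < k" for t r
  proof
    assume "q t = r" then show "W r \<le> fr t \<and> fr t < W (Suc r)" using q1 q3 by auto
  next
    assume A: "W r \<le> fr t \<and> fr t < W (Suc r)"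
    have "q t \<le> r" unfolding q_def by (rule Least_le) (use A in simp)
    moreover have "\<not> q t < r"
    proof
      assume "q t < r"
      then have "W (Suc (q t)) \<le> W r" using r by (intro Wmono) auto
      then show False using q1[of t] A by simp
    qed
    ultimately show "q t = r" by simp
  qed
  define h where "h t = e (q t)" for t
  have hD: "h t \<in> D" for t unfolding h_def by (rule eD[OF q2])
  have key: "{t\<in>{0..1}. cell m t = i \<and> h t = d} \<in> sets borel \<and>
      measure lborel {t\<in>{0..1}. cell m t = i \<and> h t = d} = w d / m" if i: "i < m" and d: "d \<in> D" for i d
  proof -
    obtain r where r: "r < k" "d = e r" using e d by (auto simp: bij_betw_def)
    have hd: "h t = d \<longleftrightarrow> q t = r" for t
      using e r q2[of t] by (auto simp: h_def bij_betw_def inj_on_def)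
    define A where "A = {t\<in>{0..1}. cell m t = i \<and> h t = d}"
    define lo where "lo = (real i + W r) / m"
    define hi where "hi = (real i + W (Suc r)) / m"
    have W01: "0 \<le> W r" "W r \<le> W (Suc r)" "W (Suc r) \<le> 1"
      using Wmono[of 0 r] Wmono[of r "Suc r"] Wmono[of "Suc r" k] r(1) W0 Wk by auto
    have lohi: "0 \<le> lo" "lo \<le> hi" "hi \<le> 1"
    proof -
      show "0 \<le> lo" using W01 by (simp add: lo_def)
      show "lo \<le> hi" using W01 by (simp add: lo_def hi_def divide_right_mono)
      have "real i + W (Suc r) \<le> real m" using W01(3) i by linarith
      then show "hi \<le> 1" using m by (simp add: hi_def)
    qed
    \<comment> \<open>The point 1 is set apart: it belongs to the last cell while its fractional
      part is 0, so the half-open interval may miss it. A single point does not affect the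
      measure.\<close>
    have mem: "t \<in> A \<longleftrightarrow> t \<in> {lo..<hi}" if "t \<noteq> 1" for t
    proof -
      have "t \<in> {lo..<hi} \<longleftrightarrow> real i + W r \<le> real m * t \<and> real m * t < real i + W (Suc r)"
        using m by (simp add: lo_def hi_def field_simps)
      moreover have "t \<in> A \<longleftrightarrow> real i + W r \<le> real m * t \<and> real m * t < real i + W (Suc r)"
      proof
        assume t: "t \<in> A"
        then have t01: "0 \<le> t" "t < 1" using that by (auto simp: A_def)
        have "0 \<le> \<lfloor>real m * t\<rfloor>" using t01 by simp
        then have "real_of_int \<lfloor>real m * t\<rfloor> = real i"
        proof -
          have "nat \<lfloor>real m * t\<rfloor> = i" using t cell_eq[OF m t01] by (simp add: A_def)
          then have "\<lfloor>real m * t\<rfloor> = int i" using \<open>0 \<le> \<lfloor>real m * t\<rfloor>\<close> by linarith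
          then show ?thesis by simp
        qed
        then have "real m * t = real i + fr t" by (simp add: fr_def frac_def)
        moreover have "W r \<le> fr t" "fr t < W (Suc r)" using t hd q_iff[OF r(1)] by (auto simp: A_def)
        ultimately show "real i + W r \<le> real m * t \<and> real m * t < real i + W (Suc r)" by simp
      next
        assume t: "real i + W r \<le> real m * t \<and> real m * t < real i + W (Suc r)"
        then have "t \<in> {lo..<hi}" using m by (simp add: lo_def hi_def field_simps)
        then have t01: "0 \<le> t" "t < 1" using lohi by auto
        have fl: "\<lfloor>real m * t\<rfloor> = int i" using t W01 by (intro floor_unique) auto
        then have "fr t = real m * t - real i" by (simp add: fr_def frac_def)
        then have "q t = r" using t q_iff[OF r(1)] by simp
        then show "t \<in> A" using t01 cell_eq[OF m t01] fl hd by (simp add: A_def)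
      qed
      ultimately show ?thesis by simp
    qed
    have "A = {lo..<hi} \<union> (A \<inter> {1})" using mem lohi by fastforce
    moreover have n: "A \<inter> {1} \<in> null_sets lborel"
      by (rule countable_imp_null_set_lborel) auto
    ultimately have "A \<in> sets borel" "emeasure lborel A = emeasure lborel {lo..<hi}"
      using emeasure_Un_null_set[OF _ n, of "{lo..<hi}"] null_setsD2[OF n]
      by (metis atLeastLessThan_borel sets.Un sets_lborel, metis atLeastLessThan_borel sets_lborel)
    then have "A \<in> sets borel" "measure lborel A = hi - lo"
      using lohi by (auto simp: measure_def)
    moreover have "hi - lo = w d / m" using m WS[of r] r(2) by (simp add: hi_def lo_def field_simps)
    ultimately show ?thesis by (simp add: A_def)
  qed
  have "h \<in> measurable unit_interval (count_space D)"
  proof (subst measurable_count_space_eq2[OF D], intro conjI ballI)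
    show "h \<in> space unit_interval \<rightarrow> D" using hD by auto
    fix d assume d: "d \<in> D"
    have "cell m t < m" for t using m by (simp add: cell_def)
    then have "h -` {d} \<inter> space unit_interval = (\<Union>i<m. {t\<in>{0..1}. cell m t = i \<and> h t = d})"
      by (auto simp: space_unit_interval)
    also have "\<dots> \<in> sets borel" using key[OF _ d] by (intro sets.finite_UN) auto
    finally show "h -` {d} \<inter> space unit_interval \<in> sets unit_interval"
      by (simp add: sets_unit_interval space_unit_interval)
  qed
  moreover have "{t\<in>space unit_interval. cell m t = i \<and> h t = d} \<in> sets unit_interval \<and>
      measure unit_interval {t\<in>space unit_interval. cell m t = i \<and> h t = d} = w d / m"
    if "i < m" "d \<in> D" for i d
  proof -
    have s: "{t\<in>{0..1}. cell m t = i \<and> h t = d} \<subseteq> {0..1}" by auto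
    show ?thesis unfolding space_unit_interval sets_unit_interval measure_unit_interval[OF s]
      using key[OF that] s by blast
  qed
  ultimately show ?thesis by blast
qed

lemma cell_measure:
  assumes m: "0 < m" and i: "i < m"
  shows "{t\<in>space unit_interval. cell m t = i} \<in> sets unit_interval"
    and "measure unit_interval {t\<in>space unit_interval. cell m t = i} = 1 / m"
proof -
  obtain h :: "real \<Rightarrow> unit" where "\<forall>i<m. \<forall>d\<in>{()}. {t\<in>space unit_interval. cell m t = i \<and> h t = d} \<in> sets unit_interval \<and>
      measure unit_interval {t\<in>space unit_interval. cell m t = i \<and> h t = d} = 1 / m"
    using unit_interval_split[OF m, of "{()}" "\<lambda>_. 1"] by auto
  from this[rule_format, OF i, of "()"]
  show "{t\<in>space unit_interval. cell m t = i} \<in> sets unit_interval"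
    "measure unit_interval {t\<in>space unit_interval. cell m t = i} = 1 / m" by simp_all
qed

lemma pmp_times_trivial:
  assumes b: "pmp_action G Y b"
  shows "pmp_action G (Y \<Otimes>\<^sub>M unit_interval) (times_trivial (space Y) {0..1} b)"
proof (rule pmp_actionI[OF pmp_actionD(2)[OF b]])
  let ?X = "Y \<Otimes>\<^sub>M unit_interval" and ?a = "times_trivial (space Y) {0..1} b"
  have sp: "space ?X = space Y \<times> {0..1}" by (simp add: space_pair_measure space_unit_interval)
  interpret U: prob_space unit_interval by (rule prob_space_unit_interval)
  interpret Y: prob_space Y using b by (rule pmp_actionD)
  interpret YU: pair_prob_space Y unit_interval ..
  show "prob_space ?X" by (rule YU.prob_space_axioms)
  fix g assume g: "g \<in> carrier G"
  have bg: "b g \<in> measurable Y Y" by (rule pmp_actionD(3)[OF b g])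
  show "?a g \<in> extensional (space ?X)" by (simp add: times_trivial_def sp)
  have m0: "(\<lambda>(y, t). (b g y, t)) \<in> measurable ?X ?X"
    using bg by (auto simp: case_prod_beta' intro!: measurable_Pair measurable_compose[OF measurable_fst])
  have cong: "?a g z = (\<lambda>(y, t). (b g y, t)) z" if "z \<in> space ?X" for z
    using that by (auto simp: times_trivial_def sp)
  have "?a g \<in> measurable ?X ?X \<longleftrightarrow> (\<lambda>(y, t). (b g y, t)) \<in> measurable ?X ?X"
    by (rule measurable_cong[OF cong])
  then show "?a g \<in> measurable ?X ?X" using m0 by simp
  have "distr ?X ?X (?a g) = distr ?X ?X (\<lambda>(y, t). (b g y, t))"
    by (rule distr_cong[OF refl refl cong])
  also have "\<dots> = ?X"
    using distr_pair_map_fst[OF U.prob_space_axioms bg] pmp_actionD(4)[OF b g] by simp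
  finally show "distr ?X ?X (?a g) = ?X" .
next
  fix x assume "x \<in> space (Y \<Otimes>\<^sub>M unit_interval)"
  then show "times_trivial (space Y) {0..1} b \<one>\<^bsub>G\<^esub> x = x"
    using pmp_actionD(6)[OF b] by (auto simp: times_trivial_def space_pair_measure space_unit_interval)
next
  fix g h x assume "g \<in> carrier G" "h \<in> carrier G" "x \<in> space (Y \<Otimes>\<^sub>M unit_interval)"
  then show "times_trivial (space Y) {0..1} b (g \<otimes>\<^bsub>G\<^esub> h) x =
      times_trivial (space Y) {0..1} b g (times_trivial (space Y) {0..1} b h x)"
    using pmp_actionD(7,8)[OF b] by (auto simp: times_trivial_def space_pair_measure space_unit_interval)
qed

section \<open>The completion times the unit interval\<close>

text \<open>Cutting each of \<open>m\<close> cells into \<open>m'\<close> parts gives the cells of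
  \<open>m * m'\<close>, so coarse cells are recovered by integer division. The truncations at the
  right end agree because \<open>(m * m' - 1) div m' = m - 1\<close>. This makes the levels of the
  product directed.\<close>

lemma cell_div:
  assumes m: "0 < m" "0 < m'" and t: "0 \<le> t"
  shows "cell m t = cell (m * m') t div m'"
proof -
  define n where "n = nat \<lfloor>real (m * m') * t\<rfloor>"
  have "\<lfloor>real m * t\<rfloor> = \<lfloor>real (m * m') * t / real_of_int (int m')\<rfloor>"
    using m by simp
  also have "\<dots> = \<lfloor>real (m * m') * t\<rfloor> div int m'" by (rule floor_divide_real_eq_div) simp
  finally have "nat \<lfloor>real m * t\<rfloor> = nat (\<lfloor>real (m * m') * t\<rfloor> div int m')" by simp
  also have "\<dots> = n div m'" using t by (simp add: n_def nat_div_distrib)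
  finally have 1: "nat \<lfloor>real m * t\<rfloor> = n div m'" .
  have "m' * (m - 1) + m' = m' * m" using m by (cases m) auto
  then have 2: "(m * m' - 1) div m' = m - 1"
    using m by (intro div_nat_eqI) (auto simp: mult.commute)
  have "min (n div m') (m - 1) = min n (m * m' - 1) div m'"
  proof (cases "n \<le> m * m' - 1")
    case True
    then have "n div m' \<le> (m * m' - 1) div m'" by (rule div_le_mono)
    then show ?thesis using True 2 by (simp add: min_def)
  next
    case False
    then have "(m * m' - 1) div m' \<le> n div m'" by (intro div_le_mono) simp
    then show ?thesis using False 2 by (simp add: min_def)
  qed
  then show ?thesis by (simp add: cell_def 1 n_def)
qed

context completion begin

abbreviation "X2 \<equiv> \<mu> \<Otimes>\<^sub>M unit_interval"

definition level2 :: "'g set \<Rightarrow> nat \<Rightarrow> ('g set \<Rightarrow> 'g set) \<times> real \<Rightarrow> 'g set \<times> nat" where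
  "level2 N m z = (fst z N, cell m (snd z))"

definition levels2 :: "((('g set \<Rightarrow> 'g set) \<times> real) \<Rightarrow> ('g set \<times> nat)) set" where
  "levels2 = {level2 N m | N m. N \<in> \<F> \<and> 0 < m}"

lemma levels2I: "N \<in> \<F> \<Longrightarrow> 0 < m \<Longrightarrow> level2 N m \<in> levels2"
  by (auto simp: levels2_def)

lemma space_X2: "z \<in> space X2 \<longleftrightarrow> fst z \<in> K \<and> snd z \<in> {0..1}"
  by (cases z) (simp add: space_pair_measure space_\<mu> space_unit_interval)

lemma prob_space_X2: "prob_space X2"
  using pmp_actionD(1)[OF pmp_times_trivial[OF pmp_left_translation]] .

lemma eval_set: "N \<in> \<F> \<Longrightarrow> {x\<in>space \<mu>. x N \<in> E} \<in> sets \<mu>"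
  using open_sets[OF open_cylinder] by (simp add: space_\<mu>)

lemma level2_event:
  assumes N: "N \<in> \<F>" and m: "0 < m" and i: "i < m"
  shows "{z\<in>space X2. level2 N m z = (C, i)} \<in> sets X2"
    and "measure X2 {z\<in>space X2. level2 N m z = (C, i)} = measure \<mu> {x\<in>space \<mu>. x N = C} / m"
proof -
  have eq: "{z\<in>space X2. level2 N m z = (C, i)} = {z\<in>space X2. fst z N = C \<and> cell m (snd z) = i}"
    by (auto simp: level2_def)
  have C: "{x\<in>space \<mu>. x N = C} \<in> sets \<mu>" using eval_set[OF N, of "{C}"] by simp
  note e = pair_measure_event[OF prob_space_\<mu> prob_space_unit_interval C cell_measure(1)[OF m i]]
  show "{z\<in>space X2. level2 N m z = (C, i)} \<in> sets X2" unfolding eq by (rule e(1))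
  show "measure X2 {z\<in>space X2. level2 N m z = (C, i)} = measure \<mu> {x\<in>space \<mu>. x N = C} / m"
    unfolding eq e(2) cell_measure(2)[OF m i] by simp
qed

lemma level2_measurable:
  assumes N: "N \<in> \<F>" and m: "0 < m"
  shows "level2 N m \<in> measurable X2 (count_space ((rcosets N) \<times> {..<m}))"
proof (subst measurable_count_space_eq2, simp add: fin_index_normalsD(2)[OF N], intro conjI ballI)
  show "level2 N m \<in> space X2 \<rightarrow> (rcosets N) \<times> {..<m}"
    using K_coset[OF _ N] m by (auto simp: level2_def space_X2 cell_def)
  fix j assume j: "j \<in> (rcosets N) \<times> {..<m}"
  obtain C i where Ci: "j = (C, i)" by (cases j)
  have "level2 N m -` {j} \<inter> space X2 = {z\<in>space X2. level2 N m z = (C, i)}" using Ci by auto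
  then show "level2 N m -` {j} \<inter> space X2 \<in> sets X2" using level2_event(1)[OF N m] j Ci by simp
qed

lemma level_family2: "level_family X2 levels2"
  unfolding level_family_def
proof (intro conjI ballI)
  show "levels2 \<noteq> {}" using carrier_in_F by (auto simp: levels2_def intro!: exI[of _ 1])
  fix l assume "l \<in> levels2"
  then obtain N m where N: "N \<in> \<F>" "0 < m" "l = level2 N m" by (auto simp: levels2_def)
  show "l \<in> measurable X2 (count_space UNIV)"
    unfolding N(3) by (rule measurable_compose[OF level2_measurable[OF N(1,2)]]) simp
  fix l' assume "l' \<in> levels2"
  then obtain N' m' where N': "N' \<in> \<F>" "0 < m'" "l' = level2 N' m'" by (auto simp: levels2_def)
  define u where "u = (\<lambda>(C, i::nat). (N <#> C, i div m'))"
  define u' where "u' = (\<lambda>(C, i::nat). (N' <#> C, i div m))"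
  have "l z = u (level2 (N \<inter> N') (m * m') z) \<and> l' z = u' (level2 (N \<inter> N') (m * m') z)" if "z \<in> space X2" for z
  proof -
    have x: "fst z \<in> K" "0 \<le> snd z" using that by (auto simp: space_X2)
    have "fst z N = N <#> fst z (N \<inter> N')" "fst z N' = N' <#> fst z (N \<inter> N')"
      using K_compat[OF x(1) Int_in_F[OF N(1) N'(1)] N(1)] K_compat[OF x(1) Int_in_F[OF N(1) N'(1)] N'(1)] by auto
    moreover have "cell m (snd z) = cell (m * m') (snd z) div m'" by (rule cell_div[OF N(2) N'(2) x(2)])
    moreover have "cell m' (snd z) = cell (m * m') (snd z) div m"
      using cell_div[OF N'(2) N(2) x(2)] by (simp add: mult.commute)
    ultimately show ?thesis by (simp add: N(3) N'(3) level2_def u_def u'_def)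
  qed
  then have *: "\<forall>z\<in>space X2. l z = u (level2 (N \<inter> N') (m * m') z) \<and> l' z = u' (level2 (N \<inter> N') (m * m') z)"
    by blast
  have "level2 (N \<inter> N') (m * m') \<in> levels2"
    by (rule levels2I[OF Int_in_F[OF N(1) N'(1)]]) (use N(2) N'(2) in simp)
  then show "\<exists>k\<in>levels2. \<exists>u u'. \<forall>z\<in>space X2. l z = u (k z) \<and> l' z = u' (k z)"
    by (rule bexI[rotated]) (rule exI[of _ u], rule exI[of _ u'], rule *)
qed

lemma approx_fst:
  assumes A: "A \<in> sets \<mu>" shows "approx_set X2 levels2 {z\<in>space X2. fst z \<in> A}"
  unfolding approx_set_def
proof (intro conjI allI impI)
  have ev: "{z\<in>space X2. fst z \<in> B} \<in> sets X2 \<and> measure X2 {z\<in>space X2. fst z \<in> B} = measure \<mu> B"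
    if B: "B \<in> sets \<mu>" for B
  proof -
    have B': "{x\<in>space \<mu>. x \<in> B} = B" using sets.sets_into_space[OF B] by auto
    show ?thesis
      using pair_measure_event_fst[OF prob_space_\<mu> prob_space_unit_interval, of "\<lambda>x. x \<in> B"] B
      unfolding B' by blast
  qed
  show "{z\<in>space X2. fst z \<in> A} \<in> sets X2" using ev[OF A] by blast
  fix e :: real assume e: "0 < e"
  obtain l E where l: "l \<in> levels" and E: "measure \<mu> (sym_diff A {x\<in>space \<mu>. l x \<in> E}) < e"
    by (rule approx_setE[OF approx_\<mu>[OF A] e])
  then obtain N where N: "N \<in> \<F>" "l = (\<lambda>x. x N)" by (auto simp: levels_def)
  have D: "sym_diff A {x\<in>space \<mu>. l x \<in> E} \<in> sets \<mu>"
    using A eval_set[OF N(1), of E] by (auto simp: N(2))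
  have "sym_diff {z\<in>space X2. fst z \<in> A} {z\<in>space X2. level2 N 1 z \<in> E \<times> UNIV} =
    {z\<in>space X2. fst z \<in> sym_diff A {x\<in>space \<mu>. l x \<in> E}}"
    by (auto simp: level2_def N(2) space_X2 space_\<mu>)
  then have "measure X2 (sym_diff {z\<in>space X2. fst z \<in> A} {z\<in>space X2. level2 N 1 z \<in> E \<times> UNIV}) < e"
    using ev[OF D] E by (simp only:)
  moreover have "level2 N 1 \<in> levels2"
    by (rule levels2I[OF N(1)]) simp
  ultimately show "\<exists>l\<in>levels2. \<exists>E. measure X2 (sym_diff {z\<in>space X2. fst z \<in> A} {z\<in>space X2. l z \<in> E}) < e"
    by (intro bexI[of _ "level2 N 1"] exI[of _ "E \<times> UNIV"])
qed

text \<open>By monotonicity of \<open>cell\<close>, comparing cell indices with that of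
  \<open>a\<close> can err only inside the cell of \<open>a\<close>, which has measure
  \<open>1 / m\<close>.\<close>

lemma approx_snd_atMost:
  "approx_set X2 levels2 {z\<in>space X2. snd z \<in> {..a}}"
  unfolding approx_set_def
proof (intro conjI allI impI)
  interpret X2: prob_space X2 by (rule prob_space_X2)
  have "{t\<in>space unit_interval. t \<in> {..a}} \<in> sets unit_interval"
  proof -
    have "{t\<in>space unit_interval. t \<in> {..a}} = {0..1} \<inter> {..a}" by (auto simp: space_unit_interval)
    then show ?thesis by (simp add: sets_unit_interval)
  qed
  then show "{z\<in>space X2. snd z \<in> {..a}} \<in> sets X2"
    by (rule pair_measure_event_snd(1)[OF prob_space_\<mu> prob_space_unit_interval])
  fix e :: real assume e: "0 < e"
  obtain n where n: "1 / real (Suc n) < e" using nat_approx_posE[OF e] by auto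
  define m where "m = Suc n"
  have m: "0 < m" "1 / real m < e" using n by (simp_all add: m_def)
  define i where "i = cell m a"
  have i: "i < m" using m by (simp add: i_def cell_def)
  have N: "carrier G \<in> \<F>" by (rule carrier_in_F)
  let ?E = "{p. snd p \<le> i}"
  have B: "{z\<in>space X2. cell m (snd z) = i} \<in> sets X2 \<and> measure X2 {z\<in>space X2. cell m (snd z) = i} = 1 / m"
    using pair_measure_event_snd[OF prob_space_\<mu> prob_space_unit_interval cell_measure(1)[OF m(1) i]]
    unfolding cell_measure(2)[OF m(1) i] by blast
  have "sym_diff {z\<in>space X2. snd z \<in> {..a}} {z\<in>space X2. level2 (carrier G) m z \<in> ?E} \<subseteq>
      {z\<in>space X2. cell m (snd z) = i}"
  proof
    fix z assume z: "z \<in> sym_diff {z\<in>space X2. snd z \<in> {..a}} {z\<in>space X2. level2 (carrier G) m z \<in> ?E}"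
    have "snd z \<le> a \<Longrightarrow> cell m (snd z) \<le> i" unfolding i_def by (rule cell_mono)
    moreover have "a \<le> snd z \<Longrightarrow> i \<le> cell m (snd z)" unfolding i_def by (rule cell_mono)
    ultimately show "z \<in> {z\<in>space X2. cell m (snd z) = i}" using z by (auto simp: level2_def)
  qed
  from X2.finite_measure_mono[OF this conjunct1[OF B]]
  have "measure X2 (sym_diff {z\<in>space X2. snd z \<in> {..a}} {z\<in>space X2. level2 (carrier G) m z \<in> ?E}) \<le> 1 / m"
    unfolding conjunct2[OF B] .
  moreover have "level2 (carrier G) m \<in> levels2"
    by (rule levels2I[OF N m(1)])
  ultimately show "\<exists>l\<in>levels2. \<exists>E. measure X2 (sym_diff {z\<in>space X2. snd z \<in> {..a}} {z\<in>space X2. l z \<in> E}) < e"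
    using m(2) by (intro bexI[of _ "level2 (carrier G) m"] exI[of _ ?E]) simp_all
qed

lemma approx_snd:
  assumes B: "B \<in> sets unit_interval" shows "approx_set X2 levels2 {z\<in>space X2. snd z \<in> B}"
proof -
  interpret X2: prob_space X2 by (rule prob_space_X2)
  have "B \<in> sets borel" using B by (simp add: sets_unit_interval)
  also have "sets borel = sigma_sets UNIV (range (\<lambda>a::real. {..a}))" by (simp add: borel_eq_atMost)
  finally show ?thesis
  proof induction
    case (Basic a) then show ?case using approx_snd_atMost by auto
  next
    case Empty
    then show ?case using X2.approx_set_sigma_sets[OF level_family2, of "{}" "{}"] sigma_sets.Empty by auto
  next
    case (Compl a)
    have "{z\<in>space X2. snd z \<in> UNIV - a} = space X2 - {z\<in>space X2. snd z \<in> a}" by auto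
    then show ?case using X2.approx_set_Diff[OF level_family2 Compl.IH] by (simp only:)
  next
    case (Union a)
    have "{z\<in>space X2. snd z \<in> \<Union>(range a)} = (\<Union>i. {z\<in>space X2. snd z \<in> a i})" by auto
    then show ?case using X2.approx_set_UN[OF level_family2 Union.IH] by (simp only:)
  qed
qed

lemma approx_X2:
  assumes A: "A \<in> sets X2" shows "approx_set X2 levels2 A"
proof -
  interpret X2: prob_space X2 by (rule prob_space_X2)
  have A': "A \<in> sigma_sets (space X2) {a \<times> b | a b. a \<in> sets \<mu> \<and> b \<in> sets unit_interval}"
    using A by (simp add: sets_pair_measure space_pair_measure)
  show ?thesis
  proof (rule X2.approx_set_sigma_sets[OF level_family2 _ A'])
    fix R assume "R \<in> {a \<times> b | a b. a \<in> sets \<mu> \<and> b \<in> sets unit_interval}"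
    then obtain a b where ab: "a \<in> sets \<mu>" "b \<in> sets unit_interval" "R = a \<times> b" by auto
    have sub: "a \<subseteq> space \<mu>" "b \<subseteq> space unit_interval"
      using sets.sets_into_space[OF ab(1)] sets.sets_into_space[OF ab(2)] by auto
    let ?a = "{z\<in>space X2. fst z \<in> a}" and ?b = "{z\<in>space X2. snd z \<in> b}"
    \<comment> \<open>A rectangle is the intersection of two strips, written with complements and a
      union because these are the closure properties at hand.\<close>
    have "R = space X2 - ((space X2 - ?a) \<union> (space X2 - ?b))"
      using sub by (auto simp: ab(3) space_pair_measure)
    moreover have "approx_set X2 levels2 (space X2 - ((space X2 - ?a) \<union> (space X2 - ?b)))"
      by (intro X2.approx_set_Diff X2.approx_set_Un level_family2 approx_fst approx_snd ab)
    ultimately show "approx_set X2 levels2 R" by (simp only:)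
  qed
qed

text \<open>Translations permute the cosets transitively, so all of them have the same measure.
  Positivity is what allows conditioning on the fibres of a level.\<close>

lemma coset_measure:
  assumes N: "N \<in> \<F>" and C: "C \<in> rcosets N"
  shows "measure \<mu> {x\<in>space \<mu>. x N = C} = 1 / card (rcosets N)" "0 < measure \<mu> {x\<in>space \<mu>. x N = C}"
proof -
  have w: "weights G (rcosets N) (coset_act N) (\<lambda>C. measure \<mu> {x\<in>space \<mu>. x N = C})"
    by (rule equivariant_weights[OF pmp_left_translation gset_coset_act[OF N] eval_measurable[OF N]])
       (simp add: left_translation_apply[OF _ _ N] space_\<mu>)
  show 1: "measure \<mu> {x\<in>space \<mu>. x N = C} = 1 / card (rcosets N)"
    by (rule transitive_weights[OF gset_coset_act[OF N] w coset_act_trans[OF N] C])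
  have "card (rcosets N) > 0" using C fin_index_normalsD(2)[OF N] by (auto simp: card_gt_0_iff)
  then show "0 < measure \<mu> {x\<in>space \<mu>. x N = C}" by (simp add: 1)
qed

lemma coset_apply_closed:
  assumes D: "gset G D c" and B: "B \<in> rcosets (ker_act G D c)" and d: "d \<in> D"
  shows "coset_apply c B d \<in> D"
proof -
  obtain g where "g \<in> carrier G" "B = ker_act G D c #> g" using B by (rule rcosetsE)
  then show ?thesis using coset_apply_rcos[OF D _ d] gsetD(2)[OF D _ d] by simp
qed

lemma coset_apply_act:
  assumes D: "gset G D c" and B: "B \<in> rcosets (ker_act G D c)" and d: "d \<in> D" and g: "g \<in> carrier G"
  shows "coset_apply c (coset_act (ker_act G D c) g B) d = c g (coset_apply c B d)"
proof -
  obtain h where h: "h \<in> carrier G" "B = ker_act G D c #> h" using B by (rule rcosetsE)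
  then show ?thesis
    using coset_apply_rcos[OF D _ d] gsetD(4)[OF D g h(1) d] g
      coset_act_rcos[OF ker_act_fin_index[OF D] g h(1)] by simp
qed

lemma coset_apply_sets:
  assumes D: "gset G D c" and Q: "{x\<in>space \<mu>. Q x} \<in> sets \<mu>"
  shows "{x\<in>space \<mu>. Q x \<and> coset_apply c (x (ker_act G D c)) d' = d} \<in> sets \<mu>"
proof -
  have L: "ker_act G D c \<in> \<F>" by (rule ker_act_fin_index[OF D])
  have "{x\<in>space \<mu>. Q x} \<inter> {x\<in>space \<mu>. x (ker_act G D c) \<in> {B. coset_apply c B d' = d}} \<in> sets \<mu>"
    using Q eval_set[OF L] by (rule sets.Int)
  also have "{x\<in>space \<mu>. Q x} \<inter> {x\<in>space \<mu>. x (ker_act G D c) \<in> {B. coset_apply c B d' = d}} =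
    {x\<in>space \<mu>. Q x \<and> coset_apply c (x (ker_act G D c)) d' = d}" by auto
  finally show ?thesis .
qed

text \<open>Since \<open>w\<close> is invariant, applying a fixed element of the completion to a \<open>w\<close>-random point
  of \<open>D\<close> gives again a \<open>w\<close>-random point.\<close>

lemma coset_apply_sum:
  assumes D: "gset G D c" and w: "weights G D c w" and Q: "{x\<in>space \<mu>. Q x} \<in> sets \<mu>" and d: "d \<in> D"
  shows "(\<Sum>d'\<in>D. w d' * measure \<mu> {x\<in>space \<mu>. Q x \<and> coset_apply c (x (ker_act G D c)) d' = d}) =
    w d * measure \<mu> {x\<in>space \<mu>. Q x}"
proof -
  define L where "L = ker_act G D c"
  interpret \<mu>: prob_space \<mu> by (rule prob_space_\<mu>)
  have L: "L \<in> \<F>" unfolding L_def by (rule ker_act_fin_index[OF D])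
  note fm = \<mu>.finite_measure_axioms and em = eval_measurable[OF L] and fL = fin_index_normalsD(2)[OF L]
  have Qc: "{x\<in>space \<mu>. coset_apply c B d' = d \<and> Q x} \<in> sets \<mu>" for B d'
    using Q by (cases "coset_apply c B d' = d") simp_all
  have 1: "measure \<mu> {x\<in>space \<mu>. Q x \<and> coset_apply c (x L) d' = d} =
    (\<Sum>B\<in>rcosets L. if coset_apply c B d' = d then measure \<mu> {x\<in>space \<mu>. x L = B \<and> Q x} else 0)" for d'
  proof -
    have "measure \<mu> {x\<in>space \<mu>. coset_apply c (x L) d' = d \<and> Q x} =
      (\<Sum>B\<in>rcosets L. measure \<mu> {x\<in>space \<mu>. x L = B \<and> coset_apply c B d' = d \<and> Q x})"
      by (rule measure_split(1)[OF fm em fL, of "\<lambda>B x. coset_apply c B d' = d \<and> Q x", OF Qc])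
    also have "\<dots> = (\<Sum>B\<in>rcosets L. if coset_apply c B d' = d then measure \<mu> {x\<in>space \<mu>. x L = B \<and> Q x} else 0)"
      by (rule sum.cong) auto
    finally show ?thesis by (simp only: conj_commute)
  qed
  have 2: "(\<Sum>d'\<in>D. w d' * (if coset_apply c B d' = d then q else 0)) = w d * q"
    if B: "B \<in> rcosets L" for B and q :: real
  proof -
    obtain g where g: "g \<in> carrier G" "B = L #> g" using B by (rule rcosetsE)
    have "(\<Sum>d'\<in>D. w d' * (if coset_apply c B d' = d then q else 0)) =
      (\<Sum>d'\<in>D. if c g d' = d then w d' * q else 0)"
      by (rule sum.cong) (use coset_apply_rcos[OF D g(1)] g in \<open>auto simp: L_def\<close>)
    also have "\<dots> = (\<Sum>d' | d' \<in> D \<and> c g d' = d. w d' * q)"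
      using gsetD(1)[OF D] by (simp add: sum.inter_filter)
    also have "\<dots> = (\<Sum>d' | d' \<in> D \<and> c g d' = d. w d') * q" by (simp add: sum_distrib_right)
    also have "(\<Sum>d' | d' \<in> D \<and> c g d' = d. w d') = (\<Sum>d' | d' \<in> D \<and> d' = d. w d')"
      by (rule weights_sum_translate[OF is_group D w g(1)])
    also have "{d'. d' \<in> D \<and> d' = d} = {d}" using d by auto
    finally show ?thesis by simp
  qed
  have "(\<Sum>d'\<in>D. w d' * measure \<mu> {x\<in>space \<mu>. Q x \<and> coset_apply c (x L) d' = d}) =
    (\<Sum>d'\<in>D. \<Sum>B\<in>rcosets L. w d' * (if coset_apply c B d' = d then measure \<mu> {x\<in>space \<mu>. x L = B \<and> Q x} else 0))"
    unfolding 1 sum_distrib_left ..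
  also have "\<dots> = (\<Sum>B\<in>rcosets L. \<Sum>d'\<in>D. w d' * (if coset_apply c B d' = d then measure \<mu> {x\<in>space \<mu>. x L = B \<and> Q x} else 0))"
    by (rule sum.swap)
  also have "\<dots> = (\<Sum>B\<in>rcosets L. w d * measure \<mu> {x\<in>space \<mu>. x L = B \<and> Q x})"
    by (rule sum.cong[OF refl 2])
  also have "\<dots> = w d * (\<Sum>B\<in>rcosets L. measure \<mu> {x\<in>space \<mu>. x L = B \<and> Q x})"
    by (simp add: sum_distrib_left)
  also have "(\<Sum>B\<in>rcosets L. measure \<mu> {x\<in>space \<mu>. x L = B \<and> Q x}) = measure \<mu> {x\<in>space \<mu>. Q x}"
    by (rule measure_split(1)[OF fm em fL, of "\<lambda>_. Q", OF Q, symmetric])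
  finally show ?thesis by (simp only: L_def)
qed

text \<open>With \<open>h\<close> a random point of \<open>D\<close> independent of the cell,
  \<open>\<eta> (x, t)\<close> lets \<open>x\<close> act on \<open>h t\<close>. The group moves
  \<open>x\<close> and fixes \<open>t\<close>, so \<open>\<eta>\<close> is equivariant at every
  point. Given \<open>x\<close>, invariance of the weights gives \<open>\<eta>\<close> the law
  \<open>w\<close> again, whence exact independence of the coset and of the cell.\<close>

lemma randomize_X2:
  assumes D: "gset G D c" and w: "weights G D c w" and N: "N \<in> \<F>" and m: "0 < m" and S: "S \<subseteq> carrier G"
  shows "\<exists>\<eta>\<in>measurable X2 (count_space D).
    measure X2 {z\<in>space X2. \<exists>s\<in>S. \<eta> (times_trivial K {0..1} (left_translation G) (inv s) z) \<noteq> c (inv s) (\<eta> z)} = 0 \<and>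
    (\<forall>j\<in>(rcosets N) \<times> {..<m}. \<forall>d\<in>D. measure X2 {z\<in>space X2. level2 N m z = j \<and> \<eta> z = d} =
      measure X2 {z\<in>space X2. level2 N m z = j} * w d)"
proof -
  define L where "L = ker_act G D c"
  interpret X2: prob_space X2 by (rule prob_space_X2)
  have L: "L \<in> \<F>" unfolding L_def by (rule ker_act_fin_index[OF D])
  have fD: "finite D" by (rule gsetD(1)[OF D])
  obtain h where h: "h \<in> measurable unit_interval (count_space D)"
    and hs: "\<forall>i<m. \<forall>d\<in>D. {t\<in>space unit_interval. cell m t = i \<and> h t = d} \<in> sets unit_interval \<and>
      measure unit_interval {t\<in>space unit_interval. cell m t = i \<and> h t = d} = w d / m"
  proof -
    have "0 \<le> w d" if "d \<in> D" for d using w that by (simp add: weights_def)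
    moreover have "sum w D = 1" using w by (simp add: weights_def)
    ultimately have "\<exists>h\<in>measurable unit_interval (count_space D).
      \<forall>i<m. \<forall>d\<in>D. {t\<in>space unit_interval. cell m t = i \<and> h t = d} \<in> sets unit_interval \<and>
        measure unit_interval {t\<in>space unit_interval. cell m t = i \<and> h t = d} = w d / m"
      by (rule unit_interval_split[OF m fD])
    then show ?thesis by (elim bexE) (rule that)
  qed
  define \<eta> where "\<eta> z = coset_apply c (fst z L) (h (snd z))" for z :: "('g set \<Rightarrow> 'g set) \<times> real"
  have hm: "(\<lambda>z. h (snd z)) \<in> measurable X2 (count_space D)"
    by (rule measurable_compose[OF measurable_snd h])
  have hD: "h (snd z) \<in> D" if "z \<in> space X2" for z using measurable_space[OF hm that] by simp
  have fst_set: "{z\<in>space X2. fst z L \<in> E} \<in> sets X2" for E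
    by (rule pair_measure_event_fst(1)[OF prob_space_\<mu> prob_space_unit_interval eval_set[OF L]])
  have \<eta>m: "\<eta> \<in> measurable X2 (count_space D)"
  proof (subst measurable_count_space_eq2[OF fD], intro conjI ballI)
    show "\<eta> \<in> space X2 \<rightarrow> D"
      using coset_apply_closed[OF D] K_coset[OF _ L] hD by (auto simp: \<eta>_def L_def space_X2)
    fix d
    have "{z\<in>space X2. coset_apply c (fst z L) d' = d} \<in> sets X2" for d'
      using fst_set[of "{B. coset_apply c B d' = d}"] by (simp only: mem_Collect_eq)
    then have "{z\<in>space X2. coset_apply c (fst z L) (h (snd z)) = d} \<in> sets X2"
      by (rule measure_split(2)[OF X2.finite_measure_axioms hm fD, of "\<lambda>d' z. coset_apply c (fst z L) d' = d"])
    also have "{z\<in>space X2. coset_apply c (fst z L) (h (snd z)) = d} = \<eta> -` {d} \<inter> space X2"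
      by (auto simp: \<eta>_def)
    finally show "\<eta> -` {d} \<inter> space X2 \<in> sets X2" .
  qed
  have "\<eta> (times_trivial K {0..1} (left_translation G) g z) = c g (\<eta> z)"
    if g: "g \<in> carrier G" and z: "z \<in> space X2" for g z
  proof -
    have z': "fst z \<in> K" "snd z \<in> {0..1}" using z by (auto simp: space_X2)
    have "times_trivial K {0..1} (left_translation G) g z = (left_translation G g (fst z), snd z)"
      using z' by (auto simp: times_trivial_def case_prod_beta' mem_Times_iff)
    then show ?thesis
      using left_translation_apply[OF g z'(1) L] coset_apply_act[OF D _ hD[OF z] g] K_coset[OF z'(1) L]
      by (simp add: \<eta>_def L_def)
  qed
  then have "{z\<in>space X2. \<exists>s\<in>S. \<eta> (times_trivial K {0..1} (left_translation G) (inv s) z) \<noteq> c (inv s) (\<eta> z)} = {}"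
    using S by auto
  then have bad: "measure X2 {z\<in>space X2. \<exists>s\<in>S. \<eta> (times_trivial K {0..1} (left_translation G) (inv s) z) \<noteq> c (inv s) (\<eta> z)} = 0"
    by (simp only: measure_empty)
  have ind: "measure X2 {z\<in>space X2. level2 N m z = j \<and> \<eta> z = d} =
      measure X2 {z\<in>space X2. level2 N m z = j} * w d"
    if j: "j \<in> (rcosets N) \<times> {..<m}" and d: "d \<in> D" for j d
  proof -
    obtain C i where Ci: "j = (C, i)" "i < m" using j by auto
    have Cs: "{x\<in>space \<mu>. x N = C} \<in> sets \<mu>" using eval_set[OF N, of "{C}"] by simp
    have ev: "{z\<in>space X2. (fst z N = C \<and> coset_apply c (fst z L) d' = d) \<and> (cell m (snd z) = i \<and> h (snd z) = d')} \<in> sets X2 \<and>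
      measure X2 {z\<in>space X2. (fst z N = C \<and> coset_apply c (fst z L) d' = d) \<and> (cell m (snd z) = i \<and> h (snd z) = d')} =
        measure \<mu> {x\<in>space \<mu>. x N = C \<and> coset_apply c (x L) d' = d} * (w d' / m)" if d': "d' \<in> D" for d'
    proof -
      have s: "{x\<in>space \<mu>. x N = C \<and> coset_apply c (x L) d' = d} \<in> sets \<mu>"
        unfolding L_def by (rule coset_apply_sets[OF D Cs])
      note hh = hs[rule_format, OF Ci(2) d']
      show ?thesis
        using pair_measure_event[OF prob_space_\<mu> prob_space_unit_interval s conjunct1[OF hh]] conjunct2[OF hh] by simp
    qed
    have lv: "{z\<in>space X2. level2 N m z = j \<and> coset_apply c (fst z L) d' = d} \<in> sets X2" for d'
    proof -
      have "{z\<in>space X2. level2 N m z = j} \<inter> {z\<in>space X2. fst z L \<in> {B. coset_apply c B d' = d}} \<in> sets X2"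
        unfolding Ci(1) using level2_event(1)[OF N m Ci(2)] fst_set by (rule sets.Int)
      also have "{z\<in>space X2. level2 N m z = j} \<inter> {z\<in>space X2. fst z L \<in> {B. coset_apply c B d' = d}} =
        {z\<in>space X2. level2 N m z = j \<and> coset_apply c (fst z L) d' = d}" by auto
      finally show ?thesis .
    qed
    \<comment> \<open>Splitting by the value \<open>d'\<close> of \<open>h\<close> separates the two
      factors: what remains is a condition on \<open>x\<close> alone and a condition on
      \<open>t\<close> alone.\<close>
    have "measure X2 {z\<in>space X2. level2 N m z = j \<and> coset_apply c (fst z L) (h (snd z)) = d} =
      (\<Sum>d'\<in>D. measure X2 {z\<in>space X2. h (snd z) = d' \<and> level2 N m z = j \<and> coset_apply c (fst z L) d' = d})"
      by (rule measure_split(1)[OF X2.finite_measure_axioms hm fD,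
            of "\<lambda>d' z. level2 N m z = j \<and> coset_apply c (fst z L) d' = d", OF lv])
    also have "\<dots> = (\<Sum>d'\<in>D. measure \<mu> {x\<in>space \<mu>. x N = C \<and> coset_apply c (x L) d' = d} * (w d' / m))"
    proof (rule sum.cong[OF refl])
      fix d' assume d': "d' \<in> D"
      have "{z\<in>space X2. h (snd z) = d' \<and> level2 N m z = j \<and> coset_apply c (fst z L) d' = d} =
        {z\<in>space X2. (fst z N = C \<and> coset_apply c (fst z L) d' = d) \<and> (cell m (snd z) = i \<and> h (snd z) = d')}"
        by (auto simp: level2_def Ci)
      then show "measure X2 {z\<in>space X2. h (snd z) = d' \<and> level2 N m z = j \<and> coset_apply c (fst z L) d' = d} =
        measure \<mu> {x\<in>space \<mu>. x N = C \<and> coset_apply c (x L) d' = d} * (w d' / m)"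
        using conjunct2[OF ev[OF d']] by (simp only:)
    qed
    also have "\<dots> = (\<Sum>d'\<in>D. w d' * measure \<mu> {x\<in>space \<mu>. x N = C \<and> coset_apply c (x L) d' = d}) / m"
      unfolding sum_divide_distrib by (rule sum.cong) simp_all
    also have "\<dots> = w d * measure \<mu> {x\<in>space \<mu>. x N = C} / m"
      unfolding L_def coset_apply_sum[OF D w Cs d] ..
    also have "\<dots> = measure X2 {z\<in>space X2. level2 N m z = j} * w d"
      unfolding Ci(1) level2_event(2)[OF N m Ci(2)] by simp
    finally show ?thesis by (simp only: \<eta>_def)
  qed
  show ?thesis by (intro bexI[OF _ \<eta>m] conjI ballI bad ind)
qed

end

section \<open>Almost independent equivariant maps under EMD\<close>

text \<open>Bessel's inequality for the nearly orthogonal functions \<open>1\<^bsub>H k\<^esub> - v\<close>, tested against \<open>1\<^sub>Z\<close>.\<close>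

lemma (in prob_space) almost_independent_bessel:
  fixes n :: nat and v \<delta> :: real
  assumes Z: "Z \<in> events" and H: "\<And>k. k < n \<Longrightarrow> H k \<in> events"
    and v: "0 \<le> v" "v \<le> 1" and \<delta>: "0 \<le> \<delta>"
    and P1: "\<And>k. k < n \<Longrightarrow> \<bar>prob (H k) - v\<bar> \<le> \<delta>"
    and P2: "\<And>k k'. k < n \<Longrightarrow> k' < n \<Longrightarrow> k \<noteq> k' \<Longrightarrow> \<bar>prob (H k \<inter> H k') - v * v\<bar> \<le> \<delta>"
  shows "(\<Sum>k<n. \<bar>prob (Z \<inter> H k) - prob Z * v\<bar>)\<^sup>2 \<le> n + 3 * (real n)\<^sup>2 * \<delta>"
proof -
  define c where "c k = prob (Z \<inter> H k) - prob Z * v" for k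
  define g where "g k x = indicator (H k) x - v" for k x
  \<comment> \<open>The signs are chosen so that the integral of \<open>T\<close> over
    \<open>Z\<close> is the sum of the absolute correlations \<open>\<bar>c k\<bar>\<close>.\<close>
  define T where "T x = (\<Sum>k<n. sgn (c k) * g k x)" for x
  define X where "X x = indicator Z x * T x" for x
  have gm: "g k \<in> borel_measurable M" if "k < n" for k
    unfolding g_def[abs_def] using H[OF that] by measurable
  have gb: "\<bar>g k x\<bar> \<le> 1" for k x using v by (auto simp: g_def indicator_def)
  have Tm: "T \<in> borel_measurable M"
    unfolding T_def[abs_def] using gm by (intro borel_measurable_sum borel_measurable_times) auto
  have Tb: "\<bar>T x\<bar> \<le> n" for x
  proof -
    have "\<bar>T x\<bar> \<le> (\<Sum>k<n. \<bar>sgn (c k) * g k x\<bar>)" unfolding T_def by (rule sum_abs)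
    also have "\<dots> \<le> (\<Sum>k<n. 1)"
    proof (rule sum_mono)
      fix k
      have "\<bar>sgn (c k)\<bar> * \<bar>g k x\<bar> \<le> 1 * 1" using gb by (intro mult_mono) (auto simp: sgn_if)
      then show "\<bar>sgn (c k) * g k x\<bar> \<le> 1" by (simp add: abs_mult)
    qed
    finally show ?thesis by simp
  qed
  have Xm: "X \<in> borel_measurable M" unfolding X_def[abs_def] using Z Tm by measurable
  have Xb: "\<bar>X x\<bar> \<le> n" for x using Tb[of x] by (auto simp: X_def indicator_def)
  have sq: "y\<^sup>2 \<le> (real n)\<^sup>2" if "\<bar>y\<bar> \<le> real n" for y :: real
    using that by (simp add: abs_le_square_iff[symmetric])
  have Xi: "integrable M X" by (rule integrable_const_bound[of _ "real n"]) (use Xb Xm in auto)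
  have X2i: "integrable M (\<lambda>x. (X x)\<^sup>2)"
    by (rule integrable_const_bound[of _ "(real n)\<^sup>2"]) (use sq[OF Xb] Xm in auto)
  have T2i: "integrable M (\<lambda>x. (T x)\<^sup>2)"
    by (rule integrable_const_bound[of _ "(real n)\<^sup>2"]) (use sq[OF Tb] Tm in auto)
  have EX: "expectation X = (\<Sum>k<n. \<bar>c k\<bar>)"
  proof -
    have "expectation X = expectation (\<lambda>x. \<Sum>k<n. sgn (c k) * (indicator (Z \<inter> H k) x - v * indicator Z x))"
      by (rule Bochner_Integration.integral_cong)
        (auto simp: X_def T_def g_def sum_distrib_left indicator_def intro!: sum.cong)
    also have "\<dots> = (\<Sum>k<n. expectation (\<lambda>x. sgn (c k) * (indicator (Z \<inter> H k) x - v * indicator Z x)))"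
      by (rule Bochner_Integration.integral_sum) (use Z H in \<open>auto simp: emeasure_eq_measure\<close>)
    also have "\<dots> = (\<Sum>k<n. \<bar>c k\<bar>)"
    proof (rule sum.cong[OF refl])
      fix k assume "k \<in> {..<n}"
      then have k: "k < n" by simp
      have i: "integrable M (indicator (Z \<inter> H k) :: 'a \<Rightarrow> real)" "integrable M (\<lambda>x. v * indicator Z x)"
        using Z H[OF k] by (auto simp: emeasure_eq_measure)
      have "expectation (\<lambda>x. sgn (c k) * (indicator (Z \<inter> H k) x - v * indicator Z x)) =
        sgn (c k) * (prob (Z \<inter> H k) - v * prob Z)"
        using i Z H[OF k] by (simp add: Bochner_Integration.integral_diff)
      also have "\<dots> = \<bar>c k\<bar>" by (simp add: c_def mult.commute[of v] linordered_idom_class.abs_sgn)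
      finally show "expectation (\<lambda>x. sgn (c k) * (indicator (Z \<inter> H k) x - v * indicator Z x)) = \<bar>c k\<bar>" .
    qed
    finally show ?thesis .
  qed
  have gg: "expectation (\<lambda>x. g k x * g k' x) = prob (H k \<inter> H k') - v * prob (H k) - v * prob (H k') + v * v"
    and ggi: "integrable M (\<lambda>x. g k x * g k' x)" if k: "k < n" "k' < n" for k k'
  proof -
    have eq: "g k x * g k' x = indicator (H k \<inter> H k') x - v * indicator (H k) x - v * indicator (H k') x + v * v" for x
      by (cases "x \<in> H k"; cases "x \<in> H k'") (simp_all add: g_def algebra_simps)
    have i: "integrable M (indicator (H k \<inter> H k') :: 'a \<Rightarrow> real)" "integrable M (\<lambda>x. v * indicator (H k) x)"
      "integrable M (\<lambda>x. v * indicator (H k') x)" "integrable M (\<lambda>x. v * v)"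
      using H[OF k(1)] H[OF k(2)] by (auto simp: emeasure_eq_measure)
    show "integrable M (\<lambda>x. g k x * g k' x)"
      unfolding eq using i by (intro Bochner_Integration.integrable_add Bochner_Integration.integrable_diff)
    show "expectation (\<lambda>x. g k x * g k' x) = prob (H k \<inter> H k') - v * prob (H k) - v * prob (H k') + v * v"
      unfolding eq using i H[OF k(1)] H[OF k(2)] by (simp add: prob_space)
  qed
  \<comment> \<open>Diagonal terms are bounded trivially, since
    \<open>\<bar>g k x\<bar> \<le> 1\<close>. Off the diagonal the expectation is the pair error
    minus \<open>v\<close> times the two single errors, hence at most three times
    \<open>\<delta>\<close>. Summation over all pairs gives
    \<open>n + 3 * n * n * \<delta>\<close>.\<close>
  have ggb: "\<bar>expectation (\<lambda>x. g k x * g k' x)\<bar> \<le> (if k = k' then 1 else 3 * \<delta>)" if k: "k < n" "k' < n" for k k'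
  proof (cases "k = k'")
    case True
    have "\<bar>expectation (\<lambda>x. g k x * g k' x)\<bar> \<le> expectation (\<lambda>x. \<bar>g k x * g k' x\<bar>)"
      by (rule integral_abs_bound)
    also have "\<dots> \<le> expectation (\<lambda>x. 1)"
    proof (rule integral_mono)
      show "integrable M (\<lambda>x. \<bar>g k x * g k' x\<bar>)" using ggi[OF k] by (rule integrable_abs)
      fix x
      have "\<bar>g k x\<bar> * \<bar>g k' x\<bar> \<le> 1 * 1" using gb by (intro mult_mono) auto
      then show "\<bar>g k x * g k' x\<bar> \<le> 1" by (simp add: abs_mult)
    qed simp
    finally show ?thesis using True by (simp add: prob_space)
  next
    case False
    have vb: "\<bar>v * (prob (H j) - v)\<bar> \<le> \<delta>" if "j < n" for j
    proof -
      have "\<bar>v * (prob (H j) - v)\<bar> \<le> 1 * \<bar>prob (H j) - v\<bar>"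
        unfolding abs_mult using v by (intro mult_right_mono) auto
      then show ?thesis using P1[OF that] by simp
    qed
    have "prob (H k \<inter> H k') - v * prob (H k) - v * prob (H k') + v * v =
      (prob (H k \<inter> H k') - v * v) - v * (prob (H k) - v) - v * (prob (H k') - v)"
      by (simp add: algebra_simps)
    then show ?thesis using gg[OF k] P2[OF k False] vb[OF k(1)] vb[OF k(2)] False by (simp only: if_False)
  qed
  have ET: "expectation (\<lambda>x. (T x)\<^sup>2) \<le> n + 3 * (real n)\<^sup>2 * \<delta>"
  proof -
    have "expectation (\<lambda>x. (T x)\<^sup>2) = expectation (\<lambda>x. \<Sum>k<n. \<Sum>k'<n. sgn (c k) * sgn (c k') * (g k x * g k' x))"
      by (rule Bochner_Integration.integral_cong)
        (auto simp: T_def power2_eq_square sum_product intro!: sum.cong)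
    also have "\<dots> = (\<Sum>k<n. \<Sum>k'<n. sgn (c k) * sgn (c k') * expectation (\<lambda>x. g k x * g k' x))"
      using ggi by (subst Bochner_Integration.integral_sum; (intro Bochner_Integration.integrable_sum integrable_mult_right)?)
        (auto intro!: sum.cong simp: Bochner_Integration.integral_sum)
    also have "\<dots> \<le> (\<Sum>k<n. \<Sum>k'<n. (if k = k' then 1 else 0) + 3 * \<delta>)"
    proof (intro sum_mono)
      fix k k' assume "k \<in> {..<n}" "k' \<in> {..<n}"
      then have k: "k < n" "k' < n" by auto
      have "sgn (c k) * sgn (c k') * expectation (\<lambda>x. g k x * g k' x) \<le> \<bar>sgn (c k) * sgn (c k') * expectation (\<lambda>x. g k x * g k' x)\<bar>"
        by (rule abs_ge_self)
      also have "\<dots> \<le> 1 * \<bar>expectation (\<lambda>x. g k x * g k' x)\<bar>"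
        unfolding abs_mult[of "sgn (c k) * sgn (c k')"] by (intro mult_right_mono) (auto simp: sgn_if)
      also have "\<dots> \<le> (if k = k' then 1 else 0) + 3 * \<delta>" using ggb[OF k] \<delta> by (auto split: if_splits)
      finally show "sgn (c k) * sgn (c k') * expectation (\<lambda>x. g k x * g k' x) \<le> (if k = k' then 1 else 0) + 3 * \<delta>" .
    qed
    also have "\<dots> = n + 3 * (real n)\<^sup>2 * \<delta>"
      by (simp add: sum.distrib power2_eq_square algebra_simps)
    finally show ?thesis .
  qed
  \<comment> \<open>A variance is nonnegative, and dropping the indicator of \<open>Z\<close> only
    enlarges the square.\<close>
  have "(expectation X)\<^sup>2 \<le> expectation (\<lambda>x. (X x)\<^sup>2)"
    using variance_eq[OF Xi X2i] variance_positive[of X] by simp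
  also have "\<dots> \<le> expectation (\<lambda>x. (T x)\<^sup>2)"
    by (rule integral_mono[OF X2i T2i]) (auto simp: X_def indicator_def)
  also note ET
  finally show ?thesis by (simp add: EX c_def)
qed

text \<open>If every \<open>k\<close> had some \<open>j\<close> with a summand of at least
  \<open>\<epsilon>\<close>, the double sum would be at least \<open>n * \<epsilon>\<close>. Summed
  over \<open>k\<close> first it is at most \<open>card J * sqrt (2 * n)\<close>, and for
  \<open>n\<close> beyond the stated bound these two estimates are incompatible.\<close>

lemma exists_small_summand:
  fixes S :: "nat \<Rightarrow> 'i \<Rightarrow> real"
  assumes J: "finite J" and n: "real n > 2 * (real (card J))\<^sup>2 / \<epsilon>\<^sup>2" and e: "0 < \<epsilon>"
    and nn: "\<And>k j. 0 \<le> S k j" and b: "\<And>j. j \<in> J \<Longrightarrow> (\<Sum>k<n. S k j)\<^sup>2 \<le> 2 * real n"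
  shows "\<exists>k<n. \<forall>j\<in>J. S k j < \<epsilon>"
proof (rule ccontr)
  assume A: "\<not> ?thesis"
  have np: "real n > 0"
  proof -
    have "0 \<le> 2 * (real (card J))\<^sup>2 / \<epsilon>\<^sup>2" by simp
    then show ?thesis using n by linarith
  qed
  have "real n * \<epsilon> = (\<Sum>k<n. \<epsilon>)" by simp
  also have "\<dots> \<le> (\<Sum>k<n. \<Sum>j\<in>J. S k j)"
  proof (rule sum_mono)
    fix k assume k: "k \<in> {..<n}"
    have "\<exists>j\<in>J. \<epsilon> \<le> S k j"
    proof (rule ccontr)
      assume "\<not> (\<exists>j\<in>J. \<epsilon> \<le> S k j)"
      then have "\<forall>j\<in>J. S k j < \<epsilon>" by (simp add: not_le)
      then have "\<exists>k<n. \<forall>j\<in>J. S k j < \<epsilon>" using k by (intro exI[of _ k]) simp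
      with A show False by (rule notE)
    qed
    then obtain j where j: "j \<in> J" "\<epsilon> \<le> S k j" by (elim bexE)
    have "S k j \<le> (\<Sum>j\<in>J. S k j)" using J j(1) nn by (intro member_le_sum) auto
    then show "\<epsilon> \<le> (\<Sum>j\<in>J. S k j)" using j(2) by simp
  qed
  also have "\<dots> = (\<Sum>j\<in>J. \<Sum>k<n. S k j)" by (rule sum.swap)
  also have "\<dots> \<le> (\<Sum>j\<in>J. sqrt (2 * real n))"
    by (intro sum_mono real_le_rsqrt b)
  also have "\<dots> = real (card J) * sqrt (2 * real n)" by simp
  finally have "(real n * \<epsilon>)\<^sup>2 \<le> (real (card J) * sqrt (2 * real n))\<^sup>2"
    using e np by (intro power_mono) auto
  then have "real n * (real n * \<epsilon>\<^sup>2) \<le> real n * (2 * (real (card J))\<^sup>2)"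
    by (simp add: power_mult_distrib power2_eq_square algebra_simps)
  then have "real n * \<epsilon>\<^sup>2 \<le> 2 * (real (card J))\<^sup>2" using np by simp
  moreover have "2 * (real (card J))\<^sup>2 < real n * \<epsilon>\<^sup>2" using n e by (simp add: divide_less_eq)
  ultimately show False by simp
qed

lemma EMD_imp_MD: "property_EMD G \<Longrightarrow> property_MD G"
  unfolding property_EMD_def property_MD_def
proof (intro allI impI)
  fix M :: "real measure"
  assume E: "\<forall>M :: real measure. standard_nonatomic M \<longrightarrow>
     action_space G M closure_of {a \<in> topspace (action_space G M). ergodic G M a \<and> profinite_action G M a}
       = topspace (action_space G M)" and M: "standard_nonatomic M"
  let ?X = "action_space G M"
  have "?X closure_of {a \<in> topspace ?X. ergodic G M a \<and> profinite_action G M a} \<subseteq>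
      ?X closure_of {a \<in> topspace ?X. profinite_action G M a}"
    by (rule closure_of_mono) auto
  then show "?X closure_of {a \<in> topspace ?X. profinite_action G M a} = topspace ?X"
    unfolding E[rule_format, OF M] using closure_of_subset_topspace by (intro equalityI)
qed

text \<open>The diagonal action on a power of \<open>D\<close>, as the case of
  \<open>pmp_action_PiM\<close> in which the indices stay fixed. The last clause is used for sets
  \<open>J\<close> of one and of two elements, where it says that the coordinates have law
  \<open>w\<close> and that their level sets are pairwise independent.\<close>

lemma iid_action:
  assumes G: "group G" and D: "gset G D c" and w: "weights G D c w"
  shows "\<exists>W a. pmp_action G W a \<and> space W = {..<n} \<rightarrow>\<^sub>E D \<and>
    (\<lambda>y. y) \<in> measurable W (count_space ({..<n} \<rightarrow>\<^sub>E D)) \<and>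
    (\<forall>g\<in>carrier G. \<forall>y\<in>space W. \<forall>k<n. a g y k = c g (y k)) \<and>
    (\<forall>J d. J \<subseteq> {..<n::nat} \<longrightarrow> d \<in> D \<longrightarrow> measure W {y\<in>space W. \<forall>k\<in>J. y k = d} = w d ^ card J)"
proof -
  interpret group G by fact
  have fD: "finite D" by (rule gsetD(1)[OF D])
  define P where "P = point_measure D (\<lambda>d. ennreal (w d))"
  have sP: "sets P = sets (count_space D)" "space P = D" by (simp_all add: P_def sets_point_measure space_point_measure)
  have w0: "0 \<le> w d" if "d \<in> D" for d using w that by (simp add: weights_def)
  have eP: "emeasure P A = ennreal (sum w A)" if "A \<subseteq> D" for A
    using that fD w0 by (simp add: P_def emeasure_point_measure_finite subset_eq sum_ennreal)
  have prob: "prob_space P"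
    by (rule prob_spaceI) (use eP[of D] w in \<open>simp add: sP weights_def\<close>)
  have cm: "c g \<in> measurable (count_space D) (count_space D)" if "g \<in> carrier G" for g
    using gsetD(2)[OF D that] by auto
  have cm': "c g \<in> measurable P (count_space D)" if "g \<in> carrier G" for g
    using cm[OF that] measurable_cong_sets[OF sP(1) refl] by blast
  have dis: "distr P (count_space D) (c g) = P" if g: "g \<in> carrier G" for g
  proof (rule measure_eqI)
    show "sets (distr P (count_space D) (c g)) = sets P" by (simp add: sP)
    fix A assume "A \<in> sets (distr P (count_space D) (c g))"
    then have A: "A \<subseteq> D" by simp
    have "emeasure (distr P (count_space D) (c g)) A = emeasure P (c g -` A \<inter> D)"
      using emeasure_distr[OF cm'[OF g], of A] A sP(2) by simp
    also have "\<dots> = ennreal (sum w (c g -` A \<inter> D))" by (rule eP) auto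
    also have "c g -` A \<inter> D = {d. d \<in> D \<and> c g d \<in> A}" by auto
    also have "sum w {d. d \<in> D \<and> c g d \<in> A} = sum w {d. d \<in> D \<and> d \<in> A}"
      by (rule weights_sum_translate[OF G D w g])
    also have "{d. d \<in> D \<and> d \<in> A} = A" using A by auto
    also have "ennreal (sum w A) = emeasure P A" using eP[OF A] by simp
    finally show "emeasure (distr P (count_space D) (c g)) A = emeasure P A" .
  qed
  have I: "gset G {..<n} (\<lambda>_ k. k)" by (simp add: gset_def)
  define W where "W = PiM {..<n} (\<lambda>_. P)"
  define a where "a = (\<lambda>g. \<lambda>x\<in>space W. \<lambda>k\<in>{..<n}. c g (x k))"
  have "pmp_action G (PiM {..<n} (\<lambda>_. P)) (\<lambda>g. \<lambda>x\<in>space (PiM {..<n} (\<lambda>_. P)). \<lambda>k\<in>{..<n}. c g (x ((\<lambda>_ k. k) (inv\<^bsub>G\<^esub> g) k)))"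
    by (rule pmp_action_PiM[where \<nu> = "\<lambda>_. P" and N = "count_space D" and b = c and \<sigma> = "\<lambda>_ k. k", OF G I prob sP(1) cm])
       (use gsetD[OF D] dis in auto)
  then have pa: "pmp_action G W a" by (simp add: W_def a_def)
  have spW: "space W = {..<n} \<rightarrow>\<^sub>E D" by (simp add: W_def space_PiM sP)
  interpret product_prob_space "\<lambda>_. P" "{..<n}"
    by (intro product_prob_space.intro product_prob_space_axioms.intro product_sigma_finite.intro prob prob_space_imp_sigma_finite)
  have "(\<lambda>y. y) \<in> measurable W (count_space ({..<n} \<rightarrow>\<^sub>E D))"
  proof (subst measurable_count_space_eq2, intro finite_PiE fD finite_lessThan, intro conjI ballI)
    show "(\<lambda>y. y) \<in> space W \<rightarrow> {..<n} \<rightarrow>\<^sub>E D" by (simp add: spW)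
    fix x assume x: "x \<in> {..<n} \<rightarrow>\<^sub>E D"
    have "(\<Pi>\<^sub>E k\<in>{..<n}. {x k}) \<in> sets W"
      unfolding W_def using x by (intro sets_PiM_I_finite) (auto simp: sP PiE_iff)
    moreover have "(\<Pi>\<^sub>E k\<in>{..<n}. {x k}) = {x}"
      using x by (intro PiE_singleton) (simp add: PiE_iff)
    moreover have "(\<lambda>y. y) -` {x} \<inter> space W = {x}" using x by (auto simp: spW)
    ultimately show "(\<lambda>y. y) -` {x} \<inter> space W \<in> sets W" by simp
  qed
  moreover have "measure W {y\<in>space W. \<forall>k\<in>J. y k = d} = w d ^ card J" if J: "J \<subseteq> {..<n}" and d: "d \<in> D" for J d
  proof -
    have fJ: "finite J" using J finite_subset by blast
    have "emeasure W {y\<in>space W. \<forall>k\<in>J. y k \<in> {d}} = (\<Prod>k\<in>J. emeasure P {d})"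
      unfolding W_def by (rule emeasure_PiM_Collect[OF J fJ]) (use d in \<open>auto simp: sP\<close>)
    also have "\<dots> = ennreal (w d ^ card J)" using d eP[of "{d}"] w0[OF d] by (simp add: ennreal_power)
    finally show ?thesis using w0[OF d] by (simp add: measure_def)
  qed
  moreover have "a g y k = c g (y k)" if "g \<in> carrier G" "y \<in> space W" "k < n" for g y k
    using that by (simp add: a_def)
  ultimately show ?thesis using pa spW by (intro exI[of _ W] exI[of _ a]) blast
qed

context completion begin

text \<open>EMD models the diagonal action on the power by a transitive set \<open>E\<close>. The
  orbit map \<open>\<xi>\<close> of the completion onto \<open>E\<close> has the unique invariant
  law, so each statistic of the power reappears on the completion up to \<open>\<delta>\<close>. The
  coordinates of \<open>f' \<circ> \<xi>\<close> are then almost equivariant and almost pairwise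
  independent, and the Bessel bound leaves at least one that is almost independent of every coset of
  \<open>N\<close>.\<close>

lemma randomize_EMD:
  fixes D :: "'d set"
  assumes EMD: "property_EMD G" and cG: "countable (carrier G)"
    and D: "gset G D c" and w: "weights G D c w" and N: "N \<in> \<F>"
    and S: "finite S" "S \<subseteq> carrier G" and e: "0 < \<epsilon>"
  shows "\<exists>\<eta>\<in>measurable \<mu> (count_space D).
    measure \<mu> {x\<in>space \<mu>. \<exists>s\<in>S. \<eta> (left_translation G (inv s) x) \<noteq> c (inv s) (\<eta> x)} < \<epsilon> \<and>
    (\<forall>C\<in>rcosets N. \<forall>d\<in>D. \<bar>measure \<mu> {x\<in>space \<mu>. x N = C \<and> \<eta> x = d} - measure \<mu> {x\<in>space \<mu>. x N = C} * w d\<bar> < \<epsilon>)"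
proof -
  interpret \<mu>: prob_space \<mu> by (rule prob_space_\<mu>)
  have fD: "finite D" by (rule gsetD(1)[OF D])
  define J where "J = (rcosets N) \<times> D"
  have fJ: "finite J" using fin_index_normalsD(2)[OF N] fD by (simp add: J_def)
  \<comment> \<open>The number of coordinates is fixed before the model, and it is what
    \<open>exists_small_summand\<close> needs in order to serve all pairs of a coset and a point of
    \<open>D\<close> by the same coordinate.\<close>
  obtain n where n: "real n > 2 * (real (card J))\<^sup>2 / \<epsilon>\<^sup>2" using reals_Archimedean2 by blast
  have np: "real n > 0"
  proof -
    have "0 \<le> 2 * (real (card J))\<^sup>2 / \<epsilon>\<^sup>2" by simp
    then show ?thesis using n by linarith
  qed
  \<comment> \<open>The first bound controls the failure of equivariance; the second makes the error
    term of the Bessel estimate at most \<open>n\<close>, so that the total is at most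
    \<open>2 * n\<close>.\<close>
  define \<delta> where "\<delta> = min \<epsilon> (1 / (3 * real n))"
  have \<delta>: "0 < \<delta>" "\<delta> \<le> \<epsilon>" "3 * real n * \<delta> \<le> 1"
  proof -
    show "0 < \<delta>" "\<delta> \<le> \<epsilon>" using e np by (auto simp: \<delta>_def)
    have "3 * real n * \<delta> \<le> 3 * real n * (1 / (3 * real n))" by (intro mult_left_mono) (auto simp: \<delta>_def)
    then show "3 * real n * \<delta> \<le> 1" using np by simp
  qed
  define V where "V = {..<n} \<rightarrow>\<^sub>E D"
  have fV: "finite V" unfolding V_def using fD by (intro finite_PiE) auto
  obtain W a where a: "pmp_action G W a" and spW: "space W = V"
    and idm: "(\<lambda>y. y) \<in> measurable W (count_space V)"
    and act: "\<forall>g\<in>carrier G. \<forall>y\<in>space W. \<forall>k<n. a g y k = c g (y k)"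
    and law: "\<forall>J d. J \<subseteq> {..<n} \<longrightarrow> d \<in> D \<longrightarrow> measure W {y\<in>space W. \<forall>k\<in>J. y k = d} = w d ^ card J"
    using iid_action[OF is_group D w, of n, folded V_def] by (elim exE conjE) (rule that)
  \<comment> \<open>With the identity in the window, a pattern contains the point itself besides its
    translates, so a failure of equivariance becomes a property of patterns.\<close>
  define S' where "S' = insert \<one> S"
  have S': "finite S'" "S' \<subseteq> carrier G" using S by (auto simp: S'_def)
  obtain E :: "real set set" and b w' f' where E: "gset G E b" and w': "weights G E b w'" and f': "\<forall>d. f' d \<in> V"
    and trans: "\<forall>d\<in>E. \<forall>d'\<in>E. \<exists>g\<in>carrier G. b g d = d'"
    and model: "\<forall>R. \<bar>measure W {y\<in>space W. R (\<lambda>s\<in>S'. a (inv s) y)} -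
      (\<Sum>d | d \<in> E \<and> R (\<lambda>s\<in>S'. f' (b (inv s) d)). w' d)\<bar> < \<delta>"
    using finite_model_EMD[OF EMD a cG idm fV S' \<delta>(1)] by (elim exE conjE) (rule that)
  have fE: "finite E" by (rule gsetD(1)[OF E])
  have "E \<noteq> {}" using w' by (auto simp: weights_def)
  then obtain d0 where d0: "d0 \<in> E" by auto
  define L where "L = ker_act G E b"
  have L: "L \<in> \<F>" unfolding L_def by (rule ker_act_fin_index[OF E])
  \<comment> \<open>The orbit map at an arbitrary base point; transitivity makes the choice of
    \<open>d0\<close> immaterial for the law.\<close>
  define \<xi> where "\<xi> x = coset_apply b (x L) d0" for x :: "'g set \<Rightarrow> 'g set"
  have \<xi>E: "\<xi> x \<in> E" if "x \<in> K" for x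
    unfolding \<xi>_def using coset_apply_closed[OF E _ d0] K_coset[OF that L] by (simp add: L_def)
  have \<xi>m: "\<xi> \<in> measurable \<mu> (count_space E)"
  proof (subst measurable_count_space_eq2[OF fE], intro conjI ballI)
    show "\<xi> \<in> space \<mu> \<rightarrow> E" using \<xi>E by (simp add: space_\<mu>)
    fix d
    have eq: "\<xi> -` {d} \<inter> space \<mu> = {x\<in>space \<mu>. x L \<in> {B. coset_apply b B d0 = d}}"
      by (rule Set.set_eqI)
        (simp only: \<xi>_def vimage_eq Int_iff mem_Collect_eq singleton_iff conj_commute)
    show "\<xi> -` {d} \<inter> space \<mu> \<in> sets \<mu>" unfolding eq by (rule eval_set[OF L])
  qed
  have \<xi>eq: "\<xi> (left_translation G g x) = b g (\<xi> x)" if g: "g \<in> carrier G" and x: "x \<in> K" for g x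
    unfolding \<xi>_def left_translation_apply[OF g x L]
    using coset_apply_act[OF E _ d0 g] K_coset[OF x L] by (simp add: L_def)
  have wE: "weights G E b (\<lambda>d. measure \<mu> {x\<in>space \<mu>. \<xi> x = d})"
    by (rule equivariant_weights[OF pmp_left_translation E \<xi>m]) (simp add: \<xi>eq space_\<mu>)
  have w'eq: "measure \<mu> {x\<in>space \<mu>. \<xi> x = d} = w' d" if "d \<in> E" for d
  proof -
    have t: "\<exists>g\<in>carrier G. b g i = j" if "i \<in> E" "j \<in> E" for i j using trans that by blast
    show ?thesis using transitive_weights[OF E wE t that] transitive_weights[OF E w' t that] by simp
  qed
  have \<xi>_set: "{x\<in>space \<mu>. Q (\<xi> x)} \<in> sets \<mu>"
    and \<xi>_law: "measure \<mu> {x\<in>space \<mu>. Q (\<xi> x)} = (\<Sum>d | d \<in> E \<and> Q d. w' d)" for Q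
  proof -
    have s: "{x\<in>space \<mu>. Q d} \<in> sets \<mu>" for d by (cases "Q d") simp_all
    show "{x\<in>space \<mu>. Q (\<xi> x)} \<in> sets \<mu>"
      by (rule measure_split(2)[OF \<mu>.finite_measure_axioms \<xi>m fE, of "\<lambda>d _. Q d", OF s])
    have "measure \<mu> {x\<in>space \<mu>. Q (\<xi> x)} = (\<Sum>d\<in>E. measure \<mu> {x\<in>space \<mu>. \<xi> x = d \<and> Q d})"
      by (rule measure_split(1)[OF \<mu>.finite_measure_axioms \<xi>m fE, of "\<lambda>d _. Q d", OF s])
    also have "\<dots> = (\<Sum>d\<in>E. if Q d then w' d else 0)"
      by (rule sum.cong) (auto simp: w'eq)
    also have "\<dots> = (\<Sum>d | d \<in> E \<and> Q d. w' d)" using fE by (simp add: sum.inter_filter)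
    finally show "measure \<mu> {x\<in>space \<mu>. Q (\<xi> x)} = (\<Sum>d | d \<in> E \<and> Q d. w' d)" .
  qed
  define \<eta> where "\<eta> k x = f' (\<xi> x) k" for k x
  have f'D: "f' d k \<in> D" if "k < n" for d k using f' that by (auto simp: V_def PiE_iff)
  have \<eta>m: "\<eta> k \<in> measurable \<mu> (count_space D)" if k: "k < n" for k
  proof (subst measurable_count_space_eq2[OF fD], intro conjI ballI)
    show "\<eta> k \<in> space \<mu> \<rightarrow> D" using f'D[OF k] by (simp add: \<eta>_def)
    fix d
    have "\<eta> k -` {d} \<inter> space \<mu> = {x\<in>space \<mu>. f' (\<xi> x) k = d}" by (auto simp: \<eta>_def)
    then show "\<eta> k -` {d} \<inter> space \<mu> \<in> sets \<mu>" using \<xi>_set[of "\<lambda>d'. f' d' k = d"] by (simp only:)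
  qed
  have oneS': "\<one> \<in> S'" by (simp add: S'_def)
  have a1: "a (inv \<one>) y = y" if "y \<in> space W" for y using pmp_actionD(6)[OF a that] by simp
  have b1: "b (inv \<one>) d = d" if "d \<in> E" for d using gsetD(3)[OF E that] by simp
  have model1: "\<bar>measure W {y\<in>space W. Q y} - measure \<mu> {x\<in>space \<mu>. Q (f' (\<xi> x))}\<bar> < \<delta>" for Q
  proof -
    have "{y\<in>space W. Q ((\<lambda>s\<in>S'. a (inv s) y) \<one>)} = {y\<in>space W. Q y}" using oneS' a1 by auto
    moreover have "{d. d \<in> E \<and> Q ((\<lambda>s\<in>S'. f' (b (inv s) d)) \<one>)} = {d. d \<in> E \<and> Q (f' d)}" using oneS' b1 by auto
    ultimately show ?thesis
      using model[rule_format, of "\<lambda>r. Q (r \<one>)"] \<xi>_law[of "\<lambda>d. Q (f' d)"] by simp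
  qed
  have bad: "measure \<mu> {x\<in>space \<mu>. \<exists>s\<in>S. \<eta> k (left_translation G (inv s) x) \<noteq> c (inv s) (\<eta> k x)} < \<delta>"
    if k: "k < n" for k
  proof -
    define R where "R r \<longleftrightarrow> (\<exists>s\<in>S. r s k \<noteq> c (inv s) (r \<one> k))" for r :: "'g \<Rightarrow> nat \<Rightarrow> 'd"
    have inS: "s \<in> S'" "inv s \<in> carrier G" if "s \<in> S" for s using that S by (auto simp: S'_def)
    \<comment> \<open>On the power itself the coordinates are equivariant everywhere, so this event
      is empty there, and the model can give it weight at most its tolerance.\<close>
    have "\<not> R (\<lambda>s\<in>S'. a (inv s) y)" if y: "y \<in> space W" for y
      using act k y inS oneS' a1[OF y] by (auto simp: R_def)
    then have e1: "{y\<in>space W. R (\<lambda>s\<in>S'. a (inv s) y)} = {}" by blast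
    have e2: "{d. d \<in> E \<and> R (\<lambda>s\<in>S'. f' (b (inv s) d))} =
      {d. d \<in> E \<and> (\<exists>s\<in>S. f' (b (inv s) d) k \<noteq> c (inv s) (f' d k))}"
      using inS oneS' b1 by (auto simp: R_def)
    have "\<bar>0 - (\<Sum>d | d \<in> E \<and> (\<exists>s\<in>S. f' (b (inv s) d) k \<noteq> c (inv s) (f' d k)). w' d)\<bar> < \<delta>"
      using model[rule_format, of R] unfolding e1 e2 measure_empty .
    then have "measure \<mu> {x\<in>space \<mu>. \<exists>s\<in>S. f' (b (inv s) (\<xi> x)) k \<noteq> c (inv s) (f' (\<xi> x) k)} < \<delta>"
      using \<xi>_law[of "\<lambda>d. \<exists>s\<in>S. f' (b (inv s) d) k \<noteq> c (inv s) (f' d k)"] by linarith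
    also have "{x\<in>space \<mu>. \<exists>s\<in>S. f' (b (inv s) (\<xi> x)) k \<noteq> c (inv s) (f' (\<xi> x) k)} =
      {x\<in>space \<mu>. \<exists>s\<in>S. \<eta> k (left_translation G (inv s) x) \<noteq> c (inv s) (\<eta> k x)}"
      using \<xi>eq inS by (auto simp: \<eta>_def space_\<mu>)
    finally show ?thesis .
  qed
  have \<eta>law: "\<bar>measure \<mu> {x\<in>space \<mu>. \<forall>k\<in>J. \<eta> k x = d} - w d ^ card J\<bar> < \<delta>" if "J \<subseteq> {..<n}" "d \<in> D" for J d
    using model1[of "\<lambda>y. \<forall>k\<in>J. y k = d"] law[rule_format, OF that] unfolding \<eta>_def by linarith
  define q where "q k j = \<bar>measure \<mu> {x\<in>space \<mu>. x N = fst j \<and> \<eta> k x = snd j} -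
    measure \<mu> {x\<in>space \<mu>. x N = fst j} * w (snd j)\<bar>" for k and j :: "'g set \<times> 'd"
  have "\<exists>k<n. \<forall>j\<in>J. q k j < \<epsilon>"
  proof (rule exists_small_summand[OF fJ n e])
    show "0 \<le> q k j" for k j by (simp add: q_def)
    fix j assume "j \<in> J"
    then obtain C d where j: "j = (C, d)" "C \<in> rcosets N" "d \<in> D" by (auto simp: J_def)
    define Z where "Z = {x\<in>space \<mu>. x N = C}"
    define H where "H k = {x\<in>space \<mu>. \<eta> k x = d}" for k
    have Z: "Z \<in> sets \<mu>" unfolding Z_def using eval_set[OF N, of "{C}"] by simp
    have H: "H k \<in> sets \<mu>" for k unfolding H_def \<eta>_def by (rule \<xi>_set)
    have v: "0 \<le> w d" "w d \<le> 1"
    proof -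
      show "0 \<le> w d" using w j(3) by (simp add: weights_def)
      have "w d \<le> sum w D" using w j(3) fD by (intro member_le_sum) (auto simp: weights_def)
      then show "w d \<le> 1" using w by (simp add: weights_def)
    qed
    have P1: "\<bar>measure \<mu> (H k) - w d\<bar> \<le> \<delta>" if "k < n" for k
      using \<eta>law[of "{k}" d] that j(3) by (simp add: H_def)
    \<comment> \<open>Two coordinates agreeing with \<open>d\<close> is one of the events whose
      probability in the power is known exactly, here the square of \<open>w d\<close>.\<close>
    have P2: "\<bar>measure \<mu> (H k \<inter> H k') - w d * w d\<bar> \<le> \<delta>" if "k < n" "k' < n" "k \<noteq> k'" for k k'
    proof -
      have "H k \<inter> H k' = {x\<in>space \<mu>. \<forall>i\<in>{k, k'}. \<eta> i x = d}" by (auto simp: H_def)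
      moreover have "card {k, k'} = 2" using that by simp
      ultimately show ?thesis
        using \<eta>law[of "{k, k'}" d] that j(3) by (simp add: power2_eq_square)
    qed
    have "(\<Sum>k<n. \<bar>measure \<mu> (Z \<inter> H k) - measure \<mu> Z * w d\<bar>)\<^sup>2 \<le> n + 3 * (real n)\<^sup>2 * \<delta>"
      using \<mu>.almost_independent_bessel[OF Z H v less_imp_le[OF \<delta>(1)] P1 P2] .
    also have "n + 3 * (real n)\<^sup>2 * \<delta> = n + real n * (3 * real n * \<delta>)" by (simp add: power2_eq_square)
    also have "\<dots> \<le> n + real n * 1" using \<delta>(3) by (intro add_left_mono mult_left_mono) auto
    finally have "(\<Sum>k<n. \<bar>measure \<mu> (Z \<inter> H k) - measure \<mu> Z * w d\<bar>)\<^sup>2 \<le> 2 * real n" by simp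
    moreover have "Z \<inter> H k = {x\<in>space \<mu>. x N = C \<and> \<eta> k x = d}" for k by (auto simp: Z_def H_def)
    ultimately show "(\<Sum>k<n. q k j)\<^sup>2 \<le> 2 * real n" by (simp add: q_def j(1) Z_def)
  qed
  then obtain k where k: "k < n" "\<forall>j\<in>J. q k j < \<epsilon>" by blast
  have "\<bar>measure \<mu> {x\<in>space \<mu>. x N = C \<and> \<eta> k x = d} - measure \<mu> {x\<in>space \<mu>. x N = C} * w d\<bar> < \<epsilon>"
    if "C \<in> rcosets N" "d \<in> D" for C d
    using k(2)[rule_format, of "(C, d)"] that by (simp add: J_def q_def)
  then show ?thesis using bad[OF k(1)] \<delta>(2) by (intro bexI[OF _ \<eta>m[OF k(1)]] conjI ballI) auto
qed

text \<open>The levels are the coordinates of the inverse limit. EMD enters twice: through MD in the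
  relative model of \<open>Y\<close>, and through transitive models in the construction of
  \<open>\<eta>\<close>.\<close>

lemma existentially_closed_completion:
  assumes EMD: "property_EMD G" and cG: "countable (carrier G)"
  shows "existentially_closed TYPE('y) G \<mu> (left_translation G)"
proof (rule existentially_closed_criterion[where L = "{(\<lambda>x. x N, rcosets N, coset_act N) | N. N \<in> \<F>}",
      OF EMD_imp_MD[OF EMD] cG pmp_left_translation])
  interpret \<mu>: prob_space \<mu> by (rule prob_space_\<mu>)
  fix l :: "('g set \<Rightarrow> 'g set) \<Rightarrow> 'g set" and I \<sigma>
  assume "(l, I, \<sigma>) \<in> {(\<lambda>x. x N, rcosets N, coset_act N) | N. N \<in> \<F>}"
  then obtain N where N: "N \<in> \<F>" "l = (\<lambda>x. x N)" "I = rcosets N" "\<sigma> = coset_act N" by blast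
  show "gset G I \<sigma> \<and> l \<in> measurable \<mu> (count_space I) \<and>
      (\<forall>g\<in>carrier G. \<forall>x\<in>space \<mu>. l (left_translation G g x) = \<sigma> g (l x)) \<and>
      (\<forall>j\<in>I. 0 < measure \<mu> {x\<in>space \<mu>. l x = j})"
    unfolding N(2-4) using gset_coset_act[OF N(1)] eval_measurable[OF N(1)] coset_measure(2)[OF N(1)]
      left_translation_apply[OF _ _ N(1)] by (simp add: space_\<mu>)
  {
    fix D :: "real set set" and c w S and \<epsilon> :: real
    assume "gset G D c" "weights G D c w" "finite S" "S \<subseteq> carrier G" "0 < \<epsilon>"
    from randomize_EMD[OF EMD cG this(1,2) N(1) this(3-5)]
    show "\<exists>\<eta>\<in>measurable \<mu> (count_space D).
        measure \<mu> {x\<in>space \<mu>. \<exists>s\<in>S. \<eta> (left_translation G (inv s) x) \<noteq> c (inv s) (\<eta> x)} < \<epsilon> \<and>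
        (\<forall>j\<in>I. \<forall>d\<in>D. \<bar>measure \<mu> {x\<in>space \<mu>. l x = j \<and> \<eta> x = d} -
          measure \<mu> {x\<in>space \<mu>. l x = j} * w d\<bar> < \<epsilon>)" unfolding N(2,3) .
  }
next
  interpret \<mu>: prob_space \<mu> by (rule prob_space_\<mu>)
  fix q \<beta> and \<epsilon> :: real
  assume \<beta>: "\<beta> \<in> measurable \<mu> (count_space {..<q::nat})" and e: "0 < \<epsilon>"
  have q: "0 < q" using \<mu>.not_empty measurable_space[OF \<beta>] by fastforce
  have "approx_set \<mu> levels {x\<in>space \<mu>. \<beta> x = j}" for j
    by (rule approx_\<mu>, rule measure_split(2)[OF \<mu>.finite_measure_axioms \<beta> finite_lessThan, of "\<lambda>i _. i = j"]) simp
  then obtain l u where l: "l \<in> levels" "measure \<mu> {x\<in>space \<mu>. \<beta> x \<noteq> u (l x)} < \<epsilon>"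
    using \<mu>.approx_fun[OF level_family_levels q \<beta> _ e] by blast
  then obtain N where "N \<in> \<F>" "l = (\<lambda>x. x N)" by (auto simp: levels_def)
  then show "\<exists>l I \<sigma> v. (l, I, \<sigma>) \<in> {(\<lambda>x. x N, rcosets N, coset_act N) | N. N \<in> \<F>} \<and>
      measure \<mu> {x\<in>space \<mu>. \<beta> x \<noteq> v (l x)} < \<epsilon>"
    using l(2) by (intro exI[of _ l] exI[of _ "rcosets N"] exI[of _ "coset_act N"] exI[of _ u]) auto
qed

definition act2 :: "'g set \<Rightarrow> 'g \<Rightarrow> 'g set \<times> nat \<Rightarrow> 'g set \<times> nat" where
  "act2 N g j = (coset_act N g (fst j), snd j)"

text \<open>A level pairs a coset with a cell, and the group moves only the coset. The map supplied
  by \<open>randomize_X2\<close> meets the two estimates of the criterion with error zero.\<close>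

lemma existentially_closed_completion_times_interval:
  assumes MD: "property_MD G" and cG: "countable (carrier G)"
  shows "existentially_closed TYPE('y) G X2 (times_trivial (space \<mu>) {0..1} (left_translation G))"
proof (rule existentially_closed_criterion[where
      L = "{(level2 N m, (rcosets N) \<times> {..<m}, act2 N) | N m. N \<in> \<F> \<and> 0 < m}",
      OF MD cG pmp_times_trivial[OF pmp_left_translation]])
  interpret X2: prob_space X2 by (rule prob_space_X2)
  fix l :: "('g set \<Rightarrow> 'g set) \<times> real \<Rightarrow> 'g set \<times> nat" and I \<sigma>
  assume "(l, I, \<sigma>) \<in> {(level2 N m, (rcosets N) \<times> {..<m}, act2 N) | N m. N \<in> \<F> \<and> 0 < m}"
  then obtain N m where N: "N \<in> \<F>" "0 < m" "l = level2 N m" "I = (rcosets N) \<times> {..<m}"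
    "\<sigma> = act2 N" by blast
  have "gset G ((rcosets N) \<times> {..<m}) (act2 N)"
    using gset_coset_act[OF N(1)] by (auto simp: gset_def act2_def)
  moreover have "level2 N m (times_trivial (space \<mu>) {0..1} (left_translation G) g z) =
      act2 N g (level2 N m z)" if g: "g \<in> carrier G" and z: "z \<in> space X2" for g z
  proof -
    have z': "fst z \<in> K" "snd z \<in> {0..1}" using z by (auto simp: space_X2)
    have "times_trivial (space \<mu>) {0..1} (left_translation G) g z = (left_translation G g (fst z), snd z)"
      using z' by (auto simp: times_trivial_def case_prod_beta' mem_Times_iff space_\<mu>)
    then show ?thesis using left_translation_apply[OF g z'(1) N(1)] by (simp add: level2_def act2_def)
  qed
  moreover have "0 < measure X2 {z\<in>space X2. level2 N m z = j}" if "j \<in> (rcosets N) \<times> {..<m}" for j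
    using that level2_event(2)[OF N(1,2)] coset_measure(2)[OF N(1)] N(2) by auto
  ultimately show "gset G I \<sigma> \<and> l \<in> measurable X2 (count_space I) \<and>
      (\<forall>g\<in>carrier G. \<forall>x\<in>space X2. l (times_trivial (space \<mu>) {0..1} (left_translation G) g x) = \<sigma> g (l x)) \<and>
      (\<forall>j\<in>I. 0 < measure X2 {x\<in>space X2. l x = j})"
    unfolding N(3-5) using level2_measurable[OF N(1,2)] by blast
  {
    fix D :: "real set set" and c w S and \<epsilon> :: real
    assume D: "gset G D c" "weights G D c w" and S: "finite S" "S \<subseteq> carrier G" and e: "0 < \<epsilon>"
    obtain \<eta> where \<eta>: "\<eta> \<in> measurable X2 (count_space D)"
      "measure X2 {z\<in>space X2. \<exists>s\<in>S. \<eta> (times_trivial K {0..1} (left_translation G) (inv s) z) \<noteq> c (inv s) (\<eta> z)} = 0"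
      "\<forall>j\<in>(rcosets N) \<times> {..<m}. \<forall>d\<in>D. measure X2 {z\<in>space X2. level2 N m z = j \<and> \<eta> z = d} =
        measure X2 {z\<in>space X2. level2 N m z = j} * w d"
      using randomize_X2[OF D N(1,2) S(2)] by (elim bexE conjE) (rule that)
    show "\<exists>\<eta>\<in>measurable X2 (count_space D).
        measure X2 {x\<in>space X2. \<exists>s\<in>S. \<eta> (times_trivial (space \<mu>) {0..1} (left_translation G) (inv s) x) \<noteq> c (inv s) (\<eta> x)} < \<epsilon> \<and>
        (\<forall>j\<in>I. \<forall>d\<in>D. \<bar>measure X2 {x\<in>space X2. l x = j \<and> \<eta> x = d} -
          measure X2 {x\<in>space X2. l x = j} * w d\<bar> < \<epsilon>)"
      unfolding N(3,4) space_\<mu> using \<eta>(2,3) e by (intro bexI[OF _ \<eta>(1)]) simp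
  }
next
  interpret X2: prob_space X2 by (rule prob_space_X2)
  fix q \<beta> and \<epsilon> :: real
  assume \<beta>: "\<beta> \<in> measurable X2 (count_space {..<q::nat})" and e: "0 < \<epsilon>"
  have q: "0 < q" using X2.not_empty measurable_space[OF \<beta>] by fastforce
  have "approx_set X2 levels2 {x\<in>space X2. \<beta> x = j}" for j
    by (rule approx_X2, rule measure_split(2)[OF X2.finite_measure_axioms \<beta> finite_lessThan, of "\<lambda>i _. i = j"]) simp
  then obtain l u where l: "l \<in> levels2" "measure X2 {x\<in>space X2. \<beta> x \<noteq> u (l x)} < \<epsilon>"
    using X2.approx_fun[OF level_family2 q \<beta> _ e] by blast
  then obtain N m where N: "N \<in> \<F>" "0 < m" "l = level2 N m" by (auto simp: levels2_def)
  have "(l, (rcosets N) \<times> {..<m}, act2 N) \<in>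
      {(level2 N m, (rcosets N) \<times> {..<m}, act2 N) | N m. N \<in> \<F> \<and> 0 < m}"
    using N by blast
  then show "\<exists>l I \<sigma> v. (l, I, \<sigma>) \<in> {(level2 N m, (rcosets N) \<times> {..<m}, act2 N) | N m. N \<in> \<F> \<and> 0 < m} \<and>
      measure X2 {x\<in>space X2. \<beta> x \<noteq> v (l x)} < \<epsilon>"
    using l(2) by (intro exI conjI)
qed

end

theorem theorem4p2:
  fixes G :: "('g, 'm) monoid_scheme" and \<mu> :: "('g set \<Rightarrow> 'g set) measure"
  assumes "group G" and "countable (carrier G)" and "residually_finite G"
    and "normalized_haar_measure (profinite_completion G) (profinite_topology G) \<mu>"
  shows "(property_EMD G \<longrightarrow>
            existentially_closed TYPE('y) G \<mu> (left_translation G)) \<and>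
         (property_MD G \<longrightarrow>
            existentially_closed TYPE('y) G (\<mu> \<Otimes>\<^sub>M restrict_space lborel {0..1::real})
              (times_trivial (space \<mu>) {0..1} (left_translation G)))"
proof -
  interpret completion G \<mu>
    using assms(1,4) by (simp add: completion_def completion_axioms_def)
  show ?thesis
    using existentially_closed_completion[OF _ assms(2)]
      existentially_closed_completion_times_interval[OF _ assms(2)] by blast
qed

end
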